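(* Let $l$ be a field, $G$ a finite group acting on $l$ by field automorphisms, $k:=l^G$ and $H:=\operatorname{Ker}(G\to\operatorname{Gal}(l/k))$. \begin{enumerate} \item There exists a bijection \[\operatorname{Gal}(l/k)\backslash\operatorname{sim}lH\cong\operatorname{sim}l*G.\] \item Decompose $\operatorname{sim}lH$ into the disjoint union of the orbits of the $\operatorname{Gal}(l/k)$-action, \[\operatorname{sim}lH=\bigsqcup_{i=1}^{s}\{W_{i1},\ldots,W_{it_i}\},\] and let $V_i\in\operatorname{sim}l*G$ be the simple left $l*G$-module corresponding to $\{W_{i1},\ldots,W_{it_i}\}$ under the bijection of (1). Then for each $1\le i\le s$ there exist integers $a_i,b_i\ge1$ satisfying \[\operatorname{Res}_HV_i\cong(W_{i1}\oplus\cdots\oplus W_{it_i})^{\oplus a_i},\] \[\operatorname{Ind}_H^GW_{ij}\cong V_i^{\oplus b_i}\quad\text{for each }1\le j\le t_i,\] \[t_ia_ib_i=[l:k].\] \end{enumerate}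
   Context: $l/k$ is a finite Galois extension and $G/H\cong\operatorname{Gal}(l/k)$. No assumption is made on $\operatorname{char} l$ or $|G|$. $l*G$ is the skew group ring (free left $l$-module on $G$ with $(\lambda*g)(\mu*h)=\lambda g(\mu)*gh$); it contains the group algebra $lH$. $\operatorname{sim}A$ is the set of isomorphism classes of simple left $A$-modules. $\operatorname{Res}_H\colon\mathsf{mod}\,l*G\to\mathsf{mod}\,lH$ is restriction and $\operatorname{Ind}_H^G:=(l*G)\otimes_{lH}-$. For $g\in G$ and $W\in\mathsf{mod}\,lH$, set $gW:=g\otimes W=\{g\otimes w\mid w\in W\}\subseteq(l*G)\otimes_{lH}W$, an $lH$-submodule; i.e. $W$ with the $lH$-action twisted by conjugation in $l*G$, $\lambda h\cdot(g\otimes w)=g\otimes\bigl(g^{-1}(\lambda)\,(g^{-1}hg)\,w\bigr)$. Since $hW\cong W$ for $h\in H$, this gives an action of $\operatorname{Gal}(l/k)\cong G/H$ on $\operatorname{sim}lH$. *)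

theory Defs
  imports "HOL-Algebra.Algebra"
begin

section \<open>Left modules over a not necessarily commutative ring\<close>

text \<open>
  The library locale \<^locale>\<open>module\<close> requires a commutative ring of scalars. The record type
  and the locale \<^locale>\<open>submodule\<close> do not, and are reused here; the fields \<open>mult\<close> and \<open>one\<close>
  of a module record play no role.
\<close>

locale left_module = R?: ring R + M?: abelian_group M
  for R :: "('a, 'r) ring_scheme" (structure)
    and M :: "('a, 'm, 'x) module_scheme" (structure) +
  assumes smult_closed [simp, intro]:
      "\<lbrakk>a \<in> carrier R; x \<in> carrier M\<rbrakk> \<Longrightarrow> a \<odot>\<^bsub>M\<^esub> x \<in> carrier M"
    and smult_l_distr:
      "\<lbrakk>a \<in> carrier R; b \<in> carrier R; x \<in> carrier M\<rbrakk> \<Longrightarrow>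
        (a \<oplus> b) \<odot>\<^bsub>M\<^esub> x = a \<odot>\<^bsub>M\<^esub> x \<oplus>\<^bsub>M\<^esub> b \<odot>\<^bsub>M\<^esub> x"
    and smult_r_distr:
      "\<lbrakk>a \<in> carrier R; x \<in> carrier M; y \<in> carrier M\<rbrakk> \<Longrightarrow>
        a \<odot>\<^bsub>M\<^esub> (x \<oplus>\<^bsub>M\<^esub> y) = a \<odot>\<^bsub>M\<^esub> x \<oplus>\<^bsub>M\<^esub> a \<odot>\<^bsub>M\<^esub> y"
    and smult_assoc1:
      "\<lbrakk>a \<in> carrier R; b \<in> carrier R; x \<in> carrier M\<rbrakk> \<Longrightarrow>
        (a \<otimes> b) \<odot>\<^bsub>M\<^esub> x = a \<odot>\<^bsub>M\<^esub> (b \<odot>\<^bsub>M\<^esub> x)"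
    and smult_one [simp]: "x \<in> carrier M \<Longrightarrow> \<one> \<odot>\<^bsub>M\<^esub> x = x"

definition simple_left_module ::
    "('a, 'r) ring_scheme \<Rightarrow> ('a, 'm, 'x) module_scheme \<Rightarrow> bool"
  where "simple_left_module R M \<longleftrightarrow>
    left_module R M \<and> carrier M \<noteq> {\<zero>\<^bsub>M\<^esub>} \<and>
    (\<forall>N. submodule N R M \<longrightarrow> N = {\<zero>\<^bsub>M\<^esub>} \<or> N = carrier M)"

definition left_module_hom ::
    "('a, 'r) ring_scheme \<Rightarrow> ('a, 'm, 'x) module_scheme \<Rightarrow> ('a, 'n, 'y) module_scheme \<Rightarrow> ('m \<Rightarrow> 'n) set"
  where "left_module_hom R M N =
    {f \<in> hom (add_monoid M) (add_monoid N).
       \<forall>a\<in>carrier R. \<forall>x\<in>carrier M. f (a \<odot>\<^bsub>M\<^esub> x) = a \<odot>\<^bsub>N\<^esub> f x}"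

definition left_module_iso ::
    "('a, 'r) ring_scheme \<Rightarrow> ('a, 'm, 'x) module_scheme \<Rightarrow> ('a, 'n, 'y) module_scheme \<Rightarrow> bool"
  where "left_module_iso R M N \<longleftrightarrow>
    (\<exists>f\<in>left_module_hom R M N. bij_betw f (carrier M) (carrier N))"

text \<open>
  Isomorphism classes are formed among the modules whose elements are sets of ring elements. Every
  simple left module over \<open>R\<close>, on whatever type, is isomorphic to one of these, namely to a
  quotient of \<open>R\<close> by a maximal left ideal; see lemma \<open>simple_left_module_represented\<close> below.
\<close>

definition iso_class ::
    "('a, 'r) ring_scheme \<Rightarrow> ('a, 'm, 'x) module_scheme \<Rightarrow> ('a, 'a set) module set"
  where "iso_class R M = {N. left_module R N \<and> left_module_iso R N M}"

definition sim :: "('a, 'r) ring_scheme \<Rightarrow> ('a, 'a set) module set set"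
  where "sim R = {iso_class R M | M :: ('a, 'a set) module. simple_left_module R M}"

lemma left_module_transport:
  fixes M :: "('a, 'm, 'x) module_scheme" and f :: "'m \<Rightarrow> 'n"
  assumes M: "left_module R M" and f: "inj_on f (carrier M)"
  obtains N :: "('a, 'n) module"
  where "left_module R N" "carrier N = f ` carrier M" "f \<in> left_module_hom R M N"
proof -
  interpret left_module R M by (rule M)
  define g where "g = inv_into (carrier M) f"
  have gf[simp]: "g (f x) = x" if "x \<in> carrier M" for x
    unfolding g_def using f that by simp
  define N :: "('a, 'n) module" where "N = \<lparr>carrier = f ` carrier M,
     monoid.mult = (\<lambda>x y. undefined), one = undefined,
     ring.zero = f \<zero>\<^bsub>M\<^esub>, ring.add = (\<lambda>x y. f (g x \<oplus>\<^bsub>M\<^esub> g y)),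
     module.smult = (\<lambda>a x. f (a \<odot>\<^bsub>M\<^esub> g x))\<rparr>"
  have "abelian_group N"
  proof (rule abelian_groupI)
    fix x assume "x \<in> carrier N"
    then obtain x' where "x' \<in> carrier M" "x = f x'" by (auto simp: N_def)
    then show "\<exists>y\<in>carrier N. y \<oplus>\<^bsub>N\<^esub> x = \<zero>\<^bsub>N\<^esub>"
      by (intro bexI[of _ "f (\<ominus>\<^bsub>M\<^esub> x')"]) (auto simp: N_def M.l_neg)
  qed (auto simp: N_def M.a_ac)
  then have "left_module R N"
    by (intro left_module.intro left_module_axioms.intro R.ring_axioms)
      (auto simp: N_def smult_l_distr smult_r_distr smult_assoc1)
  moreover have "f \<in> left_module_hom R M N"
    by (auto simp: left_module_hom_def hom_def N_def)
  ultimately show thesis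
    by (intro that[of N]) (auto simp: N_def)
qed

lemma simple_left_module_iso:
  assumes M: "simple_left_module R M" and N: "left_module R N" and iso: "left_module_iso R M N"
  shows "simple_left_module R N"
proof -
  interpret M: left_module R M using M by (simp add: simple_left_module_def)
  interpret N: left_module R N by (rule N)
  obtain f where f: "f \<in> left_module_hom R M N" and bij: "bij_betw f (carrier M) (carrier N)"
    using iso by (auto simp: left_module_iso_def)
  have fc: "f x \<in> carrier N" if "x \<in> carrier M" for x
    using bij that by (auto simp: bij_betw_def)
  have fadd: "f (x \<oplus>\<^bsub>M\<^esub> y) = f x \<oplus>\<^bsub>N\<^esub> f y" if "x \<in> carrier M" "y \<in> carrier M" for x y
    using f that by (auto simp: left_module_hom_def hom_def)
  have fsm: "f (a \<odot>\<^bsub>M\<^esub> x) = a \<odot>\<^bsub>N\<^esub> f x" if "a \<in> carrier R" "x \<in> carrier M" for x a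
    using f that by (auto simp: left_module_hom_def)
  interpret gh: group_hom "add_monoid M" "add_monoid N" f
    using f M.add.is_group N.add.is_group
    by (simp add: group_hom_def group_hom_axioms_def left_module_hom_def)
  have f0: "f \<zero>\<^bsub>M\<^esub> = \<zero>\<^bsub>N\<^esub>" using gh.hom_one by simp
  have inj: "inj_on f (carrier M)" and im: "f ` carrier M = carrier N"
    using bij by (auto simp: bij_betw_def)
  have "carrier N \<noteq> {\<zero>\<^bsub>N\<^esub>}"
  proof
    assume "carrier N = {\<zero>\<^bsub>N\<^esub>}"
    then have "x = \<zero>\<^bsub>M\<^esub>" if "x \<in> carrier M" for x
      using inj_onD[OF inj, of x "\<zero>\<^bsub>M\<^esub>"] that fc[OF that] f0 by simp
    then have "carrier M = {\<zero>\<^bsub>M\<^esub>}" by auto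
    then show False using M by (simp add: simple_left_module_def)
  qed
  moreover have "P = {\<zero>\<^bsub>N\<^esub>} \<or> P = carrier N" if P: "submodule P R N" for P
  proof -
    interpret P: submodule P R N by (rule P)
    have "subgroup (f -` P \<inter> carrier M) (add_monoid M)"
    proof (rule M.add.subgroupI)
      show "f -` P \<inter> carrier M \<noteq> {}" using f0 P.one_closed by auto
    next
      fix a assume "a \<in> f -` P \<inter> carrier M"
      then show "\<ominus>\<^bsub>M\<^esub> a \<in> f -` P \<inter> carrier M"
        using gh.hom_inv[of a] P.m_inv_closed[of "f a"] by (auto simp: a_inv_def)
    qed (use P.m_closed fadd in auto)
    then have "submodule (f -` P \<inter> carrier M) R M"
      by (auto simp: submodule_def submodule_axioms_def fsm)
    then have "f -` P \<inter> carrier M = {\<zero>\<^bsub>M\<^esub>} \<or> f -` P \<inter> carrier M = carrier M"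
      using M unfolding simple_left_module_def by blast
    moreover have "P = f ` (f -` P \<inter> carrier M)"
    proof -
      have "P \<subseteq> f ` carrier M" using im P.subset by simp
      then show ?thesis by blast
    qed
    ultimately show ?thesis using f0 im by (elim disjE) simp_all
  qed
  ultimately show ?thesis using N by (auto simp: simple_left_module_def)
qed

lemma simple_left_module_represented:
  fixes M :: "('a, 'm, 'x) module_scheme"
  assumes M: "simple_left_module R M"
  obtains N :: "('a, 'a set) module" where "simple_left_module R N" "left_module_iso R M N"
proof -
  interpret left_module R M using M by (simp add: simple_left_module_def)
  obtain v where v: "v \<in> carrier M" "v \<noteq> \<zero>\<^bsub>M\<^esub>"
    using M by (auto simp: simple_left_module_def)
  define f where "f = (\<lambda>w. {a \<in> carrier R. a \<odot>\<^bsub>M\<^esub> v = w})"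
  let ?P = "(\<lambda>a. a \<odot>\<^bsub>M\<^esub> v) ` carrier R"
  have "subgroup ?P (add_monoid M)"
  proof (rule M.add.subgroupI)
    fix a assume "a \<in> ?P"
    then obtain r where r: "r \<in> carrier R" "a = r \<odot>\<^bsub>M\<^esub> v" by auto
    have z: "\<zero>\<^bsub>R\<^esub> \<odot>\<^bsub>M\<^esub> v = \<zero>\<^bsub>M\<^esub>"
      using smult_l_distr[of "\<zero>\<^bsub>R\<^esub>" "\<zero>\<^bsub>R\<^esub>" v] v(1)
      by (metis M.add.l_cancel_one' R.l_zero R.zero_closed smult_closed)
    have "(\<ominus>\<^bsub>R\<^esub> r) \<odot>\<^bsub>M\<^esub> v \<oplus>\<^bsub>M\<^esub> a = \<zero>\<^bsub>M\<^esub>"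
      using r v(1) smult_l_distr[of "\<ominus>\<^bsub>R\<^esub> r" r v] z by (simp add: R.l_neg)
    then have "\<ominus>\<^bsub>M\<^esub> a = (\<ominus>\<^bsub>R\<^esub> r) \<odot>\<^bsub>M\<^esub> v"
      using r v(1) M.minus_equality by simp
    then show "\<ominus>\<^bsub>M\<^esub> a \<in> ?P" using r by auto
  next
    fix a b assume "a \<in> ?P" "b \<in> ?P"
    then show "a \<oplus>\<^bsub>M\<^esub> b \<in> ?P"
      using v(1) by (auto simp flip: smult_l_distr)
  qed (use v in auto)
  then have "submodule ?P R M"
    using v(1) by (auto simp: submodule_def submodule_axioms_def simp flip: smult_assoc1)
  moreover have "v \<in> ?P" using v by (force intro: image_eqI[of _ _ "\<one>\<^bsub>R\<^esub>"])
  ultimately have P: "?P = carrier M"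
    using M v unfolding simple_left_module_def by blast
  have "inj_on f (carrier M)"
  proof (rule inj_onI)
    fix x y assume "x \<in> carrier M" "f x = f y"
    moreover from this(1) obtain a where "a \<in> carrier R" "x = a \<odot>\<^bsub>M\<^esub> v" using P by auto
    ultimately show "x = y" by (auto simp: f_def)
  qed
  from left_module_transport[OF left_module_axioms this] obtain N :: "('a, 'a set) module"
    where N: "left_module R N" "carrier N = f ` carrier M" "f \<in> left_module_hom R M N" .
  then have "left_module_iso R M N"
    using \<open>inj_on f (carrier M)\<close> by (auto simp: left_module_iso_def bij_betw_def)
  with simple_left_module_iso[OF M N(1)] show thesis by (intro that)
qed

text \<open>The external direct sum of a family of modules over a finite index set \<open>I\<close>.\<close>

definition direct_sum :: "'i set \<Rightarrow> ('i \<Rightarrow> ('a, 'm, 'x) module_scheme) \<Rightarrow> ('a, 'i \<Rightarrow> 'm) module"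
  where "direct_sum I M =
    \<lparr>carrier = (\<Pi>\<^sub>E i\<in>I. carrier (M i)),
     monoid.mult = (\<lambda>x y. undefined), one = undefined,
     ring.zero = (\<lambda>i\<in>I. \<zero>\<^bsub>M i\<^esub>),
     ring.add = (\<lambda>x y. \<lambda>i\<in>I. x i \<oplus>\<^bsub>M i\<^esub> y i),
     module.smult = (\<lambda>a x. \<lambda>i\<in>I. a \<odot>\<^bsub>M i\<^esub> x i)\<rparr>"

abbreviation module_power :: "('a, 'm, 'x) module_scheme \<Rightarrow> nat \<Rightarrow> ('a, nat \<Rightarrow> 'm) module"
  where "module_power M n \<equiv> direct_sum {..<n} (\<lambda>_. M)"


section \<open>Induction along a subring\<close>

text \<open>
  For a ring \<open>A\<close>, a subring \<open>B\<close> of it (a ring record with the operations of \<open>A\<close>) and a left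
  \<open>B\<close>-module \<open>W\<close>, the tensor product of \<open>A\<close> and \<open>W\<close> over \<open>B\<close> is the free abelian group on
  \<open>carrier A \<times> carrier W\<close> modulo the relations of biadditivity and \<open>B\<close>-balancedness. Scalars in
  \<open>A\<close> act by left multiplication on the first factor; the union in the last field is over sets
  that are all equal (lemma \<open>induced_module_smult_pure_tensor\<close>). Restriction to \<open>B\<close> needs no construction: the same record is used over \<open>B\<close>.
\<close>

definition tensor_relations ::
    "('a, 'r) ring_scheme \<Rightarrow> ('a, 's) ring_scheme \<Rightarrow> ('a, 'w, 'x) module_scheme \<Rightarrow> ('a \<times> 'w \<Rightarrow>\<^sub>0 int) set"
  where "tensor_relations A B W =
    {frag_of (a \<oplus>\<^bsub>A\<^esub> a', w) - (frag_of (a, w) + frag_of (a', w)) | a a' w.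
       a \<in> carrier A \<and> a' \<in> carrier A \<and> w \<in> carrier W}
    \<union> {frag_of (a, w \<oplus>\<^bsub>W\<^esub> w') - (frag_of (a, w) + frag_of (a, w')) | a w w'.
       a \<in> carrier A \<and> w \<in> carrier W \<and> w' \<in> carrier W}
    \<union> {frag_of (a \<otimes>\<^bsub>A\<^esub> b, w) - frag_of (a, b \<odot>\<^bsub>W\<^esub> w) | a b w.
       a \<in> carrier A \<and> b \<in> carrier B \<and> w \<in> carrier W}"

definition tensor_free ::
    "('a, 'r) ring_scheme \<Rightarrow> ('a, 'w, 'x) module_scheme \<Rightarrow> ('a \<times> 'w \<Rightarrow>\<^sub>0 int) monoid"
  where "tensor_free A W = free_Abelian_group (carrier A \<times> carrier W)"

definition tensor_null ::
    "('a, 'r) ring_scheme \<Rightarrow> ('a, 's) ring_scheme \<Rightarrow> ('a, 'w, 'x) module_scheme \<Rightarrow> ('a \<times> 'w \<Rightarrow>\<^sub>0 int) set"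
  where "tensor_null A B W = generate (tensor_free A W) (tensor_relations A B W)"

definition pure_tensor ::
    "('a, 'r) ring_scheme \<Rightarrow> ('a, 's) ring_scheme \<Rightarrow> ('a, 'w, 'x) module_scheme \<Rightarrow>
      'a \<Rightarrow> 'w \<Rightarrow> ('a \<times> 'w \<Rightarrow>\<^sub>0 int) set"
  where "pure_tensor A B W a w = tensor_null A B W #>\<^bsub>tensor_free A W\<^esub> frag_of (a, w)"

definition induced_module ::
    "('a, 'r) ring_scheme \<Rightarrow> ('a, 's) ring_scheme \<Rightarrow> ('a, 'w, 'x) module_scheme \<Rightarrow>
      ('a, ('a \<times> 'w \<Rightarrow>\<^sub>0 int) set) module"
  where "induced_module A B W =
    (let T = tensor_free A W Mod tensor_null A B W in
    \<lparr>carrier = carrier T,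
     monoid.mult = (\<lambda>x y. undefined), one = undefined,
     ring.zero = \<one>\<^bsub>T\<^esub>,
     ring.add = monoid.mult T,
     module.smult = (\<lambda>a p. \<Union>x\<in>p. tensor_null A B W #>\<^bsub>tensor_free A W\<^esub>
                 frag_extend (\<lambda>(a', w). frag_of (a \<otimes>\<^bsub>A\<^esub> a', w)) x)\<rparr>)"

lemma induced_module_smult_pure_tensor:
  fixes A :: "('a, 'r) ring_scheme" and W :: "('a, 'w, 'x) module_scheme"
  assumes A: "ring A" and B: "subring (carrier B) A"
    and a: "a \<in> carrier A" and a': "a' \<in> carrier A" and w: "w \<in> carrier W"
    and W: "left_module B W"
  shows "a \<odot>\<^bsub>induced_module A B W\<^esub> pure_tensor A B W a' w = pure_tensor A B W (a \<otimes>\<^bsub>A\<^esub> a') w"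
proof -
  interpret A: ring A by fact
  interpret W: left_module B W by fact
  interpret B: subring "carrier B" A by fact
  interpret T: comm_group "tensor_free A W"
    by (simp add: tensor_free_def abelian_free_Abelian_group)
  let ?f = "frag_extend (\<lambda>(a', w). frag_of (a \<otimes>\<^bsub>A\<^esub> a', w :: 'w))"
  have rel: "tensor_relations A B W \<subseteq> carrier (tensor_free A W)"
    using B.subset unfolding tensor_relations_def tensor_free_def
    by (auto dest!: subsetD[OF keys_diff] subsetD[OF keys_add] split: if_splits)
  then interpret N: subgroup "tensor_null A B W" "tensor_free A W"
    unfolding tensor_null_def by (rule T.generate_is_subgroup)
  have frel: "?f x \<in> tensor_relations A B W" if "x \<in> tensor_relations A B W" for x
    using that unfolding tensor_relations_def
    apply (elim UnE CollectE exE conjE)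
    subgoal for b b' v
      by (intro UnI1 CollectI exI[of _ "a \<otimes>\<^bsub>A\<^esub> b"] exI[of _ "a \<otimes>\<^bsub>A\<^esub> b'"] exI[of _ v])
        (simp add: frag_extend_diff frag_extend_add a A.r_distr)
    subgoal for b v v'
      by (intro UnI1 UnI2 CollectI exI[of _ "a \<otimes>\<^bsub>A\<^esub> b"] exI[of _ v] exI[of _ v'])
        (simp add: frag_extend_diff frag_extend_add a)
    subgoal for b c v
      using B.subset
      by (intro UnI2 CollectI exI[of _ "a \<otimes>\<^bsub>A\<^esub> b"] exI[of _ c] exI[of _ v])
        (auto simp add: frag_extend_diff frag_extend_add a A.m_assoc)
    done
  have fnull: "?f x \<in> tensor_null A B W" if "x \<in> tensor_null A B W" for x
    using that unfolding tensor_null_def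
  proof induction
    case one
    then show ?case using generate.one[of "tensor_free A W"] by (simp add: tensor_free_def)
  next
    case (incl h)
    then show ?case by (simp add: frel generate.incl)
  next
    case (inv h)
    have neg: "inv\<^bsub>tensor_free A W\<^esub> y = - y" if "y \<in> tensor_relations A B W" for y
      using subsetD[OF rel that] by (simp add: tensor_free_def)
    have "inv\<^bsub>tensor_free A W\<^esub> h = - h" "inv\<^bsub>tensor_free A W\<^esub> (?f h) = - ?f h"
      using neg[OF inv] neg[OF frel[OF inv]] by simp_all
    then show ?case using generate.inv[OF frel[OF inv], of "tensor_free A W"]
      by (simp add: frag_extend_minus)
  next
    case (eng h1 h2)
    then show ?case
      using generate.eng[of "?f h1" "tensor_free A W" "tensor_relations A B W" "?f h2"]
      by (simp add: tensor_free_def frag_extend_add)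
  qed
  have "tensor_null A B W #>\<^bsub>tensor_free A W\<^esub> ?f x = pure_tensor A B W (a \<otimes>\<^bsub>A\<^esub> a') w"
    if x: "x \<in> pure_tensor A B W a' w" for x
  proof -
    from x obtain n where n: "n \<in> tensor_null A B W" "x = n + frag_of (a', w)"
      by (auto simp: pure_tensor_def r_coset_def tensor_free_def)
    then have "?f x = ?f n \<otimes>\<^bsub>tensor_free A W\<^esub> frag_of (a \<otimes>\<^bsub>A\<^esub> a', w)"
      by (simp add: frag_extend_add tensor_free_def)
    moreover have "frag_of (a \<otimes>\<^bsub>A\<^esub> a', w) \<in> carrier (tensor_free A W)"
      using a a' w by (simp add: tensor_free_def)
    ultimately show ?thesis
      using T.coset_mult_assoc[OF N.subset subsetD[OF N.subset fnull[OF n(1)]], symmetric]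
        N.rcos_const[OF T.is_group fnull[OF n(1)]]
      by (simp add: pure_tensor_def)
  qed
  moreover have "frag_of (a', w) \<in> pure_tensor A B W a' w"
    using a' w unfolding pure_tensor_def
    by (intro T.rcos_self N.subgroup_axioms) (simp add: tensor_free_def)
  ultimately show ?thesis
    by (auto simp: induced_module_def)
qed


section \<open>Skew group rings\<close>

definition fixed_field :: "('l, 'r) ring_scheme \<Rightarrow> ('g, 'm) monoid_scheme \<Rightarrow> ('g \<Rightarrow> 'l \<Rightarrow> 'l) \<Rightarrow> 'l set"
  where "fixed_field L G \<phi> = {x \<in> carrier L. \<forall>g\<in>carrier G. \<phi> g x = x}"

definition Gal :: "('l, 'r) ring_scheme \<Rightarrow> 'l set \<Rightarrow> ('l \<Rightarrow> 'l) monoid"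
  where "Gal L K = BijGroup (carrier L)
    \<lparr>carrier := {\<sigma> \<in> Bij (carrier L). \<sigma> \<in> ring_hom L L \<and> (\<forall>x\<in>K. \<sigma> x = x)}\<rparr>"

text \<open>
  For a finite group \<open>G\<close>, the free left \<open>L\<close>-module on \<open>G\<close> is the module of all functions from
  \<open>G\<close> to \<open>L\<close>; the element written \<open>\<lambda> * g\<close> on paper is \<open>skew_monom L G \<lambda> g\<close>. The product below
  is the biadditive extension of \<open>(\<lambda> * g) (\<mu> * h) = \<lambda> g(\<mu>) * g h\<close>; see lemma
  \<open>skew_monom_mult\<close>.
\<close>

definition skew_group_ring ::
    "('l, 'r) ring_scheme \<Rightarrow> ('g, 'm) monoid_scheme \<Rightarrow> ('g \<Rightarrow> 'l \<Rightarrow> 'l) \<Rightarrow> ('g \<Rightarrow> 'l) ring"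
  where "skew_group_ring L G \<phi> =
    \<lparr>carrier = carrier G \<rightarrow>\<^sub>E carrier L,
     monoid.mult = (\<lambda>a b. \<lambda>x\<in>carrier G.
               \<Oplus>\<^bsub>L\<^esub>g\<in>carrier G. a g \<otimes>\<^bsub>L\<^esub> \<phi> g (b (inv\<^bsub>G\<^esub> g \<otimes>\<^bsub>G\<^esub> x))),
     one = (\<lambda>x\<in>carrier G. if x = \<one>\<^bsub>G\<^esub> then \<one>\<^bsub>L\<^esub> else \<zero>\<^bsub>L\<^esub>),
     ring.zero = (\<lambda>x\<in>carrier G. \<zero>\<^bsub>L\<^esub>),
     ring.add = (\<lambda>a b. \<lambda>x\<in>carrier G. a x \<oplus>\<^bsub>L\<^esub> b x)\<rparr>"

definition skew_monom ::
    "('l, 'r) ring_scheme \<Rightarrow> ('g, 'm) monoid_scheme \<Rightarrow> 'l \<Rightarrow> 'g \<Rightarrow> ('g \<Rightarrow> 'l)"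
  where "skew_monom L G c g = (\<lambda>x\<in>carrier G. if x = g then c else \<zero>\<^bsub>L\<^esub>)"

lemma skew_monom_mult:
  assumes "field L" "group G" "finite (carrier G)"
    and "\<And>g. g \<in> carrier G \<Longrightarrow> \<phi> g \<in> ring_hom L L"
    and "g \<in> carrier G" "h \<in> carrier G" "c \<in> carrier L" "d \<in> carrier L"
  shows "skew_monom L G c g \<otimes>\<^bsub>skew_group_ring L G \<phi>\<^esub> skew_monom L G d h =
    skew_monom L G (c \<otimes>\<^bsub>L\<^esub> \<phi> g d) (g \<otimes>\<^bsub>G\<^esub> h)"
proof -
  interpret L: field L by fact
  interpret G: group G by fact
  have closed: "\<phi> u y \<in> carrier L" if "u \<in> carrier G" "y \<in> carrier L" for u y
    using assms(4)[OF that(1)] that(2) by (rule ring_hom_closed)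
  have zero: "\<phi> g \<zero>\<^bsub>L\<^esub> = \<zero>\<^bsub>L\<^esub>"
    using ring_hom_zero[OF assms(4)[OF assms(5)] L.ring_axioms L.ring_axioms] .
  have "(\<Oplus>\<^bsub>L\<^esub>u\<in>carrier G. skew_monom L G c g u \<otimes>\<^bsub>L\<^esub>
          \<phi> u (skew_monom L G d h (inv\<^bsub>G\<^esub> u \<otimes>\<^bsub>G\<^esub> x))) =
        (if x = g \<otimes>\<^bsub>G\<^esub> h then c \<otimes>\<^bsub>L\<^esub> \<phi> g d else \<zero>\<^bsub>L\<^esub>)" (is "?sum = ?r")
    if x: "x \<in> carrier G" for x
  proof -
    have eq: "inv\<^bsub>G\<^esub> g \<otimes>\<^bsub>G\<^esub> x = h \<longleftrightarrow> x = g \<otimes>\<^bsub>G\<^esub> h"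
      using x assms(5,6) by (metis G.inv_solve_left)
    have "?sum = (\<Oplus>\<^bsub>L\<^esub>u\<in>carrier G. if g = u then c \<otimes>\<^bsub>L\<^esub>
                    \<phi> u (skew_monom L G d h (inv\<^bsub>G\<^esub> u \<otimes>\<^bsub>G\<^esub> x)) else \<zero>\<^bsub>L\<^esub>)"
      using assms(7,8) x by (intro L.finsum_cong') (auto simp: skew_monom_def closed)
    also have "\<dots> = c \<otimes>\<^bsub>L\<^esub> \<phi> g (skew_monom L G d h (inv\<^bsub>G\<^esub> g \<otimes>\<^bsub>G\<^esub> x))"
      using assms(3,5,7,8) x
      by (intro L.finsum_singleton) (auto simp: skew_monom_def closed)
    also have "\<dots> = ?r"
      using assms(5,7) x by (simp add: skew_monom_def eq zero)
    finally show ?thesis .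
  qed
  then show ?thesis
    by (auto simp: skew_group_ring_def skew_monom_def[of L G "c \<otimes>\<^bsub>L\<^esub> \<phi> g d"] intro!: restrict_ext)
qed

text \<open>
  The subring of the skew group ring spanned over \<open>L\<close> by a subgroup \<open>H\<close>. When \<open>H\<close> acts trivially
  on \<open>L\<close>, this is the group algebra of \<open>H\<close>.
\<close>

definition subgroup_ring ::
    "('l, 'r) ring_scheme \<Rightarrow> ('g, 'm) monoid_scheme \<Rightarrow> ('g \<Rightarrow> 'l \<Rightarrow> 'l) \<Rightarrow> 'g set \<Rightarrow> ('g \<Rightarrow> 'l) ring"
  where "subgroup_ring L G \<phi> H = (skew_group_ring L G \<phi>)
    \<lparr>carrier := {a \<in> carrier (skew_group_ring L G \<phi>). \<forall>x\<in>carrier G - H. a x = \<zero>\<^bsub>L\<^esub>}\<rparr>"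

abbreviation Ind ::
    "('l, 'r) ring_scheme \<Rightarrow> ('g, 'm) monoid_scheme \<Rightarrow> ('g \<Rightarrow> 'l \<Rightarrow> 'l) \<Rightarrow> 'g set \<Rightarrow>
      ('g \<Rightarrow> 'l, 'w, 'x) module_scheme \<Rightarrow> ('g \<Rightarrow> 'l, (('g \<Rightarrow> 'l) \<times> 'w \<Rightarrow>\<^sub>0 int) set) module"
  where "Ind L G \<phi> H W \<equiv> induced_module (skew_group_ring L G \<phi>) (subgroup_ring L G \<phi> H) W"

definition conjugate_module ::
    "('l, 'r) ring_scheme \<Rightarrow> ('g, 'm) monoid_scheme \<Rightarrow> ('g \<Rightarrow> 'l \<Rightarrow> 'l) \<Rightarrow> 'g set \<Rightarrow> 'g \<Rightarrow>
      ('g \<Rightarrow> 'l, 'w, 'x) module_scheme \<Rightarrow> ('g \<Rightarrow> 'l, (('g \<Rightarrow> 'l) \<times> 'w \<Rightarrow>\<^sub>0 int) set) module"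
  where "conjugate_module L G \<phi> H g W = (Ind L G \<phi> H W)
    \<lparr>carrier := pure_tensor (skew_group_ring L G \<phi>) (subgroup_ring L G \<phi> H) W
                  (skew_monom L G \<one>\<^bsub>L\<^esub> g) ` carrier W\<rparr>"

text \<open>
  \<open>\<sigma> \<in> Gal(l/k)\<close> sends the class of \<open>W\<close> to the class of \<open>gW\<close> for any \<open>g \<in> G\<close> inducing \<open>\<sigma>\<close>. The
  union is over classes that are all equal.
\<close>

definition gal_action ::
    "('l, 'r) ring_scheme \<Rightarrow> ('g, 'm) monoid_scheme \<Rightarrow> ('g \<Rightarrow> 'l \<Rightarrow> 'l) \<Rightarrow> 'g set \<Rightarrow> ('l \<Rightarrow> 'l) \<Rightarrow>
      ('g \<Rightarrow> 'l, ('g \<Rightarrow> 'l) set) module set \<Rightarrow> ('g \<Rightarrow> 'l, ('g \<Rightarrow> 'l) set) module set"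
  where "gal_action L G \<phi> H \<sigma> = (\<lambda>C\<in>sim (subgroup_ring L G \<phi> H).
    \<Union>{iso_class (subgroup_ring L G \<phi> H) (conjugate_module L G \<phi> H g W) | g W.
        g \<in> carrier G \<and> \<phi> g = \<sigma> \<and> W \<in> C})"

end

theory Submission
  imports Defs
begin

text \<open>
  Write \<open>A\<close> for \<open>l * G\<close> and \<open>B\<close> for \<open>lH\<close>. Choosing for each \<open>\<tau> \<noteq> 1\<close> in the image \<open>\<Gamma>\<close> of \<open>G\<close> an element of
  \<open>l\<close> moved by \<open>\<tau>\<close> and multiplying out, one finds \<open>x\<^sub>i, y\<^sub>i \<in> l\<close> with \<open>\<Sum>\<^sub>i x\<^sub>i \<gamma>(y\<^sub>i) = \<delta>\<^bsub>\<gamma>,1\<^esub>\<close> for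
  \<open>\<gamma> \<in> \<Gamma>\<close>. These coordinates give \<open>\<Gamma> = Gal(l/k)\<close> and \<open>[l : k] = |\<Gamma>|\<close>. They also give descent: for
  \<open>A\<close>-modules \<open>V\<close> and \<open>M\<close>, a \<open>B\<close>-linear \<open>h : V \<rightarrow> M\<close> equals \<open>\<Sum>\<^sub>i x\<^sub>i f\<^sub>i\<close> with the \<open>A\<close>-linear maps
  \<open>f\<^sub>i = \<Sum>\<^bsub>g \<in> G/H\<^esub> g (y\<^sub>i h) g\<inverse>\<close>. No condition on the characteristic enters.

  A simple \<open>A\<close>-module \<open>V\<close> containing a simple \<open>B\<close>-module \<open>W\<close> is the sum of the conjugates of \<open>W\<close>, so the
  simple \<open>B\<close>-modules below \<open>V\<close> form one orbit. By descent, two simple \<open>A\<close>-modules above the same \<open>W\<close> are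
  isomorphic, and \<open>Ind W\<close> is a sum of images of \<open>V\<close>, hence a power of \<open>V\<close>. Twisting by \<open>G\<close> shows
  that all conjugates occur in \<open>V\<close> equally often, and comparing the length \<open>|\<Gamma>|\<close> of \<open>Ind W\<close> over \<open>B\<close> with
  that of \<open>V\<close> gives the numerical identity.
\<close>

section \<open>Modules over noncommutative rings\<close>

text \<open>The orders of \<open>H\<close> and of \<open>G/H\<close> may vanish in l, so neither
  \<open>A\<close> nor \<open>B\<close> need be semisimple and no averaging over a group is
  possible. Complete reducibility is obtained instead by writing a module as a finite sum of images
  of simple modules, and the coordinates x, y take the place of a division by the order of
  \<open>G/H\<close>. They act on homomorphisms because l is central in \<open>B\<close>: as
  \<open>H\<close> acts trivially on l, Hom over \<open>B\<close> is an l-space with a semilinear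
  action of \<open>G/H\<close>.

  Existence of simple submodules and finiteness of the set of simple classes both come from
  dimension over l, because every submodule over \<open>A\<close> or \<open>B\<close> is an
  l-subspace.

  Isomorphism classes are taken on one fixed carrier type, but induced modules live on another.
  Hence the relation between simple modules over the two rings is expressed by a nonzero
  homomorphism, which makes sense across carrier types and is invariant under isomorphism; a module
  is moved to the fixed type only when its class is needed. Twists keep the carrier of W and so stay
  in that type, which conjugate submodules of an induced module do not.\<close>

lemma (in abelian_group) minus_eq_zeroD:
  assumes "x \<in> carrier G" "y \<in> carrier G" "x \<ominus> y = \<zero>"
  shows "x = y"
  using assms minus_equality[of x "\<ominus> y"] by (simp add: minus_eq)

context left_module
begin

lemma smult_l_null [simp]: "x \<in> carrier M \<Longrightarrow> \<zero> \<odot>\<^bsub>M\<^esub> x = \<zero>\<^bsub>M\<^esub>"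
  using smult_l_distr[of "\<zero>" "\<zero>" x]
  by (metis M.add.l_cancel_one' R.l_zero R.zero_closed smult_closed)

lemma smult_r_null [simp]: "a \<in> carrier R \<Longrightarrow> a \<odot>\<^bsub>M\<^esub> \<zero>\<^bsub>M\<^esub> = \<zero>\<^bsub>M\<^esub>"
  using smult_r_distr[of a "\<zero>\<^bsub>M\<^esub>" "\<zero>\<^bsub>M\<^esub>"]
  by (metis M.add.l_cancel_one' M.l_zero M.zero_closed smult_closed)

lemma smult_l_minus: "\<lbrakk>a \<in> carrier R; x \<in> carrier M\<rbrakk> \<Longrightarrow> (\<ominus> a) \<odot>\<^bsub>M\<^esub> x = \<ominus>\<^bsub>M\<^esub> (a \<odot>\<^bsub>M\<^esub> x)"
  using smult_l_distr[of "\<ominus> a" a x] by (metis M.minus_equality R.add.inv_closed R.l_neg smult_closed smult_l_null)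

lemma finsum_smult:
  assumes "finite I" "a \<in> carrier R" "f \<in> I \<rightarrow> carrier M"
  shows "a \<odot>\<^bsub>M\<^esub> finsum M f I = (\<Oplus>\<^bsub>M\<^esub>i\<in>I. a \<odot>\<^bsub>M\<^esub> f i)"
  using assms by (induction I rule: finite_induct) (simp_all add: Pi_def smult_r_distr)

text \<open>The subgroup part of \<open>submodule\<close> demands negatives; they are supplied by
  the action of \<ominus> \<one>, so that applications check only zero, sums and scalar
  multiples.\<close>

lemma submoduleI:
  assumes "N \<subseteq> carrier M" "\<zero>\<^bsub>M\<^esub> \<in> N" "\<And>x y. \<lbrakk>x \<in> N; y \<in> N\<rbrakk> \<Longrightarrow> x \<oplus>\<^bsub>M\<^esub> y \<in> N"
    and "\<And>a x. \<lbrakk>a \<in> carrier R; x \<in> N\<rbrakk> \<Longrightarrow> a \<odot>\<^bsub>M\<^esub> x \<in> N"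
  shows "submodule N R M"
proof -
  have "\<ominus>\<^bsub>M\<^esub> x \<in> N" if "x \<in> N" for x
    using assms(4)[of "\<ominus> \<one>" x] smult_l_minus[of "\<one>" x] assms(1) that by auto
  then have "subgroup N (add_monoid M)"
    using assms(1-3) by (intro M.add.subgroupI) (auto simp: a_inv_def)
  then show ?thesis by (simp add: submodule_def submodule_axioms_def assms(4))
qed

lemma submodule_carrier: "submodule (carrier M) R M"
  by (rule submoduleI) auto

lemma submodule_zero: "submodule {\<zero>\<^bsub>M\<^esub>} R M"
  by (rule submoduleI) auto

lemma submodule_left_module:
  assumes "submodule N R M"
  shows "left_module R (M\<lparr>carrier := N\<rparr>)"
proof -
  interpret N: submodule N R M by (rule assms)
  have sub: "x \<in> carrier M" if "x \<in> N" for x using N.subset that by auto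
  have "abelian_group (M\<lparr>carrier := N\<rparr>)"
  proof (rule abelian_groupI)
    fix x assume "x \<in> carrier (M\<lparr>carrier := N\<rparr>)"
    then show "\<exists>y\<in>carrier (M\<lparr>carrier := N\<rparr>). y \<oplus>\<^bsub>M\<lparr>carrier := N\<rparr>\<^esub> x = \<zero>\<^bsub>M\<lparr>carrier := N\<rparr>\<^esub>"
      using N.m_inv_closed sub
      by (intro bexI[of _ "\<ominus>\<^bsub>M\<^esub> x"]) (auto simp: a_inv_def M.l_neg simp flip: a_inv_def)
  qed (use N.m_closed N.one_closed in \<open>auto simp: M.a_ac sub\<close>)
  then show ?thesis
    by (intro left_module.intro left_module_axioms.intro R.ring_axioms)
      (auto simp: smult_l_distr smult_r_distr smult_assoc1 sub N.smult_closed)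
qed

end

lemma submodule_of_submodule:
  assumes M: "left_module R M" and N: "submodule N R M" and P: "submodule P R (M\<lparr>carrier := N\<rparr>)"
  shows "submodule P R M"
proof -
  interpret M: left_module R M by (rule M)
  interpret N: submodule N R M by (rule N)
  interpret P: submodule P R "M\<lparr>carrier := N\<rparr>" by (rule P)
  show ?thesis
    using P.subset N.subset P.one_closed P.m_closed P.smult_closed by (intro M.submoduleI) auto
qed

lemma left_module_homI:
  assumes "\<And>x. x \<in> carrier M \<Longrightarrow> f x \<in> carrier N"
    and "\<And>x y. \<lbrakk>x \<in> carrier M; y \<in> carrier M\<rbrakk> \<Longrightarrow> f (x \<oplus>\<^bsub>M\<^esub> y) = f x \<oplus>\<^bsub>N\<^esub> f y"
    and "\<And>a x. \<lbrakk>a \<in> carrier R; x \<in> carrier M\<rbrakk> \<Longrightarrow> f (a \<odot>\<^bsub>M\<^esub> x) = a \<odot>\<^bsub>N\<^esub> f x"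
  shows "f \<in> left_module_hom R M N"
  using assms by (simp add: left_module_hom_def hom_def)

lemma
  assumes "f \<in> left_module_hom R M N"
  shows lmh_closed: "x \<in> carrier M \<Longrightarrow> f x \<in> carrier N"
    and lmh_add: "\<lbrakk>x \<in> carrier M; y \<in> carrier M\<rbrakk> \<Longrightarrow> f (x \<oplus>\<^bsub>M\<^esub> y) = f x \<oplus>\<^bsub>N\<^esub> f y"
    and lmh_smult: "\<lbrakk>a \<in> carrier R; x \<in> carrier M\<rbrakk> \<Longrightarrow> f (a \<odot>\<^bsub>M\<^esub> x) = a \<odot>\<^bsub>N\<^esub> f x"
  using assms by (auto simp: left_module_hom_def hom_def)

lemma lmh_comp:
  "\<lbrakk>f \<in> left_module_hom R M N; g \<in> left_module_hom R N P\<rbrakk> \<Longrightarrow> (\<lambda>x. g (f x)) \<in> left_module_hom R M P"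
  by (rule left_module_homI) (simp_all add: lmh_closed lmh_add lmh_smult)

lemma lmh_id: "(\<lambda>x. x) \<in> left_module_hom R M M"
  by (rule left_module_homI) simp_all

lemma lmh_inclusion: "N \<subseteq> carrier M \<Longrightarrow> (\<lambda>x. x) \<in> left_module_hom R (M\<lparr>carrier := N\<rparr>) M"
  by (rule left_module_homI) auto

text \<open>Bundles a homomorphism with both modules, so that one interpretation yields
  compatibility with zero, negatives, finite sums, and images and preimages of submodules. The
  carriers may have different types.\<close>

locale module_hom_pair = M: left_module R M + N: left_module R N
  for R :: "('a, 'r) ring_scheme" and M :: "('a, 'm, 'x) module_scheme"
    and N :: "('a, 'n, 'y) module_scheme" +
  fixes f
  assumes hom: "f \<in> left_module_hom R M N"
begin

lemmas closed [simp] = lmh_closed[OF hom]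
  and add = lmh_add[OF hom]
  and smult = lmh_smult[OF hom]

lemma zero [simp]: "f \<zero>\<^bsub>M\<^esub> = \<zero>\<^bsub>N\<^esub>"
  using add[of "\<zero>\<^bsub>M\<^esub>" "\<zero>\<^bsub>M\<^esub>"] by (simp add: N.add.l_cancel_one')

lemma minus: "x \<in> carrier M \<Longrightarrow> f (\<ominus>\<^bsub>M\<^esub> x) = \<ominus>\<^bsub>N\<^esub> f x"
  by (metis M.M.add.inv_closed M.M.l_neg N.minus_equality add closed zero)

lemma diff:
  assumes "x \<in> carrier M" "y \<in> carrier M"
  shows "f (x \<ominus>\<^bsub>M\<^esub> y) = f x \<ominus>\<^bsub>N\<^esub> f y"
  using assms by (simp add: a_minus_def add minus)

lemma finsum:
  assumes "finite I" "x \<in> I \<rightarrow> carrier M"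
  shows "f (finsum M x I) = (\<Oplus>\<^bsub>N\<^esub>i\<in>I. f (x i))"
  using assms by (induction I rule: finite_induct) (simp_all add: Pi_def add)

lemma image_submodule:
  assumes "submodule P R M"
  shows "submodule (f ` P) R N"
proof -
  interpret P: submodule P R M by (rule assms)
  have c: "x \<in> carrier M" if "x \<in> P" for x using P.subset that by auto
  show ?thesis
  proof (rule N.submoduleI)
    show "\<zero>\<^bsub>N\<^esub> \<in> f ` P" using P.one_closed zero by (metis imageI monoid.simps(2))
    fix x y assume "x \<in> f ` P" "y \<in> f ` P"
    then show "x \<oplus>\<^bsub>N\<^esub> y \<in> f ` P" using P.m_closed c by (auto simp flip: add)
  next
    fix a x assume "a \<in> carrier R" "x \<in> f ` P"
    then show "a \<odot>\<^bsub>N\<^esub> x \<in> f ` P" using P.smult_closed c by (auto simp flip: smult)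
  qed (auto dest: c)
qed

lemma vimage_submodule:
  assumes "submodule P R N"
  shows "submodule {x \<in> carrier M. f x \<in> P} R M"
proof -
  interpret P: submodule P R N by (rule assms)
  show ?thesis
    using P.one_closed P.m_closed P.smult_closed by (intro M.submoduleI) (auto simp: add smult)
qed

lemma inj_iff: "inj_on f (carrier M) \<longleftrightarrow> (\<forall>x\<in>carrier M. f x = \<zero>\<^bsub>N\<^esub> \<longrightarrow> x = \<zero>\<^bsub>M\<^esub>)"
proof
  assume "inj_on f (carrier M)"
  then show "\<forall>x\<in>carrier M. f x = \<zero>\<^bsub>N\<^esub> \<longrightarrow> x = \<zero>\<^bsub>M\<^esub>"
    by (metis M.zero_closed inj_onD zero)
next
  assume *: "\<forall>x\<in>carrier M. f x = \<zero>\<^bsub>N\<^esub> \<longrightarrow> x = \<zero>\<^bsub>M\<^esub>"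
  show "inj_on f (carrier M)"
  proof (rule inj_onI)
    fix x y assume xy: "x \<in> carrier M" "y \<in> carrier M" "f x = f y"
    then have "f (x \<ominus>\<^bsub>M\<^esub> y) = \<zero>\<^bsub>N\<^esub>" using diff[of x y] by (simp add: N.M.r_neg a_minus_def[of N])
    then show "x = y" using xy bspec[OF *, of "x \<ominus>\<^bsub>M\<^esub> y"] M.M.minus_closed[of x y]
      by (metis M.M.minus_eq_zeroD)
  qed
qed

lemma inverse_hom:
  assumes "bij_betw f (carrier M) (carrier N)"
  shows "inv_into (carrier M) f \<in> left_module_hom R N M"
proof -
  let ?g = "inv_into (carrier M) f"
  have g: "?g y \<in> carrier M" "f (?g y) = y" if "y \<in> carrier N" for y
    using assms that by (auto simp: bij_betw_def inv_into_into f_inv_into_f)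
  have gf: "?g (f x) = x" if "x \<in> carrier M" for x
    using assms that by (simp add: bij_betw_def)
  show ?thesis
  proof (rule left_module_homI)
    fix x y assume "x \<in> carrier N" "y \<in> carrier N"
    then show "?g (x \<oplus>\<^bsub>N\<^esub> y) = ?g x \<oplus>\<^bsub>M\<^esub> ?g y"
      using gf[of "?g x \<oplus>\<^bsub>M\<^esub> ?g y"] by (simp add: g add)
  next
    fix a x assume "a \<in> carrier R" "x \<in> carrier N"
    then show "?g (a \<odot>\<^bsub>N\<^esub> x) = a \<odot>\<^bsub>M\<^esub> ?g x"
      using gf[of "a \<odot>\<^bsub>M\<^esub> ?g x"] by (simp add: g smult)
  qed (simp add: g)
qed

end

lemma module_hom_pairI:
  "\<lbrakk>left_module R M; left_module R N; f \<in> left_module_hom R M N\<rbrakk> \<Longrightarrow> module_hom_pair R M N f"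
  by (simp add: module_hom_pair_def module_hom_pair_axioms_def)

lemma left_module_iso_refl: "left_module_iso R M M"
  unfolding left_module_iso_def by (rule bexI[OF _ lmh_id]) (simp add: bij_betw_def)

lemma left_module_iso_sym:
  assumes "left_module R M" "left_module R N" "left_module_iso R M N"
  shows "left_module_iso R N M"
proof -
  obtain f where f: "f \<in> left_module_hom R M N" "bij_betw f (carrier M) (carrier N)"
    using assms(3) by (auto simp: left_module_iso_def)
  interpret module_hom_pair R M N f using assms f by (simp add: module_hom_pairI)
  show ?thesis
    unfolding left_module_iso_def using inverse_hom[OF f(2)] bij_betw_inv_into[OF f(2)] by blast
qed

lemma left_module_iso_trans [trans]:
  assumes "left_module_iso R M N" "left_module_iso R N P"
  shows "left_module_iso R M P"
proof -
  obtain f g where f: "f \<in> left_module_hom R M N" "bij_betw f (carrier M) (carrier N)"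
    and g: "g \<in> left_module_hom R N P" "bij_betw g (carrier N) (carrier P)"
    using assms by (auto simp: left_module_iso_def)
  have "bij_betw (\<lambda>x. g (f x)) (carrier M) (carrier P)"
    using bij_betw_trans[OF f(2) g(2)] by (simp add: comp_def)
  then show ?thesis unfolding left_module_iso_def using lmh_comp[OF f(1) g(1)] by blast
qed

lemma left_module_isoE:
  assumes "left_module R M" "left_module R N" "left_module_iso R M N"
  obtains f g where "f \<in> left_module_hom R M N" "g \<in> left_module_hom R N M"
    "\<And>x. x \<in> carrier M \<Longrightarrow> g (f x) = x" "\<And>y. y \<in> carrier N \<Longrightarrow> f (g y) = y"
proof -
  obtain f where f: "f \<in> left_module_hom R M N" "bij_betw f (carrier M) (carrier N)"
    using assms(3) by (auto simp: left_module_iso_def)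
  interpret module_hom_pair R M N f using assms f by (simp add: module_hom_pairI)
  show thesis
    using f(2) by (intro that[OF f(1) inverse_hom[OF f(2)]]) (auto simp: bij_betw_def f_inv_into_f)
qed

lemma left_module_isoI:
  assumes "f \<in> left_module_hom R M N" "g \<in> left_module_hom R N M"
    "\<And>x. x \<in> carrier M \<Longrightarrow> g (f x) = x" "\<And>y. y \<in> carrier N \<Longrightarrow> f (g y) = y"
  shows "left_module_iso R M N"
  unfolding left_module_iso_def
  by (rule bexI[OF _ assms(1)], rule bij_betw_byWitness[where f' = g])
    (use assms in \<open>auto simp: lmh_closed[OF assms(1)] lmh_closed[OF assms(2)]\<close>)

section \<open>Simple modules and Schur's lemma\<close>

lemma simple_left_moduleD:
  assumes "simple_left_module R M"
  shows "left_module R M" "\<exists>x\<in>carrier M. x \<noteq> \<zero>\<^bsub>M\<^esub>"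
    "submodule N R M \<Longrightarrow> N = {\<zero>\<^bsub>M\<^esub>} \<or> N = carrier M"
proof -
  show M: "left_module R M" using assms by (simp add: simple_left_module_def)
  interpret left_module R M by (rule M)
  show "\<exists>x\<in>carrier M. x \<noteq> \<zero>\<^bsub>M\<^esub>"
    using assms M.zero_closed unfolding simple_left_module_def by blast
qed (use assms in \<open>simp add: simple_left_module_def\<close>)

text \<open>For simple \<open>M\<close> this says that \<open>M\<close> embeds in \<open>N\<close>,
  for simple \<open>N\<close> that \<open>N\<close> is a quotient of \<open>M\<close>. No submodule
  or quotient has to be named, and the two carrier types are independent.\<close>

definition nonzero_hom where
  "nonzero_hom R M N \<longleftrightarrow> (\<exists>f\<in>left_module_hom R M N. \<exists>x\<in>carrier M. f x \<noteq> \<zero>\<^bsub>N\<^esub>)"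

lemma nonzero_homI:
  "\<lbrakk>f \<in> left_module_hom R M N; x \<in> carrier M; f x \<noteq> \<zero>\<^bsub>N\<^esub>\<rbrakk> \<Longrightarrow> nonzero_hom R M N"
  by (auto simp: nonzero_hom_def)

lemma simple_source_inj:
  assumes M: "simple_left_module R M" and N: "left_module R N" and f: "f \<in> left_module_hom R M N"
    and x: "x \<in> carrier M" "f x \<noteq> \<zero>\<^bsub>N\<^esub>"
  shows "inj_on f (carrier M)"
proof -
  interpret module_hom_pair R M N f
    using simple_left_moduleD(1)[OF M] N f by (rule module_hom_pairI)
  show ?thesis
    using simple_left_moduleD(3)[OF M vimage_submodule[OF N.submodule_zero]] x inj_iff by auto
qed

lemma simple_target_surj:
  assumes M: "left_module R M" and N: "simple_left_module R N" and f: "f \<in> left_module_hom R M N"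
    and x: "x \<in> carrier M" "f x \<noteq> \<zero>\<^bsub>N\<^esub>"
  shows "f ` carrier M = carrier N"
proof -
  interpret module_hom_pair R M N f
    using M simple_left_moduleD(1)[OF N] f by (rule module_hom_pairI)
  show ?thesis
    using simple_left_moduleD(3)[OF N image_submodule[OF M.submodule_carrier]] x by auto
qed

text \<open>Simplicity of the source makes the kernel zero, simplicity of the target makes the image
  everything.\<close>

lemma schur_iso:
  assumes M: "simple_left_module R M" and N: "simple_left_module R N" and "nonzero_hom R M N"
  shows "left_module_iso R M N"
  using assms simple_source_inj[OF M simple_left_moduleD(1)[OF N]]
    simple_target_surj[OF simple_left_moduleD(1)[OF M] N]
  unfolding nonzero_hom_def left_module_iso_def bij_betw_def by blast

lemma nonzero_hom_comp_inj:
  assumes "left_module R M" "left_module R N" "left_module R P"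
    and "nonzero_hom R M N" and g: "g \<in> left_module_hom R N P" "inj_on g (carrier N)"
  shows "nonzero_hom R M P"
proof -
  interpret module_hom_pair R N P g using assms by (simp add: module_hom_pairI)
  obtain f x where f: "f \<in> left_module_hom R M N" "x \<in> carrier M" "f x \<noteq> \<zero>\<^bsub>N\<^esub>"
    using assms(4) by (auto simp: nonzero_hom_def)
  then show ?thesis
    using g inj_iff lmh_closed[OF f(1)] by (intro nonzero_homI[OF lmh_comp[OF f(1) g(1)]]) auto
qed

lemma nonzero_hom_comp_surj:
  assumes f: "f \<in> left_module_hom R M N" "f ` carrier M = carrier N" and "nonzero_hom R N P"
  shows "nonzero_hom R M P"
  using assms lmh_comp[OF f(1)] unfolding nonzero_hom_def by (metis (no_types, lifting) imageE)

lemma nonzero_hom_iso: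
  assumes "left_module R M" "left_module R M'" "left_module R N"
    and iso: "left_module_iso R M' M" and "nonzero_hom R M N"
  shows "nonzero_hom R M' N"
  using assms nonzero_hom_comp_surj unfolding left_module_iso_def bij_betw_def by blast

section \<open>Direct sums and semisimple modules\<close>

lemma direct_sum_simps [simp]:
  "carrier (direct_sum I M) = (\<Pi>\<^sub>E i\<in>I. carrier (M i))"
  "\<zero>\<^bsub>direct_sum I M\<^esub> = (\<lambda>i\<in>I. \<zero>\<^bsub>M i\<^esub>)"
  "x \<oplus>\<^bsub>direct_sum I M\<^esub> y = (\<lambda>i\<in>I. x i \<oplus>\<^bsub>M i\<^esub> y i)"
  "a \<odot>\<^bsub>direct_sum I M\<^esub> x = (\<lambda>i\<in>I. a \<odot>\<^bsub>M i\<^esub> x i)"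
  by (simp_all add: direct_sum_def)

lemma direct_sum_left_module:
  assumes R: "ring R" and M: "\<And>i. i \<in> I \<Longrightarrow> left_module R (M i)"
  shows "left_module R (direct_sum I M)"
proof -
  have ab: "abelian_group (M i)" if "i \<in> I" for i
    using M[OF that] by (simp add: left_module_def)
  have am: "abelian_monoid (M i)" if "i \<in> I" for i
    using ab[OF that] by (simp add: abelian_group_def)
  have "abelian_group (direct_sum I M)"
  proof (rule abelian_groupI)
    fix x assume x: "x \<in> carrier (direct_sum I M)"
    then have "x i \<in> carrier (M i)" if "i \<in> I" for i using that by (auto simp: PiE_def Pi_def)
    then show "\<exists>y\<in>carrier (direct_sum I M). y \<oplus>\<^bsub>direct_sum I M\<^esub> x = \<zero>\<^bsub>direct_sum I M\<^esub>"
      using ab by (intro bexI[of _ "\<lambda>i\<in>I. \<ominus>\<^bsub>M i\<^esub> x i"])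
        (auto intro!: restrict_ext simp: abelian_group.l_neg abelian_group.a_inv_closed)
  next
    fix x assume x: "x \<in> carrier (direct_sum I M)"
    then show "\<zero>\<^bsub>direct_sum I M\<^esub> \<oplus>\<^bsub>direct_sum I M\<^esub> x = x"
      by (intro extensionalityI[of _ I]) (auto simp: PiE_def Pi_def abelian_monoid.l_zero[OF am])
  next
    fix x y z
    assume "x \<in> carrier (direct_sum I M)" "y \<in> carrier (direct_sum I M)"
    then show "x \<oplus>\<^bsub>direct_sum I M\<^esub> y = y \<oplus>\<^bsub>direct_sum I M\<^esub> x"
      by (auto intro!: restrict_ext simp: abelian_monoid.a_comm[OF am] PiE_iff)
    assume "z \<in> carrier (direct_sum I M)"
    then show "(x \<oplus>\<^bsub>direct_sum I M\<^esub> y) \<oplus>\<^bsub>direct_sum I M\<^esub> z = x \<oplus>\<^bsub>direct_sum I M\<^esub> (y \<oplus>\<^bsub>direct_sum I M\<^esub> z)"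
      using \<open>x \<in> _\<close> \<open>y \<in> _\<close>
      by (auto intro!: restrict_ext simp: abelian_monoid.a_assoc[OF am] PiE_iff)
  qed (auto simp: abelian_monoid.a_closed[OF am] abelian_monoid.zero_closed[OF am] PiE_iff)
  moreover have "left_module_axioms R (direct_sum I M)"
    by (rule left_module_axioms.intro)
      (auto intro!: restrict_ext extensionalityI[of _ I] simp: PiE_iff left_module.smult_closed[OF M]
        left_module.smult_l_distr[OF M] left_module.smult_r_distr[OF M]
        left_module.smult_assoc1[OF M] left_module.smult_one[OF M])
  ultimately show ?thesis using R by (simp add: left_module_def)
qed

lemma direct_sum_proj_hom: "i \<in> I \<Longrightarrow> (\<lambda>x. x i) \<in> left_module_hom R (direct_sum I M) (M i)"
  by (rule left_module_homI) (auto simp: PiE_mem)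

lemma direct_sum_tuple_hom:
  assumes "\<And>i. i \<in> I \<Longrightarrow> p i \<in> left_module_hom R N (M i)"
  shows "(\<lambda>x. \<lambda>i\<in>I. p i x) \<in> left_module_hom R N (direct_sum I M)"
  using assms
  by (intro left_module_homI) (auto intro!: restrict_ext
    simp: lmh_closed[OF assms] lmh_add[OF assms] lmh_smult[OF assms])

lemma direct_sum_inj_hom:
  assumes M: "\<And>j. j \<in> I \<Longrightarrow> left_module R (M j)" and i: "i \<in> I"
  shows "(\<lambda>s. \<lambda>j\<in>I. if j = i then s else \<zero>\<^bsub>M j\<^esub>) \<in> left_module_hom R (M i) (direct_sum I M)"
proof -
  have am: "abelian_monoid (M i)" if "i \<in> I" for i
    using M[OF that] by (simp add: left_module_def abelian_group_def)
  show ?thesis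
    using i by (intro left_module_homI)
      (auto intro!: restrict_ext simp: abelian_monoid.zero_closed[OF am] abelian_monoid.l_zero[OF am]
        left_module.smult_r_null[OF M])
qed

text \<open>The entry at \<open>h i\<close> is the image of \<open>x i\<close>. Writing this through
  \<open>k\<close>, the inverse of \<open>h\<close>, makes both directions tuple maps with
  homomorphic components.\<close>

lemma direct_sum_iso_reindex:
  assumes M: "\<And>i. i \<in> I \<Longrightarrow> left_module R (M i)" and N: "\<And>j. j \<in> J \<Longrightarrow> left_module R (N j)"
    and h: "bij_betw h I J" and iso: "\<And>i. i \<in> I \<Longrightarrow> left_module_iso R (M i) (N (h i))"
  shows "left_module_iso R (direct_sum I M) (direct_sum J N)"
proof -
  have hJ: "h i \<in> J" if "i \<in> I" for i using h that by (auto simp: bij_betw_def)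
  have "\<exists>f g. f \<in> left_module_hom R (M i) (N (h i)) \<and> g \<in> left_module_hom R (N (h i)) (M i) \<and>
      (\<forall>x\<in>carrier (M i). g (f x) = x) \<and> (\<forall>y\<in>carrier (N (h i)). f (g y) = y)" if "i \<in> I" for i
    using left_module_isoE[OF M[OF that] N[OF hJ[OF that]] iso[OF that]] by metis
  then obtain f g where f: "\<And>i. i \<in> I \<Longrightarrow> f i \<in> left_module_hom R (M i) (N (h i))"
    and g: "\<And>i. i \<in> I \<Longrightarrow> g i \<in> left_module_hom R (N (h i)) (M i)"
    and gf: "\<And>i x. i \<in> I \<Longrightarrow> x \<in> carrier (M i) \<Longrightarrow> g i (f i x) = x"
    and fg: "\<And>i y. i \<in> I \<Longrightarrow> y \<in> carrier (N (h i)) \<Longrightarrow> f i (g i y) = y"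
    by metis
  define k where "k = inv_into I h"
  have k: "k j \<in> I" "h (k j) = j" if "j \<in> J" for j
    using h that by (auto simp: k_def bij_betw_def inv_into_into f_inv_into_f)
  have kh: "k (h i) = i" if "i \<in> I" for i using h that by (simp add: k_def bij_betw_def)
  show ?thesis
  proof (rule left_module_isoI)
    show "(\<lambda>x. \<lambda>j\<in>J. f (k j) (x (k j))) \<in> left_module_hom R (direct_sum I M) (direct_sum J N)"
    proof (rule direct_sum_tuple_hom)
      fix j assume "j \<in> J"
      then show "(\<lambda>x. f (k j) (x (k j))) \<in> left_module_hom R (direct_sum I M) (N j)"
        using lmh_comp[OF direct_sum_proj_hom[where M = M, OF k(1)[of j]] f[OF k(1)[of j]]] k(2)[of j] by simp
    qed
    show "(\<lambda>y. \<lambda>i\<in>I. g i (y (h i))) \<in> left_module_hom R (direct_sum J N) (direct_sum I M)"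
      by (rule direct_sum_tuple_hom) (rule lmh_comp[OF direct_sum_proj_hom[where M = N, OF hJ] g])
  next
    fix x assume "x \<in> carrier (direct_sum I M)"
    then show "(\<lambda>i\<in>I. g i ((\<lambda>j\<in>J. f (k j) (x (k j))) (h i))) = x"
      by (intro extensionalityI[of _ I]) (auto simp: PiE_iff hJ kh gf)
  next
    fix y assume "y \<in> carrier (direct_sum J N)"
    moreover from this have "y j \<in> carrier (N (h (k j)))" if "j \<in> J" for j
      using that k(2) by auto
    ultimately show "(\<lambda>j\<in>J. f (k j) ((\<lambda>i\<in>I. g i (y (h i))) (k j))) = y"
      using k by (intro extensionalityI[of _ J]) (auto simp: PiE_iff fg[OF k(1), simplified k(2)])
  qed
qed

lemma direct_sum_iso_cong:
  assumes M: "\<And>i. i \<in> I \<Longrightarrow> left_module R (M i)" and N: "\<And>i. i \<in> I \<Longrightarrow> left_module R (N i)"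
    and "\<And>i. i \<in> I \<Longrightarrow> left_module_iso R (M i) (N i)"
  shows "left_module_iso R (direct_sum I M) (direct_sum I N)"
  by (rule direct_sum_iso_reindex[where h = id]) (use assms in auto)

lemma direct_sum_Times_iso:
  "left_module_iso R (direct_sum I (\<lambda>i. direct_sum J (M i))) (direct_sum (I \<times> J) (\<lambda>(i, j). M i j))"
proof (rule left_module_isoI)
  show "(\<lambda>x. \<lambda>(i, j)\<in>I \<times> J. x i j)
    \<in> left_module_hom R (direct_sum I (\<lambda>i. direct_sum J (M i))) (direct_sum (I \<times> J) (\<lambda>(i, j). M i j))"
    by (rule left_module_homI) (auto intro!: restrict_ext simp: PiE_mem)
  show "(\<lambda>y. \<lambda>i\<in>I. \<lambda>j\<in>J. y (i, j))
    \<in> left_module_hom R (direct_sum (I \<times> J) (\<lambda>(i, j). M i j)) (direct_sum I (\<lambda>i. direct_sum J (M i)))"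
    by (rule left_module_homI) (auto intro!: restrict_ext simp: PiE_iff)
next
  fix x assume x: "x \<in> carrier (direct_sum I (\<lambda>i. direct_sum J (M i)))"
  show "(\<lambda>i\<in>I. \<lambda>j\<in>J. (\<lambda>(i, j)\<in>I \<times> J. x i j) (i, j)) = x"
  proof (rule extensionalityI[of _ I])
    fix i assume i: "i \<in> I"
    then have "x i \<in> extensional J" using x by (auto simp: PiE_def Pi_def)
    with i show "(\<lambda>i\<in>I. \<lambda>j\<in>J. (\<lambda>(i, j)\<in>I \<times> J. x i j) (i, j)) i = x i"
      by (auto intro!: extensionalityI[of _ J])
  qed (use x in \<open>auto simp: PiE_def\<close>)
next
  fix y assume "y \<in> carrier (direct_sum (I \<times> J) (\<lambda>(i, j). M i j))"
  then show "(\<lambda>(i, j)\<in>I \<times> J. (\<lambda>i\<in>I. \<lambda>j\<in>J. y (i, j)) i j) = y"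
    by (intro extensionalityI[of _ "I \<times> J"]) (auto simp: PiE_def)
qed

section \<open>Sums of images of a family of homomorphisms\<close>

definition sum_image where
  "sum_image M I S u = {\<Oplus>\<^bsub>M\<^esub>i\<in>I. u i (x i) | x. \<forall>i\<in>I. x i \<in> carrier (S i)}"

text \<open>For module homomorphisms this includes injectivity of each \<open>u i\<close>; together
  with a full \<open>sum_image\<close> it makes \<open>M\<close> the direct sum of the
  \<open>S i\<close> along \<open>u\<close>.\<close>

definition sum_indep where
  "sum_indep M I S u \<longleftrightarrow> (\<forall>x. (\<forall>i\<in>I. x i \<in> carrier (S i)) \<longrightarrow> (\<Oplus>\<^bsub>M\<^esub>i\<in>I. u i (x i)) = \<zero>\<^bsub>M\<^esub> \<longrightarrow>
     (\<forall>i\<in>I. x i = \<zero>\<^bsub>S i\<^esub>))"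

locale hom_family = M: left_module R M
  for R :: "('a, 'r) ring_scheme" and M :: "('a, 'm, 'x) module_scheme" +
  fixes I :: "'i set" and S :: "'i \<Rightarrow> ('a, 'n, 'y) module_scheme" and u
  assumes fin: "finite I" and S: "\<And>i. i \<in> I \<Longrightarrow> left_module R (S i)"
    and u: "\<And>i. i \<in> I \<Longrightarrow> u i \<in> left_module_hom R (S i) M"
begin

lemma sum_hom: "(\<lambda>x. \<Oplus>\<^bsub>M\<^esub>i\<in>I. u i (x i)) \<in> left_module_hom R (direct_sum I S) M"
proof (rule left_module_homI)
  fix x y assume "x \<in> carrier (direct_sum I S)" "y \<in> carrier (direct_sum I S)"
  then have x: "x i \<in> carrier (S i)" and y: "y i \<in> carrier (S i)" if "i \<in> I" for i
    using that by auto
  have "(\<Oplus>\<^bsub>M\<^esub>i\<in>I. u i ((x \<oplus>\<^bsub>direct_sum I S\<^esub> y) i)) = (\<Oplus>\<^bsub>M\<^esub>i\<in>I. u i (x i) \<oplus>\<^bsub>M\<^esub> u i (y i))"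
    by (intro M.M.finsum_cong') (auto simp: lmh_add[OF u] lmh_closed[OF u] x y)
  also have "\<dots> = (\<Oplus>\<^bsub>M\<^esub>i\<in>I. u i (x i)) \<oplus>\<^bsub>M\<^esub> (\<Oplus>\<^bsub>M\<^esub>i\<in>I. u i (y i))"
    by (intro M.M.finsum_addf) (auto simp: lmh_closed[OF u] x y)
  finally show "(\<Oplus>\<^bsub>M\<^esub>i\<in>I. u i ((x \<oplus>\<^bsub>direct_sum I S\<^esub> y) i)) =
    (\<Oplus>\<^bsub>M\<^esub>i\<in>I. u i (x i)) \<oplus>\<^bsub>M\<^esub> (\<Oplus>\<^bsub>M\<^esub>i\<in>I. u i (y i))" .
next
  fix a x assume a: "a \<in> carrier R" and "x \<in> carrier (direct_sum I S)"
  then have x: "x i \<in> carrier (S i)" if "i \<in> I" for i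
    using that by auto
  have "(\<Oplus>\<^bsub>M\<^esub>i\<in>I. u i ((a \<odot>\<^bsub>direct_sum I S\<^esub> x) i)) = (\<Oplus>\<^bsub>M\<^esub>i\<in>I. a \<odot>\<^bsub>M\<^esub> u i (x i))"
    using a by (intro M.M.finsum_cong') (auto simp: lmh_smult[OF u] lmh_closed[OF u] x)
  also have "\<dots> = a \<odot>\<^bsub>M\<^esub> (\<Oplus>\<^bsub>M\<^esub>i\<in>I. u i (x i))"
    using a fin by (intro M.finsum_smult[symmetric]) (auto simp: lmh_closed[OF u] x)
  finally show "(\<Oplus>\<^bsub>M\<^esub>i\<in>I. u i ((a \<odot>\<^bsub>direct_sum I S\<^esub> x) i)) = a \<odot>\<^bsub>M\<^esub> (\<Oplus>\<^bsub>M\<^esub>i\<in>I. u i (x i))" .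
qed (auto intro!: M.M.finsum_closed simp: lmh_closed[OF u] PiE_iff)

lemma restrict_sum:
  assumes "\<forall>i\<in>I. x i \<in> carrier (S i)"
  shows "(\<Oplus>\<^bsub>M\<^esub>i\<in>I. u i (restrict x I i)) = (\<Oplus>\<^bsub>M\<^esub>i\<in>I. u i (x i))"
  using assms by (intro M.M.finsum_cong') (auto simp: lmh_closed[OF u])

lemma sum_image_eq: "sum_image M I S u = (\<lambda>x. \<Oplus>\<^bsub>M\<^esub>i\<in>I. u i (x i)) ` carrier (direct_sum I S)"
proof (intro subset_antisym subsetI)
  fix y assume "y \<in> sum_image M I S u"
  then obtain x where x: "\<forall>i\<in>I. x i \<in> carrier (S i)" "y = (\<Oplus>\<^bsub>M\<^esub>i\<in>I. u i (x i))"
    by (auto simp: sum_image_def)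
  then show "y \<in> (\<lambda>x. \<Oplus>\<^bsub>M\<^esub>i\<in>I. u i (x i)) ` carrier (direct_sum I S)"
    using restrict_sum[OF x(1)] by (intro image_eqI[of _ _ "restrict x I"]) auto
qed (auto simp: sum_image_def PiE_mem)

lemma sum_image_submodule: "submodule (sum_image M I S u) R M"
proof -
  interpret D: left_module R "direct_sum I S" by (rule direct_sum_left_module[OF M.R.ring_axioms S])
  interpret module_hom_pair R "direct_sum I S" M "\<lambda>x. \<Oplus>\<^bsub>M\<^esub>i\<in>I. u i (x i)"
    by (intro module_hom_pairI D.left_module_axioms M.left_module_axioms sum_hom)
  show ?thesis unfolding sum_image_eq by (rule image_submodule[OF D.submodule_carrier])
qed

lemma iso_direct_sum:
  assumes ind: "sum_indep M I S u" and im: "sum_image M I S u = carrier M"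
  shows "left_module_iso R (direct_sum I S) M"
proof -
  interpret D: left_module R "direct_sum I S" by (rule direct_sum_left_module[OF M.R.ring_axioms S])
  interpret module_hom_pair R "direct_sum I S" M "\<lambda>x. \<Oplus>\<^bsub>M\<^esub>i\<in>I. u i (x i)"
    by (intro module_hom_pairI D.left_module_axioms M.left_module_axioms sum_hom)
  have "inj_on (\<lambda>x. \<Oplus>\<^bsub>M\<^esub>i\<in>I. u i (x i)) (carrier (direct_sum I S))"
    unfolding inj_iff
  proof (intro ballI impI)
    fix x assume "x \<in> carrier (direct_sum I S)" "(\<Oplus>\<^bsub>M\<^esub>i\<in>I. u i (x i)) = \<zero>\<^bsub>M\<^esub>"
    moreover from this have "x i = \<zero>\<^bsub>S i\<^esub>" if "i \<in> I" for i
      using ind that unfolding sum_indep_def by (auto simp: PiE_mem)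
    ultimately show "x = \<zero>\<^bsub>direct_sum I S\<^esub>"
      by (intro extensionalityI[of _ I]) (auto simp: PiE_def)
  qed
  then show ?thesis
    using hom im unfolding sum_image_eq left_module_iso_def bij_betw_def by blast
qed

end

lemma hom_familyI:
  assumes "left_module R M" "finite I" "\<And>i. i \<in> I \<Longrightarrow> left_module R (S i)"
    "\<And>i. i \<in> I \<Longrightarrow> u i \<in> left_module_hom R (S i) M"
  shows "hom_family R M I S u"
  using assms by (simp add: hom_family_def hom_family_axioms_def)

lemma sum_image_insert:
  assumes "hom_family R M (insert i I) S u" and i: "i \<notin> I"
  shows "sum_image M (insert i I) S u = {u i s \<oplus>\<^bsub>M\<^esub> y | s y. s \<in> carrier (S i) \<and> y \<in> sum_image M I S u}"
    (is "?L = ?R")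
proof -
  interpret hom_family R M "insert i I" S u by (rule assms(1))
  have split: "(\<Oplus>\<^bsub>M\<^esub>j\<in>insert i I. u j (x j)) = u i (x i) \<oplus>\<^bsub>M\<^esub> (\<Oplus>\<^bsub>M\<^esub>j\<in>I. u j (x j))"
    if "\<forall>j\<in>insert i I. x j \<in> carrier (S j)" for x
    using that fin i by (intro M.M.finsum_insert) (auto simp: lmh_closed[OF u])
  show ?thesis
  proof (intro subset_antisym subsetI)
    fix y assume "y \<in> ?L"
    then show "y \<in> ?R" using split by (fastforce simp: sum_image_def)
  next
    fix y assume "y \<in> ?R"
    then obtain s x where sx: "s \<in> carrier (S i)" "\<forall>j\<in>I. x j \<in> carrier (S j)"
      "y = u i s \<oplus>\<^bsub>M\<^esub> (\<Oplus>\<^bsub>M\<^esub>j\<in>I. u j (x j))"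
      by (auto simp: sum_image_def)
    have "(\<Oplus>\<^bsub>M\<^esub>j\<in>I. u j ((x(i := s)) j)) = (\<Oplus>\<^bsub>M\<^esub>j\<in>I. u j (x j))"
      using sx i by (intro M.M.finsum_cong') (auto simp: lmh_closed[OF u])
    then have "y = (\<Oplus>\<^bsub>M\<^esub>j\<in>insert i I. u j ((x(i := s)) j))"
      using sx i split[of "x(i := s)"] by auto
    then show "y \<in> ?L" using sx i by (auto simp: sum_image_def intro!: exI[of _ "x(i := s)"])
  qed
qed

text \<open>Greedy choice. The preimage under \<open>u i\<close> of the sum obtained so far is a
  submodule of the simple module \<open>S i\<close>: if it is zero, \<open>i\<close> joins
  \<open>J\<close> and independence persists; if it is everything, \<open>u i\<close> adds nothing
  to the image.\<close>

lemma semisimple_subfamily: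
  assumes M: "left_module R M" and "finite I" and S: "\<And>i. i \<in> I \<Longrightarrow> simple_left_module R (S i)"
    and u: "\<And>i. i \<in> I \<Longrightarrow> u i \<in> left_module_hom R (S i) M"
  shows "\<exists>J\<subseteq>I. sum_indep M J S u \<and> sum_image M J S u = sum_image M I S u"
  using \<open>finite I\<close> S u
proof (induction I rule: finite_induct)
  case empty
  then show ?case by (intro exI[of _ "{}"]) (simp add: sum_indep_def)
next
  case (insert i I)
  interpret M: left_module R M by (rule M)
  obtain J where J: "J \<subseteq> I" "sum_indep M J S u" "sum_image M J S u = sum_image M I S u"
    using insert.IH insert.prems by auto
  have fam: "hom_family R M K S u" if "K \<subseteq> insert i I" for K
    using that insert.prems insert.hyps finite_subset[OF that]
    by (intro hom_familyI M) (auto simp: simple_left_moduleD)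
  interpret K: hom_family R M "insert i I" S u by (rule fam) simp
  interpret J: hom_family R M J S u by (rule fam) (use J in auto)
  interpret I: hom_family R M I S u by (rule fam) auto
  let ?P = "sum_image M I S u"
  interpret P: submodule ?P R M by (rule I.sum_image_submodule)
  note ins = sum_image_insert[OF fam[OF subset_refl] insert.hyps(2)]
  interpret ui: module_hom_pair R "S i" M "u i"
    using insert.prems M by (intro module_hom_pairI) (auto simp: simple_left_moduleD)
  have si: "simple_left_module R (S i)" using insert.prems by simp
  consider "{s \<in> carrier (S i). u i s \<in> ?P} = {\<zero>\<^bsub>S i\<^esub>}" | "{s \<in> carrier (S i). u i s \<in> ?P} = carrier (S i)"
    using simple_left_moduleD(3)[OF si ui.vimage_submodule[OF I.sum_image_submodule]] by blast
  then show ?case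
  proof cases
    case 1
    have iJ: "i \<notin> J" using J insert.hyps by auto
    have "sum_indep M (insert i J) S u"
      unfolding sum_indep_def
    proof (intro allI impI)
      fix x assume x: "\<forall>j\<in>insert i J. x j \<in> carrier (S j)"
        and 0: "(\<Oplus>\<^bsub>M\<^esub>j\<in>insert i J. u j (x j)) = \<zero>\<^bsub>M\<^esub>"
      have "(\<Oplus>\<^bsub>M\<^esub>j\<in>J. u j (x j)) \<in> sum_image M J S u" using x by (auto simp: sum_image_def)
      then have y: "(\<Oplus>\<^bsub>M\<^esub>j\<in>J. u j (x j)) \<in> ?P" using J by simp
      have sp: "u i (x i) \<oplus>\<^bsub>M\<^esub> (\<Oplus>\<^bsub>M\<^esub>j\<in>J. u j (x j)) = \<zero>\<^bsub>M\<^esub>"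
        using x 0 iJ J.fin M.M.finsum_insert[of J i "\<lambda>j. u j (x j)"]
        by (auto simp: lmh_closed[OF J.u])
      then have "u i (x i) = \<ominus>\<^bsub>M\<^esub> (\<Oplus>\<^bsub>M\<^esub>j\<in>J. u j (x j))"
        using x y P.subset M.M.minus_equality by auto
      then have "u i (x i) \<in> ?P" using P.m_inv_closed[OF y] by (simp add: a_inv_def)
      then have xi: "x i = \<zero>\<^bsub>S i\<^esub>" using 1 x by auto
      then have "(\<Oplus>\<^bsub>M\<^esub>j\<in>J. u j (x j)) = \<zero>\<^bsub>M\<^esub>" using sp subsetD[OF P.subset y] by simp
      then show "\<forall>j\<in>insert i J. x j = \<zero>\<^bsub>S j\<^esub>"
        using J(2) x xi unfolding sum_indep_def by auto
    qed
    moreover have "sum_image M (insert i J) S u = sum_image M (insert i I) S u"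
      unfolding ins using J sum_image_insert[OF fam iJ] by auto
    ultimately show ?thesis using J by (intro exI[of _ "insert i J"]) auto
  next
    case 2
    have "sum_image M (insert i I) S u = ?P"
    proof (intro subset_antisym subsetI)
      fix y assume "y \<in> sum_image M (insert i I) S u"
      then obtain s z where "y = u i s \<oplus>\<^bsub>M\<^esub> z" "s \<in> carrier (S i)" "z \<in> ?P" by (auto simp: ins)
      then show "y \<in> ?P" using 2 P.m_closed by auto
    next
      fix y assume y: "y \<in> ?P"
      then have "y = u i \<zero>\<^bsub>S i\<^esub> \<oplus>\<^bsub>M\<^esub> y" using subsetD[OF P.subset y] by simp
      then show "y \<in> sum_image M (insert i I) S u" using y by (auto simp: ins simp del: ui.zero)
    qed
    then show ?thesis using J by (intro exI[of _ J]) auto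
  qed
qed

corollary semisimple_decomposition:
  assumes M: "left_module R M" and I: "finite I" and S: "\<And>i. i \<in> I \<Longrightarrow> simple_left_module R (S i)"
    and u: "\<And>i. i \<in> I \<Longrightarrow> u i \<in> left_module_hom R (S i) M" and im: "sum_image M I S u = carrier M"
  obtains J where "J \<subseteq> I" "left_module_iso R M (direct_sum J S)"
proof -
  obtain J where J: "J \<subseteq> I" "sum_indep M J S u" "sum_image M J S u = carrier M"
    using semisimple_subfamily[of R M I S u, OF M I S u] im by auto
  interpret J: hom_family R M J S u
    using J(1) finite_subset[OF J(1) I] S u M by (intro hom_familyI) (auto simp: simple_left_moduleD)
  have "left_module R (direct_sum J S)"
    using J.S by (intro direct_sum_left_module) (simp_all add: J.M.R.ring_axioms)
  then show thesis
    using left_module_iso_sym[OF _ M J.iso_direct_sum[OF J(2,3)]] that[OF J(1)] by blast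
qed

section \<open>Uniqueness of decompositions and finite length\<close>

lemma (in left_module) smult_r_minus:
  assumes "a \<in> carrier R" "x \<in> carrier M"
  shows "a \<odot>\<^bsub>M\<^esub> (\<ominus>\<^bsub>M\<^esub> x) = \<ominus>\<^bsub>M\<^esub> (a \<odot>\<^bsub>M\<^esub> x)"
proof -
  have "a \<odot>\<^bsub>M\<^esub> (\<ominus>\<^bsub>M\<^esub> x) \<oplus>\<^bsub>M\<^esub> a \<odot>\<^bsub>M\<^esub> x = a \<odot>\<^bsub>M\<^esub> (\<ominus>\<^bsub>M\<^esub> x \<oplus>\<^bsub>M\<^esub> x)"
    using assms by (simp only: smult_r_distr M.a_inv_closed)
  also have "\<dots> = \<zero>\<^bsub>M\<^esub>" using assms by (simp add: M.l_neg)
  finally show ?thesis using assms by (intro M.minus_equality[symmetric]) auto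
qed

lemma lmh_plus:
  assumes N: "left_module R N" and f: "f \<in> left_module_hom R M N" and g: "g \<in> left_module_hom R M N"
  shows "(\<lambda>x. f x \<oplus>\<^bsub>N\<^esub> g x) \<in> left_module_hom R M N"
proof -
  interpret N: left_module R N by (rule N)
  show ?thesis
    by (rule left_module_homI) (simp_all add: lmh_closed[OF f] lmh_closed[OF g] lmh_add[OF f] lmh_add[OF g]
      lmh_smult[OF f] lmh_smult[OF g] N.smult_r_distr N.M.a_ac)
qed

lemma lmh_uminus:
  assumes N: "left_module R N" and f: "f \<in> left_module_hom R M N"
  shows "(\<lambda>x. \<ominus>\<^bsub>N\<^esub> f x) \<in> left_module_hom R M N"
proof -
  interpret N: left_module R N by (rule N)
  show ?thesis
    by (rule left_module_homI) (simp_all add: lmh_closed[OF f] lmh_add[OF f] lmh_smult[OF f]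
      N.smult_r_minus N.M.minus_add)
qed

text \<open>The Steinitz exchange argument: if some composite \<open>p\<^sub>j u\<^sub>i\<close> is nonzero, it is an isomorphism by Schur's
  lemma, and subtracting suitable multiples of \<open>u\<^sub>i\<close> from the other maps eliminates both \<open>i\<close> and \<open>j\<close>.\<close>

lemma simple_family_exchange:
  assumes M: "left_module R M" and "finite J"
    and "\<And>j. j \<in> J \<Longrightarrow> simple_left_module R (T j)" "\<And>j. j \<in> J \<Longrightarrow> p j \<in> left_module_hom R M (T j)"
    and "finite I" "\<And>i. i \<in> I \<Longrightarrow> simple_left_module R (S i)" "\<And>i. i \<in> I \<Longrightarrow> u i \<in> left_module_hom R (S i) M"
    and "\<And>x. \<lbrakk>\<forall>i\<in>I. x i \<in> carrier (S i); \<forall>j\<in>J. p j (\<Oplus>\<^bsub>M\<^esub>i\<in>I. u i (x i)) = \<zero>\<^bsub>T j\<^esub>\<rbrakk> \<Longrightarrow>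
      \<forall>i\<in>I. x i = \<zero>\<^bsub>S i\<^esub>"
  shows "\<exists>\<pi>. inj_on \<pi> I \<and> \<pi> ` I \<subseteq> J \<and> (\<forall>i\<in>I. left_module_iso R (S i) (T (\<pi> i)))"
  using assms(2-)
proof (induction J arbitrary: I u rule: finite_induct)
  case empty
  \<comment> \<open>No \<open>p j\<close> remains, so the joint condition forces every tuple to
    vanish; a tuple of nonzero vectors then shows that there is no index.\<close>
  have "I = {}"
  proof (rule ccontr)
    assume "I \<noteq> {}"
    then obtain i where i: "i \<in> I" by auto
    have "\<exists>x. x \<in> carrier (S i) \<and> x \<noteq> \<zero>\<^bsub>S i\<^esub>" if "i \<in> I" for i
      using simple_left_moduleD(2)[OF empty.prems(4)[OF that]] by blast
    then obtain x where x: "\<And>i. i \<in> I \<Longrightarrow> x i \<in> carrier (S i)" "\<And>i. i \<in> I \<Longrightarrow> x i \<noteq> \<zero>\<^bsub>S i\<^esub>" by metis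
    then show False using empty.prems(6)[of x] i by auto
  qed
  then show ?case by simp
next
  case (insert j J)
  interpret M: left_module R M by (rule M)
  note T = insert.prems(1) and p = insert.prems(2) and finI = insert.prems(3)
    and S = insert.prems(4) and u = insert.prems(5) and joint = insert.prems(6)
  note Slm = simple_left_moduleD(1)[OF S]
  have Tj: "simple_left_module R (T j)" "left_module R (T j)"
    using T[of j] simple_left_moduleD(1)[OF T[of j]] by auto
  have pj: "p j \<in> left_module_hom R M (T j)" using p by simp
  interpret pj: module_hom_pair R M "T j" "p j" by (rule module_hom_pairI) fact+
  show ?case
  proof (cases "\<exists>i\<in>I. \<exists>s\<in>carrier (S i). p j (u i s) \<noteq> \<zero>\<^bsub>T j\<^esub>")
    \<comment> \<open>\<open>p j\<close> vanishes on every image of \<open>u i\<close>, hence on all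
      sums, so the remaining projections already detect zero and the induction hypothesis applies to
      the unchanged family.\<close>
    case False
    have "\<exists>\<pi>. inj_on \<pi> I \<and> \<pi> ` I \<subseteq> J \<and> (\<forall>i\<in>I. left_module_iso R (S i) (T (\<pi> i)))"
    proof (rule insert.IH)
      fix x assume x: "\<forall>i\<in>I. x i \<in> carrier (S i)" and 0: "\<forall>k\<in>J. p k (\<Oplus>\<^bsub>M\<^esub>i\<in>I. u i (x i)) = \<zero>\<^bsub>T k\<^esub>"
      have "p j (\<Oplus>\<^bsub>M\<^esub>i\<in>I. u i (x i)) = (\<Oplus>\<^bsub>T j\<^esub>i\<in>I. p j (u i (x i)))"
        using x finI by (intro pj.finsum) (auto simp: lmh_closed[OF u])
      also have "\<dots> = (\<Oplus>\<^bsub>T j\<^esub>i\<in>I. \<zero>\<^bsub>T j\<^esub>)"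
        using x False by (intro pj.N.M.finsum_cong') auto
      finally have "p j (\<Oplus>\<^bsub>M\<^esub>i\<in>I. u i (x i)) = \<zero>\<^bsub>T j\<^esub>" by simp
      with 0 have "\<forall>k\<in>insert j J. p k (\<Oplus>\<^bsub>M\<^esub>i\<in>I. u i (x i)) = \<zero>\<^bsub>T k\<^esub>" by blast
      then show "\<forall>i\<in>I. x i = \<zero>\<^bsub>S i\<^esub>" by (rule joint[OF x])
    qed (use T p finI S u in auto)
    then show ?thesis by blast
  next
    case True
    then obtain i0 s0 where i0: "i0 \<in> I" and s0: "s0 \<in> carrier (S i0)" "p j (u i0 s0) \<noteq> \<zero>\<^bsub>T j\<^esub>" by auto
    define q where "q = (\<lambda>s. p j (u i0 s))"
    have q: "q \<in> left_module_hom R (S i0) (T j)" unfolding q_def by (rule lmh_comp[OF u[OF i0] pj])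
    have bij: "bij_betw q (carrier (S i0)) (carrier (T j))"
      using simple_source_inj[OF S[OF i0] Tj(2) q s0(1)] simple_target_surj[OF Slm[OF i0] Tj(1) q s0(1)] s0(2)
      by (simp add: q_def bij_betw_def)
    interpret q: module_hom_pair R "S i0" "T j" q by (intro module_hom_pairI Slm i0 Tj q)
    interpret u0: module_hom_pair R "S i0" M "u i0" by (intro module_hom_pairI Slm i0 M u)
    define \<eta> where "\<eta> = inv_into (carrier (S i0)) q"
    have \<eta>: "\<eta> \<in> left_module_hom R (T j) (S i0)" unfolding \<eta>_def by (rule q.inverse_hom[OF bij])
    have q\<eta>: "q (\<eta> y) = y" if "y \<in> carrier (T j)" for y
      using bij that by (auto simp: \<eta>_def bij_betw_def f_inv_into_f)
    \<comment> \<open>With this correction along \<open>u i0\<close>, \<open>p j\<close> annihilates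
      each \<open>u' i\<close>: \<open>q\<close> composed with its inverse \<eta> cancels
      \<open>p j (u i s)\<close>.\<close>
    define h where "h = (\<lambda>i s. \<ominus>\<^bsub>S i0\<^esub> \<eta> (p j (u i s)))"
    have h: "h i \<in> left_module_hom R (S i) (S i0)" if "i \<in> I" for i
      unfolding h_def by (rule lmh_uminus[OF Slm[OF i0] lmh_comp[OF lmh_comp[OF u[OF that] pj] \<eta>]])
    define u' where "u' = (\<lambda>i s. u i s \<oplus>\<^bsub>M\<^esub> u i0 (h i s))"
    have u': "u' i \<in> left_module_hom R (S i) M" if "i \<in> I" for i
      unfolding u'_def by (rule lmh_plus[OF M u[OF that] lmh_comp[OF h[OF that] u[OF i0]]])
    have pu': "p j (u' i s) = \<zero>\<^bsub>T j\<^esub>" if i: "i \<in> I" and s: "s \<in> carrier (S i)" for i s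
    proof -
      have c: "p j (u i s) \<in> carrier (T j)" using lmh_closed[OF lmh_comp[OF u[OF i] pj] s] .
      have "p j (u i0 (h i s)) = \<ominus>\<^bsub>T j\<^esub> q (\<eta> (p j (u i s)))"
        using q.minus[OF lmh_closed[OF \<eta> c]] by (simp add: h_def q_def)
      then have "p j (u i0 (h i s)) = \<ominus>\<^bsub>T j\<^esub> p j (u i s)" using q\<eta>[OF c] by simp
      then show ?thesis
        using c lmh_closed[OF u[OF i] s] lmh_closed[OF h[OF i] s]
        by (simp add: u'_def pj.add pj.N.M.r_neg)
    qed
    let ?I = "I - {i0}"
    have "\<exists>\<pi>. inj_on \<pi> ?I \<and> \<pi> ` ?I \<subseteq> J \<and> (\<forall>i\<in>?I. left_module_iso R (S i) (T (\<pi> i)))"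
    proof (rule insert.IH[where u = u'])
      fix x assume x: "\<forall>i\<in>?I. x i \<in> carrier (S i)"
        and 0: "\<forall>k\<in>J. p k (\<Oplus>\<^bsub>M\<^esub>i\<in>?I. u' i (x i)) = \<zero>\<^bsub>T k\<^esub>"
      have cl: "u i (x i) \<in> carrier M" "h i (x i) \<in> carrier (S i0)" "u' i (x i) \<in> carrier M" if "i \<in> ?I" for i
        using that x lmh_closed[OF u] lmh_closed[OF h] lmh_closed[OF u'] by auto
      \<comment> \<open>The same element in terms of the old family: all corrections are collected
        in the coordinate at \<open>i0\<close>, so a relation for \<open>u'\<close> becomes one for
        \<open>u\<close>.\<close>
      define y where "y = x(i0 := \<Oplus>\<^bsub>S i0\<^esub>i\<in>?I. h i (x i))"
      have yI: "\<forall>i\<in>I. y i \<in> carrier (S i)"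
        using x cl by (auto simp: y_def intro!: q.M.M.finsum_closed)
      have yeq: "(\<Oplus>\<^bsub>M\<^esub>i\<in>?I. u i (y i)) = (\<Oplus>\<^bsub>M\<^esub>i\<in>?I. u i (x i))"
        using cl by (intro M.M.finsum_cong') (auto simp: y_def)
      have "(\<Oplus>\<^bsub>M\<^esub>i\<in>?I. u' i (x i)) = (\<Oplus>\<^bsub>M\<^esub>i\<in>?I. u i (x i)) \<oplus>\<^bsub>M\<^esub> (\<Oplus>\<^bsub>M\<^esub>i\<in>?I. u i0 (h i (x i)))"
        unfolding u'_def using cl by (intro M.M.finsum_addf) (auto simp: Pi_def)
      also have "(\<Oplus>\<^bsub>M\<^esub>i\<in>?I. u i0 (h i (x i))) = u i0 (y i0)"
        using cl finI by (subst u0.finsum[symmetric]) (auto simp: y_def Pi_def)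
      also have "(\<Oplus>\<^bsub>M\<^esub>i\<in>?I. u i (x i)) \<oplus>\<^bsub>M\<^esub> u i0 (y i0) = (\<Oplus>\<^bsub>M\<^esub>i\<in>I. u i (y i))"
      proof -
        have "(\<Oplus>\<^bsub>M\<^esub>i\<in>insert i0 ?I. u i (y i)) = u i0 (y i0) \<oplus>\<^bsub>M\<^esub> (\<Oplus>\<^bsub>M\<^esub>i\<in>?I. u i (y i))"
          using finI yI i0 lmh_closed[OF u] by (intro M.M.finsum_insert) auto
        moreover have "(\<Oplus>\<^bsub>M\<^esub>i\<in>?I. u i (x i)) \<in> carrier M" using cl by (intro M.M.finsum_closed) auto
        ultimately show ?thesis using yeq yI i0 lmh_closed[OF u] by (simp add: insert_absorb M.M.a_comm)
      qed
      finally have eq: "(\<Oplus>\<^bsub>M\<^esub>i\<in>?I. u' i (x i)) = (\<Oplus>\<^bsub>M\<^esub>i\<in>I. u i (y i))" .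
      have "p j (\<Oplus>\<^bsub>M\<^esub>i\<in>?I. u' i (x i)) = (\<Oplus>\<^bsub>T j\<^esub>i\<in>?I. p j (u' i (x i)))"
        using cl finI by (intro pj.finsum) auto
      also have "\<dots> = (\<Oplus>\<^bsub>T j\<^esub>i\<in>?I. \<zero>\<^bsub>T j\<^esub>)"
        using x pu' by (intro pj.N.M.finsum_cong') auto
      finally have "p j (\<Oplus>\<^bsub>M\<^esub>i\<in>?I. u' i (x i)) = \<zero>\<^bsub>T j\<^esub>" by simp
      with 0 have "\<forall>k\<in>insert j J. p k (\<Oplus>\<^bsub>M\<^esub>i\<in>I. u i (y i)) = \<zero>\<^bsub>T k\<^esub>" unfolding eq by blast
      then have "\<forall>i\<in>I. y i = \<zero>\<^bsub>S i\<^esub>" by (rule joint[OF yI])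
      then show "\<forall>i\<in>?I. x i = \<zero>\<^bsub>S i\<^esub>" unfolding y_def by (metis DiffE fun_upd_other singletonI)
    qed (use T p finI S u' in auto)
    then obtain \<pi> where \<pi>: "inj_on \<pi> ?I" "\<pi> ` ?I \<subseteq> J" "\<forall>i\<in>?I. left_module_iso R (S i) (T (\<pi> i))" by blast
    have "left_module_iso R (S i0) (T j)" using q bij by (auto simp: left_module_iso_def)
    then show ?thesis
      using \<pi> insert.hyps
      by (intro exI[of _ "\<pi>(i0 := j)"]) (auto simp: inj_on_def image_subset_iff)
  qed
qed

text \<open>Exchange applied to the inclusions of one decomposition and the coordinate projections
  of the other. It yields an injection of index sets that respects isomorphism types; used in both
  directions it equates numbers of summands.\<close>

theorem decomposition_unique:
  assumes M: "left_module R M" and I: "finite I" and J: "finite J"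
    and S: "\<And>i. i \<in> I \<Longrightarrow> simple_left_module R (S i)" and T: "\<And>j. j \<in> J \<Longrightarrow> simple_left_module R (T j)"
    and isoS: "left_module_iso R M (direct_sum I S)" and isoT: "left_module_iso R M (direct_sum J T)"
  obtains \<pi> where "inj_on \<pi> I" "\<pi> ` I \<subseteq> J" "\<And>i. i \<in> I \<Longrightarrow> left_module_iso R (S i) (T (\<pi> i))"
proof -
  interpret M: left_module R M by (rule M)
  note Slm = simple_left_moduleD(1)[OF S] and Tlm = simple_left_moduleD(1)[OF T]
  interpret DS: left_module R "direct_sum I S" by (rule direct_sum_left_module[OF M.R.ring_axioms Slm])
  interpret DT: left_module R "direct_sum J T" by (rule direct_sum_left_module[OF M.R.ring_axioms Tlm])
  obtain f g where f: "f \<in> left_module_hom R M (direct_sum I S)" and g: "g \<in> left_module_hom R (direct_sum I S) M"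
    and gf: "\<And>x. x \<in> carrier M \<Longrightarrow> g (f x) = x" and fg: "\<And>y. y \<in> carrier (direct_sum I S) \<Longrightarrow> f (g y) = y"
    by (rule left_module_isoE[OF M DS.left_module_axioms isoS]) blast
  obtain k l where k: "k \<in> left_module_hom R M (direct_sum J T)"
    and l: "l \<in> left_module_hom R (direct_sum J T) M" and lk: "\<And>x. x \<in> carrier M \<Longrightarrow> l (k x) = x"
    by (rule left_module_isoE[OF M DT.left_module_axioms isoT]) blast
  interpret l: module_hom_pair R "direct_sum J T" M l
    by (intro module_hom_pairI DT.left_module_axioms M l)
  interpret f: module_hom_pair R M "direct_sum I S" f
    by (intro module_hom_pairI DS.left_module_axioms M f)
  define p where "p = (\<lambda>j x. k x j)"
  define u where "u = (\<lambda>i s. g (\<lambda>k\<in>I. if k = i then s else \<zero>\<^bsub>S k\<^esub>))"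
  have u: "u i \<in> left_module_hom R (S i) M" if "i \<in> I" for i
    unfolding u_def by (rule lmh_comp[OF direct_sum_inj_hom[where M = S, OF Slm that] g])
  have "\<exists>\<pi>. inj_on \<pi> I \<and> \<pi> ` I \<subseteq> J \<and> (\<forall>i\<in>I. left_module_iso R (S i) (T (\<pi> i)))"
  proof (rule simple_family_exchange[OF M J T _ I S u])
    show "p j \<in> left_module_hom R M (T j)" if "j \<in> J" for j
      unfolding p_def by (rule lmh_comp[OF k direct_sum_proj_hom[where M = T, OF that]])
    fix x assume x: "\<forall>i\<in>I. x i \<in> carrier (S i)" and 0: "\<forall>j\<in>J. p j (\<Oplus>\<^bsub>M\<^esub>i\<in>I. u i (x i)) = \<zero>\<^bsub>T j\<^esub>"
    let ?m = "\<Oplus>\<^bsub>M\<^esub>i\<in>I. u i (x i)"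
    have m: "?m \<in> carrier M" using x lmh_closed[OF u] by (intro M.M.finsum_closed) auto
    have "k ?m = \<zero>\<^bsub>direct_sum J T\<^esub>"
      using lmh_closed[OF k m] 0 by (intro extensionalityI[of _ J]) (auto simp: p_def PiE_def)
    then have m0: "?m = \<zero>\<^bsub>M\<^esub>" using lk[OF m] l.zero by simp
    show "\<forall>i\<in>I. x i = \<zero>\<^bsub>S i\<^esub>"
    proof
      fix i assume i: "i \<in> I"
      interpret pi: module_hom_pair R "direct_sum I S" "S i" "\<lambda>x. x i"
        by (intro module_hom_pairI DS.left_module_axioms Slm direct_sum_proj_hom i)
      interpret fi: module_hom_pair R M "S i" "\<lambda>x. f x i"
        by (intro module_hom_pairI M Slm i lmh_comp[OF f direct_sum_proj_hom[where M = S, OF i]])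
      have "f (u i' (x i')) i = (if i = i' then x i else \<zero>\<^bsub>S i\<^esub>)" if "i' \<in> I" for i'
        unfolding u_def using that x i lmh_closed[OF direct_sum_inj_hom[where M = S, OF Slm that], of "x i'"]
        by (subst fg) auto
      then have "f ?m i = (\<Oplus>\<^bsub>S i\<^esub>i'\<in>I. if i = i' then x i else \<zero>\<^bsub>S i\<^esub>)"
        using x lmh_closed[OF u] i
        by (subst fi.finsum[OF I]) (auto intro!: pi.N.M.finsum_cong')
      also have "\<dots> = x i" using x i I by (intro pi.N.M.finsum_singleton) auto
      finally show "x i = \<zero>\<^bsub>S i\<^esub>" using m0 f.zero i by simp
    qed
  qed auto
  then show thesis using that by blast
qed

section \<open>Isomorphism classes and finite length\<close>

lemma iso_class_eqI:
  assumes "left_module R M" "left_module R N" "left_module_iso R M N"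
  shows "iso_class R M = iso_class R N"
  unfolding iso_class_def
  using assms(3) left_module_iso_sym[OF assms]
  by (auto intro: left_module_iso_trans)

text \<open>\<open>M\<close> has the fixed carrier type and therefore belongs to its own class,
  hence to that of \<open>N\<close>.\<close>

lemma iso_class_eqD:
  fixes M N :: "('a, 'a set) module"
  assumes "left_module R M" "iso_class R M = iso_class R N"
  shows "left_module_iso R M N"
proof -
  have "M \<in> iso_class R M" using assms(1) by (auto simp: iso_class_def intro: left_module_iso_refl)
  then have "M \<in> iso_class R N" by (simp only: assms(2))
  then show ?thesis by (simp add: iso_class_def)
qed

text \<open>Finite length in the form of a strictly monotone measure of submodules by natural
  numbers. Minimal submodules and inductions are immediate, and the measure is inherited when fewer
  submodules are considered.\<close>

definition finite_length where
  "finite_length R M \<longleftrightarrow> (\<exists>d :: _ \<Rightarrow> nat. \<forall>N N'. submodule N R M \<longrightarrow> submodule N' R M \<longrightarrow>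
     N \<subset> N' \<longrightarrow> d N < d N')"

text \<open>A nonzero submodule of least measure has no smaller nonzero submodule.\<close>

lemma simple_submodule_exists:
  assumes M: "left_module R M" and fl: "finite_length R M" and ne: "carrier M \<noteq> {\<zero>\<^bsub>M\<^esub>}"
  obtains N where "submodule N R M" "simple_left_module R (M\<lparr>carrier := N\<rparr>)"
proof -
  interpret M: left_module R M by (rule M)
  obtain d :: "_ \<Rightarrow> nat" where d: "\<And>N N'. \<lbrakk>submodule N R M; submodule N' R M; N \<subset> N'\<rbrakk> \<Longrightarrow> d N < d N'"
    using fl by (auto simp: finite_length_def)
  obtain N where N: "submodule N R M \<and> N \<noteq> {\<zero>\<^bsub>M\<^esub>}"
    and min: "\<And>P. submodule P R M \<and> P \<noteq> {\<zero>\<^bsub>M\<^esub>} \<Longrightarrow> d N \<le> d P"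
    using ex_has_least_nat[of "\<lambda>N. submodule N R M \<and> N \<noteq> {\<zero>\<^bsub>M\<^esub>}" "carrier M" d] M.submodule_carrier ne
    by blast
  have "simple_left_module R (M\<lparr>carrier := N\<rparr>)"
    unfolding simple_left_module_def
  proof (intro conjI allI impI)
    show "left_module R (M\<lparr>carrier := N\<rparr>)" using N M.submodule_left_module by blast
    fix P assume P: "submodule P R (M\<lparr>carrier := N\<rparr>)"
    have PM: "submodule P R M" using submodule_of_submodule[OF M _ P] N by blast
    have "P \<subseteq> N" using submodule.axioms(1)[OF P, THEN subgroup.subset] by simp
    then show "P = {\<zero>\<^bsub>M\<lparr>carrier := N\<rparr>\<^esub>} \<or> P = carrier (M\<lparr>carrier := N\<rparr>)"
      using min[of P] PM N d[of P N] by force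
  qed (use N in auto)
  then show thesis using that N by blast
qed

text \<open>Induction on the measure of a submodule \<open>N\<close>. Fix one simple quotient of
  \<open>N\<close> and its kernel \<open>N0\<close>: any other simple quotient either is nonzero on
  \<open>N0\<close>, and is counted there, or factors through the chosen one and is isomorphic to
  it. Each stage thus adds at most one class.\<close>

lemma finite_simple_quotient_classes:
  assumes M: "left_module R M" and fl: "finite_length R M"
  shows "finite {iso_class R W | W :: ('a, 'a set) module. simple_left_module R W \<and> nonzero_hom R M W}"
proof -
  interpret M: left_module R M by (rule M)
  obtain d :: "_ \<Rightarrow> nat" where d: "\<And>N N'. \<lbrakk>submodule N R M; submodule N' R M; N \<subset> N'\<rbrakk> \<Longrightarrow> d N < d N'"
    using fl by (auto simp: finite_length_def)
  let ?Q = "\<lambda>N. {iso_class R W | W :: ('a, 'a set) module. simple_left_module R W \<and> nonzero_hom R (M\<lparr>carrier := N\<rparr>) W}"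
  have "finite (?Q N)" if "submodule N R M" for N
    using that
  proof (induction "d N" arbitrary: N rule: less_induct)
    case less
    note N = M.submodule_left_module[OF less.prems]
    interpret N: left_module R "M\<lparr>carrier := N\<rparr>" by (rule N)
    show ?case
    proof (cases "?Q N = {}")
      case False
      then obtain W0 :: "('a, 'a set) module" where W0: "simple_left_module R W0" "nonzero_hom R (M\<lparr>carrier := N\<rparr>) W0"
        by auto
      then obtain f0 x0 where f0: "f0 \<in> left_module_hom R (M\<lparr>carrier := N\<rparr>) W0"
        and x0: "x0 \<in> N" "f0 x0 \<noteq> \<zero>\<^bsub>W0\<^esub>" by (auto simp: nonzero_hom_def)
      interpret f0: module_hom_pair R "M\<lparr>carrier := N\<rparr>" W0 f0
        by (intro module_hom_pairI N simple_left_moduleD(1)[OF W0(1)] f0)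
      define N0 where "N0 = {x \<in> N. f0 x = \<zero>\<^bsub>W0\<^esub>}"
      have N0: "submodule N0 R M"
        using submodule_of_submodule[OF M less.prems f0.vimage_submodule[OF f0.N.submodule_zero]]
        by (simp add: N0_def)
      have "N0 \<subset> N" using x0 by (auto simp: N0_def)
      then have fin: "finite (?Q N0)" using less.hyps d N0 less.prems by blast
      have "?Q N \<subseteq> insert (iso_class R W0) (?Q N0)"
      proof
        fix C assume "C \<in> ?Q N"
        then obtain W :: "('a, 'a set) module" and f x where W: "C = iso_class R W" "simple_left_module R W"
          and f: "f \<in> left_module_hom R (M\<lparr>carrier := N\<rparr>) W" and x: "x \<in> N" "f x \<noteq> \<zero>\<^bsub>W\<^esub>"
          by (auto simp: nonzero_hom_def)
        interpret f: module_hom_pair R "M\<lparr>carrier := N\<rparr>" W f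
          by (intro module_hom_pairI N simple_left_moduleD(1)[OF W(2)] f)
        show "C \<in> insert (iso_class R W0) (?Q N0)"
        proof (cases "\<exists>y\<in>N0. f y \<noteq> \<zero>\<^bsub>W\<^esub>")
          case True
          have "f \<in> left_module_hom R (M\<lparr>carrier := N0\<rparr>) W"
            using f.add f.smult f.closed by (intro left_module_homI) (auto simp: N0_def)
          then have "nonzero_hom R (M\<lparr>carrier := N0\<rparr>) W"
            using True by (auto simp: nonzero_hom_def)
          then show ?thesis using W by auto
        next
          case False
          have im: "f0 ` N = carrier W0"
            using simple_target_surj[OF N W0(1) f0] x0 by simp
          \<comment> \<open>The map induced on the quotient of \<open>N\<close> by
            \<open>N0\<close>, identified with \<open>W0\<close>; the choice of preimages is
            immaterial because \<open>f\<close> vanishes on \<open>N0\<close>.\<close>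
          define g where "g = (\<lambda>w. f (inv_into N f0 w))"
          have r: "inv_into N f0 w \<in> N" "f0 (inv_into N f0 w) = w" if "w \<in> carrier W0" for w
            using that im by (auto simp: inv_into_into f_inv_into_f)
          have geq: "g (f0 y) = f y" if y: "y \<in> N" for y
          proof -
            let ?z = "inv_into N f0 (f0 y)"
            have z: "?z \<in> N" "f0 ?z = f0 y" using r f0.closed[of y] y by auto
            have zy: "?z \<ominus>\<^bsub>M\<lparr>carrier := N\<rparr>\<^esub> y \<in> N" using N.M.minus_closed[of ?z y] z y by simp
            have "f0 (?z \<ominus>\<^bsub>M\<lparr>carrier := N\<rparr>\<^esub> y) = \<zero>\<^bsub>W0\<^esub>"
              using f0.diff[of ?z y] z y f0.closed[of y] by (simp add: f0.N.M.minus_eq f0.N.M.r_neg)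
            then have "f ?z \<ominus>\<^bsub>W\<^esub> f y = \<zero>\<^bsub>W\<^esub>"
              using False zy f.diff[of ?z y] z y by (auto simp: N0_def)
            then show ?thesis
              unfolding g_def using f.closed[of ?z] f.closed[of y] z y f.N.M.minus_eq_zeroD[of "f ?z" "f y"] by simp
          qed
          have "g \<in> left_module_hom R W0 W"
          proof (rule left_module_homI)
            fix w assume w: "w \<in> carrier W0"
            show "g w \<in> carrier W" using f.closed r[OF w] by (simp add: g_def)
            fix w' assume w': "w' \<in> carrier W0"
            from w obtain y where y1: "y \<in> N" "w = f0 y" unfolding im[symmetric] by blast
            from w' obtain y' where y2: "y' \<in> N" "w' = f0 y'" unfolding im[symmetric] by blast
            note y = y1 y2
            then have "w \<oplus>\<^bsub>W0\<^esub> w' = f0 (y \<oplus>\<^bsub>M\<^esub> y')" using f0.add[of y y'] by simp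
            then show "g (w \<oplus>\<^bsub>W0\<^esub> w') = g w \<oplus>\<^bsub>W\<^esub> g w'"
              using y geq f.add[of y y'] N.M.a_closed[of y y'] by simp
          next
            fix a w assume a: "a \<in> carrier R" and w: "w \<in> carrier W0"
            from w obtain y where y: "y \<in> N" "w = f0 y" unfolding im[symmetric] by blast
            then have "a \<odot>\<^bsub>W0\<^esub> w = f0 (a \<odot>\<^bsub>M\<^esub> y)" using f0.smult[of a y] a by simp
            then show "g (a \<odot>\<^bsub>W0\<^esub> w) = a \<odot>\<^bsub>W\<^esub> g w"
              using y geq f.smult[of a y] N.smult_closed[of a y] a by simp
          qed
          moreover have "g (f0 x) \<noteq> \<zero>\<^bsub>W\<^esub>" "f0 x \<in> carrier W0" using geq x f0.closed[of x] by auto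
          ultimately have "nonzero_hom R W0 W" by (intro nonzero_homI)
          then have "iso_class R W0 = iso_class R W"
            using schur_iso[OF W0(1) W(2)] W0 W by (intro iso_class_eqI) (auto simp: simple_left_moduleD)
          then show ?thesis using W by simp
        qed
      qed
      then show ?thesis using fin finite_subset by blast
    next
      case True
      show ?thesis unfolding True by simp
    qed
  qed
  from this[OF M.submodule_carrier] show ?thesis by simp
qed

definition regular_module :: "('a, 'r) ring_scheme \<Rightarrow> ('a, 'a) module" where
  "regular_module R = \<lparr>carrier = carrier R, monoid.mult = monoid.mult R, one = one R,
     ring.zero = ring.zero R, ring.add = ring.add R, module.smult = monoid.mult R\<rparr>"

lemma regular_module_simps [simp]:
  "carrier (regular_module R) = carrier R"
  "\<zero>\<^bsub>regular_module R\<^esub> = \<zero>\<^bsub>R\<^esub>"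
  "x \<oplus>\<^bsub>regular_module R\<^esub> y = x \<oplus>\<^bsub>R\<^esub> y"
  "a \<odot>\<^bsub>regular_module R\<^esub> x = a \<otimes>\<^bsub>R\<^esub> x"
  by (simp_all add: regular_module_def)

lemma (in ring) regular_module_left_module: "left_module R (regular_module R)"
proof -
  have "abelian_group (regular_module R)"
    by (rule abelian_groupI) (auto simp: a_ac intro!: bexI[of _ "\<ominus> _"] l_neg)
  then show ?thesis
    by (intro left_module.intro left_module_axioms.intro ring_axioms)
      (auto simp: l_distr r_distr m_assoc)
qed

lemma (in left_module) regular_module_hom:
  "v \<in> carrier M \<Longrightarrow> (\<lambda>a. a \<odot>\<^bsub>M\<^esub> v) \<in> left_module_hom R (regular_module R) M"
  by (rule left_module_homI) (auto simp: smult_l_distr smult_assoc1)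

text \<open>Evaluation at a nonzero vector makes each simple module a quotient of the regular
  module.\<close>

lemma finite_sim:
  assumes R: "ring R" and fl: "finite_length R (regular_module R)"
  shows "finite (sim R)"
proof -
  have "nonzero_hom R (regular_module R) W" if W: "simple_left_module R W" for W :: "('a, 'a set) module"
  proof -
    interpret W: left_module R W using W by (rule simple_left_moduleD)
    obtain v where "v \<in> carrier W" "v \<noteq> \<zero>\<^bsub>W\<^esub>" using simple_left_moduleD(2)[OF W] by auto
    then show ?thesis by (intro nonzero_homI[OF W.regular_module_hom, of v "\<one>\<^bsub>R\<^esub>"]) auto
  qed
  then have "sim R \<subseteq> {iso_class R W | W :: ('a, 'a set) module. simple_left_module R W \<and> nonzero_hom R (regular_module R) W}"
    unfolding sim_def by blast
  then show ?thesis
    using finite_simple_quotient_classes[OF ring.regular_module_left_module[OF R] fl] finite_subset by blast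
qed

text \<open>A line over a field is simple, which lets the exchange argument for simple modules serve
  as linear algebra.\<close>

lemma (in field) regular_module_simple: "simple_left_module R (regular_module R)"
  unfolding simple_left_module_def
proof (intro conjI allI impI)
  interpret left_module R "regular_module R" by (rule regular_module_left_module)
  fix N assume N: "submodule N R (regular_module R)"
  interpret N: submodule N R "regular_module R" by (rule N)
  show "N = {\<zero>\<^bsub>regular_module R\<^esub>} \<or> N = carrier (regular_module R)"
  proof (cases "N = {\<zero>}")
    case False
    then obtain x where x: "x \<in> N" "x \<noteq> \<zero>" using N.one_closed by auto
    have sub: "N \<subseteq> carrier R" using N.subset by simp
    have xu: "inv x \<in> carrier R" "inv x \<otimes> x = \<one>"
      using x sub field_Units by (auto intro: Units_inv_closed Units_l_inv)
    have "a \<in> N" if a: "a \<in> carrier R" for a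
    proof -
      have "(a \<otimes> inv x) \<otimes> x = a" using a x xu sub m_assoc[of a "inv x" x] by auto
      then show ?thesis using N.smult_closed[of "a \<otimes> inv x" x] a x xu by simp
    qed
    then show ?thesis using sub by auto
  qed simp
qed (use one_not_zero one_closed in \<open>auto simp: regular_module_left_module simp del: one_closed one_not_zero\<close>)

text \<open>The measure of a subspace is its number of pivots with respect to the flag spanned by the initial
  segments of \<open>m\<close>.\<close>

lemma finite_length_field:
  assumes R: "field R" and M: "left_module R M" and m: "\<And>i. i < n \<Longrightarrow> m i \<in> carrier M"
    and span: "\<And>x. x \<in> carrier M \<Longrightarrow> \<exists>c. (\<forall>i<n. c i \<in> carrier R) \<and> x = (\<Oplus>\<^bsub>M\<^esub>i\<in>{..<n::nat}. c i \<odot>\<^bsub>M\<^esub> m i)"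
  shows "finite_length R M"
proof -
  interpret M: left_module R M by (rule M)
  interpret R: field R by (rule R)
  let ?u = "\<lambda>i c. c \<odot>\<^bsub>M\<^esub> m i"
  \<comment> \<open>The flag of spans of initial segments of \<open>m\<close>, from zero at
    \<open>F 0\<close> up to the whole module at \<open>F n\<close>.\<close>
  define F where "F = (\<lambda>k. sum_image M {..<k} (\<lambda>_. regular_module R) ?u)"
  have fam: "hom_family R M {..<k} (\<lambda>_. regular_module R) ?u" if "k \<le> n" for k
    using that m by (intro hom_familyI M M.R.regular_module_left_module M.regular_module_hom) auto
  have Fsub: "submodule (F k) R M" if "k \<le> n" for k
    unfolding F_def by (rule hom_family.sum_image_submodule[OF fam[OF that]])
  have F0: "F 0 = {\<zero>\<^bsub>M\<^esub>}" by (simp add: F_def sum_image_def)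
  have Fn: "carrier M \<subseteq> F n"
  proof
    fix x assume "x \<in> carrier M"
    with span obtain c where c: "\<forall>i<n. c i \<in> carrier R" "x = (\<Oplus>\<^bsub>M\<^esub>i\<in>{..<n}. c i \<odot>\<^bsub>M\<^esub> m i)" by blast
    then show "x \<in> F n" by (auto simp: F_def sum_image_def intro!: exI[of _ c])
  qed
  have FSuc: "F (Suc k) = {c \<odot>\<^bsub>M\<^esub> m k \<oplus>\<^bsub>M\<^esub> y | c y. c \<in> carrier R \<and> y \<in> F k}" if "k < n" for k
  proof -
    have "hom_family R M (insert k {..<k}) (\<lambda>_. regular_module R) ?u"
      using fam[of "Suc k"] that by (simp add: lessThan_Suc)
    from sum_image_insert[OF this] show ?thesis by (simp add: F_def lessThan_Suc)
  qed
  \<comment> \<open>Pivots of \<open>N\<close>: the levels at which the intersection of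
    \<open>N\<close> with the flag jumps.\<close>
  define P where "P = (\<lambda>N. {k. k < n \<and> (\<exists>y\<in>N. y \<in> F (Suc k) \<and> y \<notin> F k)})"
  have fin: "finite (P N)" for N by (rule finite_subset[of _ "{..<n}"]) (auto simp: P_def)
  have "card (P N) < card (P N')" if N: "submodule N R M" and N': "submodule N' R M" and less: "N \<subset> N'" for N N'
  proof -
    interpret N: submodule N R M by (rule N)
    interpret N': submodule N' R M by (rule N')
    have "P N \<subseteq> P N'" using less by (auto simp: P_def)
    moreover have "P N \<noteq> P N'"
    proof
      assume eq: "P N = P N'"
      \<comment> \<open>With equal pivots, an element of \<open>N'\<close> at level
        \<open>Suc k\<close> can be reduced to level \<open>k\<close> by a vector of
        \<open>N\<close>, and so on down to zero; then \<open>N'\<close> would lie in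
        \<open>N\<close>.\<close>
      have "x \<in> N" if "k \<le> n" "x \<in> N'" "x \<in> F k" for k x
        using that
      proof (induction k arbitrary: x)
        case 0
        then show ?case using F0 N.one_closed by auto
      next
        case (Suc k)
        have k: "k < n" "k \<le> n" using Suc.prems by auto
        interpret Fk: submodule "F k" R M by (rule Fsub[OF k(2)])
        have xM: "x \<in> carrier M" using Suc.prems N'.subset by auto
        show ?case
        proof (cases "x \<in> F k")
          case False
          then have "k \<in> P N" using eq Suc.prems k by (auto simp: P_def)
          then obtain y where y: "y \<in> N" "y \<in> F (Suc k)" "y \<notin> F k" by (auto simp: P_def)
          have yM: "y \<in> carrier M" using y N.subset by auto
          obtain c a where ca: "c \<in> carrier R" "a \<in> F k" "x = c \<odot>\<^bsub>M\<^esub> m k \<oplus>\<^bsub>M\<^esub> a"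
            using Suc.prems FSuc[OF k(1)] by auto
          obtain e b where eb: "e \<in> carrier R" "b \<in> F k" "y = e \<odot>\<^bsub>M\<^esub> m k \<oplus>\<^bsub>M\<^esub> b"
            using y FSuc[OF k(1)] by auto
          have mk: "m k \<in> carrier M" and aM: "a \<in> carrier M" and bM: "b \<in> carrier M"
            using m k ca eb Fk.subset by auto
          have "e \<noteq> \<zero>\<^bsub>R\<^esub>" using eb y mk bM by auto
          then have ie: "inv\<^bsub>R\<^esub> e \<in> carrier R" "inv\<^bsub>R\<^esub> e \<otimes>\<^bsub>R\<^esub> e = \<one>\<^bsub>R\<^esub>"
            using eb R.field_Units by (auto intro: M.R.Units_inv_closed M.R.Units_l_inv)
          \<comment> \<open>The multiple of the pivot vector \<open>y\<close> that cancels the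
            coefficient of \<open>m k\<close> in \<open>x\<close>.\<close>
          define r where "r = \<ominus>\<^bsub>R\<^esub> (c \<otimes>\<^bsub>R\<^esub> inv\<^bsub>R\<^esub> e)"
          have r: "r \<in> carrier R" using ca ie by (simp add: r_def)
          have re: "r \<otimes>\<^bsub>R\<^esub> e = \<ominus>\<^bsub>R\<^esub> c" using ca ie eb by (simp add: r_def M.R.l_minus M.R.m_assoc)
          have "r \<odot>\<^bsub>M\<^esub> y = (\<ominus>\<^bsub>R\<^esub> c) \<odot>\<^bsub>M\<^esub> m k \<oplus>\<^bsub>M\<^esub> r \<odot>\<^bsub>M\<^esub> b"
            using r eb mk bM by (simp add: M.smult_r_distr re flip: M.smult_assoc1)
          then have "x \<oplus>\<^bsub>M\<^esub> r \<odot>\<^bsub>M\<^esub> y = a \<oplus>\<^bsub>M\<^esub> r \<odot>\<^bsub>M\<^esub> b"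
            using ca r mk aM bM
            by (simp add: M.smult_l_minus M.M.a_ac M.M.r_neg2 M.M.r_neg1 M.M.r_neg)
          then have in_F: "x \<oplus>\<^bsub>M\<^esub> r \<odot>\<^bsub>M\<^esub> y \<in> F k"
            using Fk.m_closed[OF ca(2) Fk.smult_closed[OF r eb(2)]] by simp
          have ry: "r \<odot>\<^bsub>M\<^esub> y \<in> N" using N.smult_closed[OF r y(1)] .
          then have "x \<oplus>\<^bsub>M\<^esub> r \<odot>\<^bsub>M\<^esub> y \<in> N'" using N'.m_closed Suc.prems less by auto
          then have "x \<oplus>\<^bsub>M\<^esub> r \<odot>\<^bsub>M\<^esub> y \<in> N" using Suc.IH[OF k(2)] in_F by blast
          then have "(x \<oplus>\<^bsub>M\<^esub> r \<odot>\<^bsub>M\<^esub> y) \<oplus>\<^bsub>M\<^esub> (\<ominus>\<^bsub>M\<^esub> (r \<odot>\<^bsub>M\<^esub> y)) \<in> N"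
            using N.m_closed N.m_inv_closed[OF ry] by (simp add: a_inv_def)
          then show ?thesis using xM yM r by (simp add: M.M.a_assoc M.M.r_neg)
        qed (use Suc k in auto)
      qed
      then have "N' \<subseteq> N" using Fn N'.subset by auto
      then show False using less by blast
    qed
    ultimately show ?thesis by (intro psubset_card_mono fin) blast
  qed
  then show ?thesis unfolding finite_length_def by (intro exI[of _ "\<lambda>N. card (P N)"]) blast
qed

section \<open>Tensor products\<close>

lemma left_module_hom_eq_minusI:
  assumes M: "abelian_group M" and f: "f \<in> hom (add_monoid M) (add_monoid N)" and N: "abelian_group N"
    and x: "x \<in> carrier M"
  shows "f (\<ominus>\<^bsub>M\<^esub> x) = \<ominus>\<^bsub>N\<^esub> f x"
proof -
  interpret group_hom "add_monoid M" "add_monoid N" f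
    using f abelian_group.a_group[OF M] abelian_group.a_group[OF N]
    by (simp add: group_hom_def group_hom_axioms_def)
  show ?thesis using hom_inv[of x] x by (simp add: a_inv_def)
qed

text \<open>A homomorphism that is trivial on \<open>r\<close> has the generated subgroup in its
  kernel.\<close>

lemma factor_generate:
  assumes F: "comm_group F" and r: "r \<subseteq> carrier F" and Y: "Group.group Y" and h: "h \<in> hom F Y"
    and one: "\<And>z. z \<in> r \<Longrightarrow> h z = \<one>\<^bsub>Y\<^esub>"
  obtains g where "g \<in> hom (F Mod generate F r) Y"
    "\<And>x. x \<in> carrier F \<Longrightarrow> g (generate F r #>\<^bsub>F\<^esub> x) = h x"
proof -
  interpret F: comm_group F by (rule F)
  interpret Y: Group.group Y by (rule Y)
  interpret group_hom F Y h
    using h by (simp add: group_hom_def group_hom_axioms_def F.is_group Y.is_group)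
  have "r \<subseteq> kernel F Y h"
    using one r by (auto simp: kernel_def)
  then have "generate F r \<subseteq> kernel F Y h"
    by (rule F.generate_subgroup_incl[OF _ subgroup_kernel])
  from FactGroup_universal_kernel[OF F.subgroup_imp_normal[OF F.generate_is_subgroup[OF r]] this]
  show thesis using that by blast
qed

locale tensor_product = A: ring A + W: left_module B W
  for A :: "('a, 'r) ring_scheme" and B :: "('a, 's) ring_scheme" and W :: "('a, 'w, 'x) module_scheme" +
  assumes B_subset: "carrier B \<subseteq> carrier A"
begin

declare mult_FactGroup [simp del] one_FactGroup [simp del]

abbreviation "free \<equiv> tensor_free A W"
abbreviation "null \<equiv> tensor_null A B W"
abbreviation "ind \<equiv> induced_module A B W"
abbreviation "pure \<equiv> pure_tensor A B W"

sublocale T: comm_group free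
  by (simp add: tensor_free_def abelian_free_Abelian_group)

lemma rel_subset: "tensor_relations A B W \<subseteq> carrier free"
  using B_subset unfolding tensor_relations_def tensor_free_def
  by (auto simp: subset_iff dest!: subsetD[OF keys_diff] subsetD[OF keys_add] split: if_splits)

sublocale N: subgroup null free
  unfolding tensor_null_def by (rule T.generate_is_subgroup[OF rel_subset])

sublocale N: normal null free
  by (rule T.subgroup_imp_normal[OF N.subgroup_axioms])

sublocale Q: comm_group "free Mod null"
  by (rule T.abelian_FactGroup[OF N.subgroup_axioms])

lemma ind_simps [simp]:
  "carrier ind = carrier (free Mod null)"
  "\<zero>\<^bsub>ind\<^esub> = \<one>\<^bsub>free Mod null\<^esub>"
  "x \<oplus>\<^bsub>ind\<^esub> y = x \<otimes>\<^bsub>free Mod null\<^esub> y"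
  by (simp_all add: induced_module_def Let_def)

lemma ind_abelian_group: "abelian_group ind"
proof (rule abelian_groupI)
  fix x assume "x \<in> carrier ind"
  then show "\<exists>y\<in>carrier ind. y \<oplus>\<^bsub>ind\<^esub> x = \<zero>\<^bsub>ind\<^esub>"
    using Q.l_inv_ex by simp
qed (simp_all add: Q.m_assoc, rule Q.m_comm)

lemma rel_null: "r \<in> tensor_relations A B W \<Longrightarrow> r \<in> null"
  unfolding tensor_null_def by (rule generate.incl)

lemma frag_in_free: "\<lbrakk>a \<in> carrier A; w \<in> carrier W\<rbrakk> \<Longrightarrow> frag_of (a, w) \<in> carrier free"
  by (simp add: tensor_free_def)

lemma coset_in: "x \<in> carrier free \<Longrightarrow> null #>\<^bsub>free\<^esub> x \<in> carrier (free Mod null)"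
  by (auto simp: FactGroup_def RCOSETS_def)

lemma pure_closed [simp]: "\<lbrakk>a \<in> carrier A; w \<in> carrier W\<rbrakk> \<Longrightarrow> pure a w \<in> carrier (free Mod null)"
  unfolding pure_tensor_def by (rule coset_in[OF frag_in_free])

lemma coset_diff:
  assumes "x \<in> carrier free" "y \<in> carrier free"
  shows "null #>\<^bsub>free\<^esub> (x - y) = (null #>\<^bsub>free\<^esub> x) \<otimes>\<^bsub>free Mod null\<^esub> inv\<^bsub>free Mod null\<^esub> (null #>\<^bsub>free\<^esub> y)"
proof -
  interpret group_hom free "free Mod null" "\<lambda>x. null #>\<^bsub>free\<^esub> x"
    using N.r_coset_hom_Mod by (simp add: group_hom_def group_hom_axioms_def T.is_group Q.is_group)
  have "x - y = x \<otimes>\<^bsub>free\<^esub> inv\<^bsub>free\<^esub> y" using assms by (simp add: tensor_free_def)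
  then show ?thesis using assms by simp
qed

text \<open>Cosets are reached from the generators by differences, the operation offered by
  induction on free abelian groups; differences also account for negative coefficients.\<close>

lemma tensor_induct [consumes 1, case_names zero diff pure]:
  assumes "p \<in> carrier ind" and "P \<zero>\<^bsub>ind\<^esub>"
    and "\<And>p q. \<lbrakk>p \<in> carrier ind; q \<in> carrier ind; P p; P q\<rbrakk> \<Longrightarrow> P (p \<ominus>\<^bsub>ind\<^esub> q)"
    and "\<And>a w. \<lbrakk>a \<in> carrier A; w \<in> carrier W\<rbrakk> \<Longrightarrow> P (pure a w)"
  shows "P p"
proof -
  interpret I: abelian_group ind by (rule ind_abelian_group)
  obtain x where x: "x \<in> carrier free" "p = null #>\<^bsub>free\<^esub> x"
    using assms(1) by (auto simp: FactGroup_def RCOSETS_def)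
  have "Poly_Mapping.keys x \<subseteq> carrier A \<times> carrier W" using x by (simp add: tensor_free_def)
  then have "P (null #>\<^bsub>free\<^esub> x)"
  proof (induction x rule: free_Abelian_group_induct[consumes 1])
    case 1
    have "null #>\<^bsub>free\<^esub> 0 = \<zero>\<^bsub>ind\<^esub>"
      using T.coset_mult_one[OF N.subset] by (simp add: tensor_free_def FactGroup_def)
    then show ?case using assms(2) by simp
  next
    case (2 x y)
    then have c: "x \<in> carrier free" "y \<in> carrier free" by (auto simp: tensor_free_def)
    note c' = coset_in[OF c(1)] coset_in[OF c(2)]
    have "\<ominus>\<^bsub>ind\<^esub> (null #>\<^bsub>free\<^esub> y) = inv\<^bsub>free Mod null\<^esub> (null #>\<^bsub>free\<^esub> y)"
      using c' by (intro I.minus_equality) (simp_all add: Q.l_inv)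
    then have "null #>\<^bsub>free\<^esub> (x - y) = (null #>\<^bsub>free\<^esub> x) \<ominus>\<^bsub>ind\<^esub> (null #>\<^bsub>free\<^esub> y)"
      using c c' by (simp add: coset_diff I.minus_eq)
    then show ?case using assms(3) 2 c' by simp
  next
    case (3 z)
    then show ?case using assms(4)[of "fst z" "snd z"] by (simp add: pure_tensor_def mem_Times_iff)
  qed
  then show ?thesis using x by simp
qed

lemma coset_eqI:
  assumes "x \<in> carrier free" "y \<in> carrier free" "x - y \<in> tensor_relations A B W"
  shows "null #>\<^bsub>free\<^esub> x = null #>\<^bsub>free\<^esub> y"
proof -
  have "x = (x - y) \<otimes>\<^bsub>free\<^esub> y" by (simp add: tensor_free_def)
  then have "x \<in> null #>\<^bsub>free\<^esub> y" using rel_null[OF assms(3)] unfolding r_coset_def by blast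
  then show ?thesis using T.repr_independence[OF _ assms(2) N.subgroup_axioms] by simp
qed

lemma coset_sum:
  assumes "x \<in> carrier free" "y \<in> carrier free"
  shows "(null #>\<^bsub>free\<^esub> x) \<oplus>\<^bsub>ind\<^esub> (null #>\<^bsub>free\<^esub> y) = null #>\<^bsub>free\<^esub> (x + y)" "x + y \<in> carrier free"
  using N.rcos_sum[OF assms] T.m_closed[OF assms] by (simp_all add: mult_FactGroup) (simp_all add: tensor_free_def)

lemma pure_add_left:
  assumes "a \<in> carrier A" "a' \<in> carrier A" "w \<in> carrier W"
  shows "pure (a \<oplus>\<^bsub>A\<^esub> a') w = pure a w \<oplus>\<^bsub>ind\<^esub> pure a' w"
proof -
  note c = frag_in_free[OF assms(1,3)] frag_in_free[OF assms(2,3)]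
    frag_in_free[OF A.a_closed[OF assms(1,2)] assms(3)]
  have "frag_of (a \<oplus>\<^bsub>A\<^esub> a', w) - (frag_of (a, w) + frag_of (a', w)) \<in> tensor_relations A B W"
    using assms unfolding tensor_relations_def by blast
  from coset_eqI[OF c(3) coset_sum(2)[OF c(1,2)] this] show ?thesis
    unfolding pure_tensor_def coset_sum(1)[OF c(1,2)] .
qed

lemma pure_add_right:
  assumes "a \<in> carrier A" "w \<in> carrier W" "w' \<in> carrier W"
  shows "pure a (w \<oplus>\<^bsub>W\<^esub> w') = pure a w \<oplus>\<^bsub>ind\<^esub> pure a w'"
proof -
  note c = frag_in_free[OF assms(1,2)] frag_in_free[OF assms(1,3)]
    frag_in_free[OF assms(1) W.M.a_closed[OF assms(2,3)]]
  have "frag_of (a, w \<oplus>\<^bsub>W\<^esub> w') - (frag_of (a, w) + frag_of (a, w')) \<in> tensor_relations A B W"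
    using assms unfolding tensor_relations_def by blast
  from coset_eqI[OF c(3) coset_sum(2)[OF c(1,2)] this] show ?thesis
    unfolding pure_tensor_def coset_sum(1)[OF c(1,2)] .
qed

lemma pure_balanced:
  assumes "a \<in> carrier A" "b \<in> carrier B" "w \<in> carrier W"
  shows "pure (a \<otimes>\<^bsub>A\<^esub> b) w = pure a (b \<odot>\<^bsub>W\<^esub> w)"
proof -
  have b: "b \<in> carrier A" using B_subset assms by auto
  have "frag_of (a \<otimes>\<^bsub>A\<^esub> b, w) - frag_of (a, b \<odot>\<^bsub>W\<^esub> w) \<in> tensor_relations A B W"
    using assms unfolding tensor_relations_def by blast
  then show ?thesis
    unfolding pure_tensor_def
    by (rule coset_eqI[rotated 2]) (use assms b in \<open>simp_all add: frag_in_free\<close>)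
qed

text \<open>Extend \<beta> to the free abelian group; additivity in each argument and balancedness
  say exactly that the three kinds of relations are sent to zero.\<close>

lemma tensor_lift:
  assumes Y: "abelian_group Y"
    and cl: "\<And>a w. \<lbrakk>a \<in> carrier A; w \<in> carrier W\<rbrakk> \<Longrightarrow> \<beta> a w \<in> carrier Y"
    and l: "\<And>a a' w. \<lbrakk>a \<in> carrier A; a' \<in> carrier A; w \<in> carrier W\<rbrakk> \<Longrightarrow> \<beta> (a \<oplus>\<^bsub>A\<^esub> a') w = \<beta> a w \<oplus>\<^bsub>Y\<^esub> \<beta> a' w"
    and r: "\<And>a w w'. \<lbrakk>a \<in> carrier A; w \<in> carrier W; w' \<in> carrier W\<rbrakk> \<Longrightarrow> \<beta> a (w \<oplus>\<^bsub>W\<^esub> w') = \<beta> a w \<oplus>\<^bsub>Y\<^esub> \<beta> a w'"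
    and b: "\<And>a b w. \<lbrakk>a \<in> carrier A; b \<in> carrier B; w \<in> carrier W\<rbrakk> \<Longrightarrow> \<beta> (a \<otimes>\<^bsub>A\<^esub> b) w = \<beta> a (b \<odot>\<^bsub>W\<^esub> w)"
  obtains \<Phi> where "\<Phi> \<in> hom (add_monoid ind) (add_monoid Y)"
    "\<And>a w. \<lbrakk>a \<in> carrier A; w \<in> carrier W\<rbrakk> \<Longrightarrow> \<Phi> (pure a w) = \<beta> a w"
proof -
  interpret Y: abelian_group Y by (rule Y)
  obtain h where h: "h \<in> hom free (add_monoid Y)"
    and hf: "\<And>z. z \<in> carrier A \<times> carrier W \<Longrightarrow> h (frag_of z) = (\<lambda>(a, w). \<beta> a w) z"
  proof (rule comm_group.free_Abelian_group_universal[OF Y.a_comm_group])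
    show "(\<lambda>(a, w). \<beta> a w) ` (carrier A \<times> carrier W) \<subseteq> carrier (add_monoid Y)" using cl by auto
  qed (simp add: that tensor_free_def)
  interpret h: group_hom free "add_monoid Y" h
    using h by (simp add: group_hom_def group_hom_axioms_def T.is_group Y.a_group)
  have hfr: "h (frag_of (a, w)) = \<beta> a w" if "a \<in> carrier A" "w \<in> carrier W" for a w
    using hf[of "(a, w)"] that by simp
  have hadd: "h (x + y) = h x \<oplus>\<^bsub>Y\<^esub> h y" and cadd: "x + y \<in> carrier free"
    if "x \<in> carrier free" "y \<in> carrier free" for x y
    using h.hom_mult[OF that] T.m_closed[OF that] by (simp_all add: tensor_free_def)
  have hdiff: "h (x - y) = \<zero>\<^bsub>Y\<^esub>" if "x \<in> carrier free" "y \<in> carrier free" "h x = h y" for x y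
  proof -
    have c: "x - y \<in> carrier free"
      using T.m_closed[OF that(1) T.inv_closed[OF that(2)]] that(2) by (simp add: tensor_free_def)
    have "h (x - y) \<oplus>\<^bsub>Y\<^esub> h y = h x" using hadd[OF c that(2)] by simp
    moreover have "h (x - y) \<in> carrier Y" "h y \<in> carrier Y" using h.hom_closed[OF c] h.hom_closed[OF that(2)] by simp_all
    ultimately show ?thesis using that(3) Y.add.l_cancel_one[of "h y" "h (x - y)"] by simp
  qed
  have "h z = \<one>\<^bsub>add_monoid Y\<^esub>" if "z \<in> tensor_relations A B W" for z
    using that unfolding tensor_relations_def
  proof (elim UnE CollectE exE conjE)
    fix a a' w assume z: "z = frag_of (a \<oplus>\<^bsub>A\<^esub> a', w) - (frag_of (a, w) + frag_of (a', w))"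
      and "a \<in> carrier A" "a' \<in> carrier A" "w \<in> carrier W"
    then show ?thesis by (simp, intro hdiff cadd frag_in_free) (simp_all add: hadd frag_in_free hfr l)
  next
    fix a w w' assume "z = frag_of (a, w \<oplus>\<^bsub>W\<^esub> w') - (frag_of (a, w) + frag_of (a, w'))"
      and "a \<in> carrier A" "w \<in> carrier W" "w' \<in> carrier W"
    then show ?thesis by (simp, intro hdiff cadd frag_in_free) (simp_all add: hadd frag_in_free hfr r)
  next
    fix a b' w assume "z = frag_of (a \<otimes>\<^bsub>A\<^esub> b', w) - frag_of (a, b' \<odot>\<^bsub>W\<^esub> w)"
      and "a \<in> carrier A" "b' \<in> carrier B" "w \<in> carrier W"
    then show ?thesis using B_subset
      by (simp, intro hdiff cadd frag_in_free) (auto simp: hadd frag_in_free hfr b)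
  qed
  then obtain g where g: "g \<in> hom (free Mod null) (add_monoid Y)"
    "\<And>x. x \<in> carrier free \<Longrightarrow> g (null #>\<^bsub>free\<^esub> x) = h x"
    using factor_generate[OF T.comm_group_axioms rel_subset Y.a_group h] unfolding tensor_null_def by blast
  then show thesis
    using hfr by (intro that[of g]) (auto simp: hom_def pure_tensor_def frag_in_free)
qed

lemma tensor_hom_eq:
  assumes Y: "abelian_group Y" and f: "f \<in> hom (add_monoid ind) (add_monoid Y)"
    and g: "g \<in> hom (add_monoid ind) (add_monoid Y)"
    and eq: "\<And>a w. \<lbrakk>a \<in> carrier A; w \<in> carrier W\<rbrakk> \<Longrightarrow> f (pure a w) = g (pure a w)"
    and p: "p \<in> carrier ind"
  shows "f p = g p"
  using p
proof (induction p rule: tensor_induct)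
  interpret I: abelian_group ind by (rule ind_abelian_group)
  interpret Y: abelian_group Y by (rule Y)
  interpret f: group_hom "add_monoid ind" "add_monoid Y" f
    using f by (simp add: group_hom_def group_hom_axioms_def I.a_group Y.a_group del: ind_simps)
  interpret g: group_hom "add_monoid ind" "add_monoid Y" g
    using g by (simp add: group_hom_def group_hom_axioms_def I.a_group Y.a_group del: ind_simps)
  case zero
  show ?case using f.hom_one g.hom_one by simp
next
  interpret I: abelian_group ind by (rule ind_abelian_group)
  case (diff p q)
  have "h (p \<ominus>\<^bsub>ind\<^esub> q) = h p \<ominus>\<^bsub>Y\<^esub> h q" if "h \<in> hom (add_monoid ind) (add_monoid Y)" for h
    using diff that left_module_hom_eq_minusI[OF ind_abelian_group that Y, of q] I.a_inv_closed[of q]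
    by (auto simp: hom_def a_minus_def)
  from this[OF f] this[OF g] show ?case using diff by simp
qed (rule eq)

text \<open>Left multiplication on the first factor carries relations to relations, hence descends
  to an additive map \<open>g\<close> of the quotient. The union in the definition of the action
  runs over cosets that all equal the value of \<open>g\<close>, so the action is this map.\<close>

lemma smult_hom:
  assumes a: "a \<in> carrier A"
  shows "(\<lambda>p. a \<odot>\<^bsub>ind\<^esub> p) \<in> hom (add_monoid ind) (add_monoid ind)"
    and "\<lbrakk>a' \<in> carrier A; w \<in> carrier W\<rbrakk> \<Longrightarrow> a \<odot>\<^bsub>ind\<^esub> pure a' w = pure (a \<otimes>\<^bsub>A\<^esub> a') w"
proof -
  let ?f = "frag_extend (\<lambda>(a', w). frag_of (a \<otimes>\<^bsub>A\<^esub> a', w :: 'w))"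
  have fc: "?f x \<in> carrier free" if "x \<in> carrier free" for x
  proof -
    have "Poly_Mapping.keys x \<subseteq> carrier A \<times> carrier W" using that by (simp add: tensor_free_def)
    then have "Poly_Mapping.keys (?f x) \<subseteq> carrier A \<times> carrier W"
    proof (induction x rule: free_Abelian_group_induct[consumes 1])
      case (2 x y)
      then show ?case using keys_diff[of "?f x" "?f y"] by (auto simp: frag_extend_diff)
    qed (use a in auto)
    then show ?thesis by (simp add: tensor_free_def)
  qed
  have fhom: "?f \<in> hom free free"
    using fc by (auto simp: hom_def frag_extend_add tensor_free_def)
  have rel: "?f z \<in> tensor_relations A B W" if "z \<in> tensor_relations A B W" for z
    using that[unfolded tensor_relations_def]
  proof (elim UnE CollectE exE conjE)
    fix c c' w assume "z = frag_of (c \<oplus>\<^bsub>A\<^esub> c', w) - (frag_of (c, w) + frag_of (c', w))"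
      and "c \<in> carrier A" "c' \<in> carrier A" "w \<in> carrier W"
    then show ?thesis unfolding tensor_relations_def
      using a by (intro UnI1 CollectI exI[of _ "a \<otimes>\<^bsub>A\<^esub> c"] exI[of _ "a \<otimes>\<^bsub>A\<^esub> c'"] exI[of _ w])
        (simp add: frag_extend_diff frag_extend_add A.r_distr)
  next
    fix c w w' assume "z = frag_of (c, w \<oplus>\<^bsub>W\<^esub> w') - (frag_of (c, w) + frag_of (c, w'))"
      and "c \<in> carrier A" "w \<in> carrier W" "w' \<in> carrier W"
    then show ?thesis unfolding tensor_relations_def
      using a by (intro UnI1 UnI2 CollectI exI[of _ "a \<otimes>\<^bsub>A\<^esub> c"] exI[of _ w] exI[of _ w'])
        (simp add: frag_extend_diff frag_extend_add)
  next
    fix c b w assume "z = frag_of (c \<otimes>\<^bsub>A\<^esub> b, w) - frag_of (c, b \<odot>\<^bsub>W\<^esub> w)"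
      and "c \<in> carrier A" "b \<in> carrier B" "w \<in> carrier W"
    then show ?thesis unfolding tensor_relations_def
      using a B_subset by (intro UnI2 CollectI exI[of _ "a \<otimes>\<^bsub>A\<^esub> c"] exI[of _ b] exI[of _ w])
        (auto simp: frag_extend_diff frag_extend_add A.m_assoc)
  qed
  have one: "null #>\<^bsub>free\<^esub> z = \<one>\<^bsub>free Mod null\<^esub>" if "z \<in> null" for z
    using N.rcos_const[OF T.is_group that] by (simp add: FactGroup_def)
  have "(\<lambda>x. null #>\<^bsub>free\<^esub> ?f x) \<in> hom free (free Mod null)"
    using hom_compose[OF fhom N.r_coset_hom_Mod] by (simp add: comp_def)
  then obtain g where g: "g \<in> hom (free Mod null) (free Mod null)"
    and gx: "\<And>x. x \<in> carrier free \<Longrightarrow> g (null #>\<^bsub>free\<^esub> x) = null #>\<^bsub>free\<^esub> ?f x"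
    using factor_generate[OF T.comm_group_axioms rel_subset Q.is_group] one[OF rel_null[OF rel]] unfolding tensor_null_def by blast
  have sg: "a \<odot>\<^bsub>ind\<^esub> p = g p" if p: "p \<in> carrier (free Mod null)" for p
  proof -
    obtain x where x: "x \<in> carrier free" "p = null #>\<^bsub>free\<^esub> x"
      using p by (auto simp: FactGroup_def RCOSETS_def)
    have "null #>\<^bsub>free\<^esub> ?f y = g p" if "y \<in> p" for y
      using that x gx[of y] T.repr_independence[of y null x] T.r_coset_subset_G[OF N.subset x(1)] N.subgroup_axioms
      by auto
    moreover have "x \<in> p" using x T.rcos_self N.subgroup_axioms by simp
    ultimately show ?thesis by (auto simp: induced_module_def Let_def)
  qed
  show "(\<lambda>p. a \<odot>\<^bsub>ind\<^esub> p) \<in> hom (add_monoid ind) (add_monoid ind)"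
    using g by (auto simp: hom_def sg)
  show "a \<odot>\<^bsub>ind\<^esub> pure a' w = pure (a \<otimes>\<^bsub>A\<^esub> a') w" if "a' \<in> carrier A" "w \<in> carrier W"
    using that by (simp add: sg) (simp add: pure_tensor_def gx frag_in_free)
qed

text \<open>Distributivity over ring sums, associativity and the unit law are equalities of additive
  maps in the tensor argument, and are compared on pure tensors.\<close>

lemma ind_left_module: "left_module A ind"
proof -
  interpret I: abelian_group ind by (rule ind_abelian_group)
  have sc: "a \<odot>\<^bsub>ind\<^esub> p \<in> carrier ind" if "a \<in> carrier A" "p \<in> carrier ind" for a p
    using smult_hom(1)[OF that(1)] that(2) by (auto simp: hom_def)
  have sd: "a \<odot>\<^bsub>ind\<^esub> (p \<oplus>\<^bsub>ind\<^esub> q) = a \<odot>\<^bsub>ind\<^esub> p \<oplus>\<^bsub>ind\<^esub> a \<odot>\<^bsub>ind\<^esub> q"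
    if "a \<in> carrier A" "p \<in> carrier ind" "q \<in> carrier ind" for a p q
    using smult_hom(1)[OF that(1)] that(2,3) by (auto simp: hom_def)
  have addhom: "(\<lambda>p. a \<odot>\<^bsub>ind\<^esub> p \<oplus>\<^bsub>ind\<^esub> b \<odot>\<^bsub>ind\<^esub> p) \<in> hom (add_monoid ind) (add_monoid ind)"
    if "a \<in> carrier A" "b \<in> carrier A" for a b
    using sc[OF that(1)] sc[OF that(2)] sd[OF that(1)] sd[OF that(2)] I.a_ac I.a_closed
    by (simp add: hom_def del: ind_simps)
  have comphom: "(\<lambda>p. a \<odot>\<^bsub>ind\<^esub> (b \<odot>\<^bsub>ind\<^esub> p)) \<in> hom (add_monoid ind) (add_monoid ind)"
    if "a \<in> carrier A" "b \<in> carrier A" for a b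
    using hom_compose[OF smult_hom(1)[OF that(2)] smult_hom(1)[OF that(1)]] by (simp add: comp_def)
  have idhom: "(\<lambda>p. p) \<in> hom (add_monoid ind) (add_monoid ind)" by (simp add: hom_def)
  note eqI = tensor_hom_eq[OF ind_abelian_group]
  show ?thesis
  proof (intro left_module.intro left_module_axioms.intro A.ring_axioms ind_abelian_group)
    fix a b p assume ab: "a \<in> carrier A" "b \<in> carrier A" and p: "p \<in> carrier ind"
    show "(a \<oplus>\<^bsub>A\<^esub> b) \<odot>\<^bsub>ind\<^esub> p = a \<odot>\<^bsub>ind\<^esub> p \<oplus>\<^bsub>ind\<^esub> b \<odot>\<^bsub>ind\<^esub> p"
      by (rule eqI[OF smult_hom(1)[OF A.a_closed[OF ab]] addhom[OF ab] _ p])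
        (simp add: smult_hom(2) A.l_distr pure_add_left ab del: ind_simps)
    show "(a \<otimes>\<^bsub>A\<^esub> b) \<odot>\<^bsub>ind\<^esub> p = a \<odot>\<^bsub>ind\<^esub> (b \<odot>\<^bsub>ind\<^esub> p)"
      by (rule eqI[OF smult_hom(1)[OF A.m_closed[OF ab]] comphom[OF ab] _ p])
        (simp add: smult_hom(2) A.m_assoc ab del: ind_simps)
  next
    fix p assume p: "p \<in> carrier ind"
    show "\<one>\<^bsub>A\<^esub> \<odot>\<^bsub>ind\<^esub> p = p"
      by (rule eqI[OF smult_hom(1)[OF A.one_closed] idhom _ p]) (simp add: smult_hom(2) del: ind_simps)
  qed (rule sc sd; assumption)+
qed

text \<open>One half of Frobenius reciprocity: a \<open>B\<close>-linear map into an
  \<open>A\<close>-module extends along induction.\<close>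

lemma tensor_lift_module:
  assumes M: "left_module A M" and f: "f \<in> left_module_hom B W M"
    and mult: "\<And>a b. \<lbrakk>a \<in> carrier B; b \<in> carrier B\<rbrakk> \<Longrightarrow> a \<otimes>\<^bsub>A\<^esub> b = a \<otimes>\<^bsub>B\<^esub> b"
  obtains \<Phi> where "\<Phi> \<in> left_module_hom A ind M"
    "\<And>a w. \<lbrakk>a \<in> carrier A; w \<in> carrier W\<rbrakk> \<Longrightarrow> \<Phi> (pure a w) = a \<odot>\<^bsub>M\<^esub> f w"
proof -
  interpret M: left_module A M by (rule M)
  interpret I: left_module A ind by (rule ind_left_module)
  note fc = lmh_closed[OF f]
  obtain \<Phi> where \<Phi>: "\<Phi> \<in> hom (add_monoid ind) (add_monoid M)"
    and pure: "\<And>a w. \<lbrakk>a \<in> carrier A; w \<in> carrier W\<rbrakk> \<Longrightarrow> \<Phi> (pure a w) = a \<odot>\<^bsub>M\<^esub> f w"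
    using B_subset
    by (rule_tac tensor_lift[OF M.M.abelian_group_axioms, of "\<lambda>a w. a \<odot>\<^bsub>M\<^esub> f w"])
      (auto simp: fc lmh_add[OF f] lmh_smult[OF f] M.smult_l_distr M.smult_r_distr
        M.smult_assoc1[symmetric] subset_iff)
  have "\<Phi> (a \<odot>\<^bsub>ind\<^esub> p) = a \<odot>\<^bsub>M\<^esub> \<Phi> p" if a: "a \<in> carrier A" and p: "p \<in> carrier ind" for a p
  proof -
    have "(\<lambda>p. \<Phi> (a \<odot>\<^bsub>ind\<^esub> p)) \<in> hom (add_monoid ind) (add_monoid M)"
      using hom_compose[OF smult_hom(1)[OF a] \<Phi>] by (simp add: comp_def)
    moreover have "(\<lambda>p. a \<odot>\<^bsub>M\<^esub> \<Phi> p) \<in> hom (add_monoid ind) (add_monoid M)"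
      using \<Phi> a by (auto simp: hom_def M.smult_r_distr Pi_def)
    ultimately show ?thesis
      by (rule tensor_hom_eq[OF M.M.abelian_group_axioms _ _ _ p])
        (simp add: pure smult_hom(2)[OF a] a fc M.smult_assoc1)
  qed
  then have "\<Phi> \<in> left_module_hom A ind M"
    using \<Phi> by (simp add: left_module_hom_def)
  then show thesis using that pure by blast
qed

end

section \<open>Fields with a finite group of automorphisms\<close>

lemma (in abelian_monoid) finsum_swap:
  assumes "finite I" "finite J" "\<And>i j. \<lbrakk>i \<in> I; j \<in> J\<rbrakk> \<Longrightarrow> f i j \<in> carrier G"
  shows "(\<Oplus>i\<in>I. \<Oplus>j\<in>J. f i j) = (\<Oplus>j\<in>J. \<Oplus>i\<in>I. f i j)"
  using assms(1,3)
proof (induction I rule: finite_induct)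
  case (insert i I)
  have "(\<Oplus>i\<in>insert i I. \<Oplus>j\<in>J. f i j) = (\<Oplus>j\<in>J. f i j) \<oplus> (\<Oplus>j\<in>J. \<Oplus>i\<in>I. f i j)"
    using insert by (subst finsum_insert) (auto intro!: finsum_closed)
  also have "\<dots> = (\<Oplus>j\<in>J. f i j \<oplus> (\<Oplus>i\<in>I. f i j))"
    using insert by (intro finsum_addf[symmetric]) (auto intro!: finsum_closed)
  also have "\<dots> = (\<Oplus>j\<in>J. \<Oplus>i\<in>insert i I. f i j)"
    using insert by (intro finsum_cong') (auto intro!: finsum_closed)
  finally show ?case .
qed simp

lemma ring_hom_finsum:
  assumes "ring R" "ring S" "h \<in> ring_hom R S" "finite I" "f \<in> I \<rightarrow> carrier R"
  shows "h (finsum R f I) = (\<Oplus>\<^bsub>S\<^esub>i\<in>I. h (f i))"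
proof -
  interpret R: ring R by fact
  interpret S: ring S by fact
  interpret h: ring_hom_ring R S h by (rule ring_hom_ringI2) fact+
  show ?thesis
    using assms(4,5) by (induction I rule: finite_induct) (simp_all add: Pi_def)
qed

context field
begin

lemma inv_of_diff:
  assumes "a \<in> carrier R" "b \<in> carrier R" "a \<noteq> b"
  shows "inv (a \<ominus> b) \<in> carrier R" "(a \<ominus> b) \<otimes> inv (a \<ominus> b) = \<one>"
proof -
  have "a \<ominus> b \<in> Units R"
    using assms field_Units r_right_minus_eq by auto
  then show "inv (a \<ominus> b) \<in> carrier R" "(a \<ominus> b) \<otimes> inv (a \<ominus> b) = \<one>" by auto
qed

text \<open>For each \<open>\<tau> \<in> S\<close> pick \<open>y\<close> with \<open>\<rho> y \<noteq> \<tau> y\<close>; the product over \<open>S\<close> of the functions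
  \<open>\<alpha> \<mapsto> (\<alpha> y - \<tau> y) / (\<rho> y - \<tau> y)\<close>, expanded, has the required shape.\<close>

lemma separating_coordinates:
  assumes "finite S" and \<rho>: "\<rho> \<in> ring_hom R R"
    and "\<And>\<tau>. \<tau> \<in> S \<Longrightarrow> \<tau> \<in> ring_hom R R" "\<And>\<tau>. \<tau> \<in> S \<Longrightarrow> \<exists>y\<in>carrier R. \<rho> y \<noteq> \<tau> y"
  shows "\<exists>(n::nat) x y. (\<forall>i. x i \<in> carrier R \<and> y i \<in> carrier R) \<and>
    (\<Oplus>i\<in>{..<n}. x i \<otimes> \<rho> (y i)) = \<one> \<and> (\<forall>\<tau>\<in>S. (\<Oplus>i\<in>{..<n}. x i \<otimes> \<tau> (y i)) = \<zero>)"
proof -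
  \<comment> \<open>Functions of an endomorphism \<tau> that are finite sums of terms x times
    \<tau>(y). They are closed under products with an affine factor u \<tau>(b) + v because \<tau>
    is multiplicative.\<close>
  define rep where "rep = (\<lambda>F. \<exists>(n::nat) x y. (\<forall>i. x i \<in> carrier R \<and> y i \<in> carrier R) \<and>
    (\<forall>\<tau>\<in>ring_hom R R. (\<Oplus>i\<in>{..<n}. x i \<otimes> \<tau> (y i)) = F \<tau>))"
  have rep_add: "rep (\<lambda>\<tau>. F \<tau> \<oplus> a \<otimes> \<tau> b)" if F: "rep F" and ab: "a \<in> carrier R" "b \<in> carrier R" for F a b
  proof -
    obtain n :: nat and x y where xy: "\<And>i. x i \<in> carrier R" "\<And>i. y i \<in> carrier R"
      "\<And>\<tau>. \<tau> \<in> ring_hom R R \<Longrightarrow> (\<Oplus>i\<in>{..<n}. x i \<otimes> \<tau> (y i)) = F \<tau>"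
      using F unfolding rep_def by blast
    have "(\<Oplus>i\<in>{..<Suc n}. (x(n := a)) i \<otimes> \<tau> ((y(n := b)) i)) = F \<tau> \<oplus> a \<otimes> \<tau> b"
      if \<tau>: "\<tau> \<in> ring_hom R R" for \<tau>
    proof -
      note c = ring_hom_closed[OF \<tau>]
      have "(\<Oplus>i\<in>{..<n}. (x(n := a)) i \<otimes> \<tau> ((y(n := b)) i)) = F \<tau>"
        unfolding xy(3)[OF \<tau>, symmetric] by (rule finsum_cong') (auto simp: xy c)
      moreover have "F \<tau> \<in> carrier R"
        unfolding xy(3)[OF \<tau>, symmetric] by (intro finsum_closed) (auto simp: xy c)
      ultimately show ?thesis
        unfolding lessThan_Suc using ab
        by (subst finsum_insert) (auto simp: xy c a_comm)
    qed
    then show ?thesis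
      unfolding rep_def using xy(1,2) ab
      by (intro exI[of _ "Suc n"] exI[of _ "x(n := a)"] exI[of _ "y(n := b)"]) auto
  qed
  have rep_cong: "rep F \<Longrightarrow> (\<And>\<tau>. \<tau> \<in> ring_hom R R \<Longrightarrow> F \<tau> = F' \<tau>) \<Longrightarrow> rep F'" for F F'
    unfolding rep_def by simp
  have rep_zero: "rep (\<lambda>\<tau>. \<zero>)" unfolding rep_def
    by (intro exI[of _ "0::nat"] exI[of _ "\<lambda>_. \<zero>"]) auto
  have rep_mult: "rep (\<lambda>\<tau>. (\<Oplus>i\<in>{..<n}. x i \<otimes> \<tau> (y i)) \<otimes> (u \<otimes> \<tau> b \<oplus> v))"
    if xy: "\<And>i. x i \<in> carrier R" "\<And>i. y i \<in> carrier R" and u: "u \<in> carrier R" "b \<in> carrier R" "v \<in> carrier R"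
    for n :: nat and x y u v b
  proof (induction n)
    case 0
    show ?case
      by (rule rep_cong[OF rep_zero]) (use u in \<open>simp add: ring_hom_closed\<close>)
  next
    case (Suc n)
    have "rep (\<lambda>\<tau>. ((\<Oplus>i\<in>{..<n}. x i \<otimes> \<tau> (y i)) \<otimes> (u \<otimes> \<tau> b \<oplus> v)
      \<oplus> (x n \<otimes> u) \<otimes> \<tau> (y n \<otimes> b)) \<oplus> (x n \<otimes> v) \<otimes> \<tau> (y n))"
      using xy u by (intro rep_add Suc) auto
    then show ?case
    proof (rule rep_cong)
      fix \<tau> assume \<tau>: "\<tau> \<in> ring_hom R R"
      note c = ring_hom_closed[OF \<tau>]
      define s where "s = (\<Oplus>i\<in>{..<n}. x i \<otimes> \<tau> (y i))"
      have s: "s \<in> carrier R" unfolding s_def by (intro finsum_closed) (auto simp: xy c)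
      have "(\<Oplus>i\<in>{..<Suc n}. x i \<otimes> \<tau> (y i)) = x n \<otimes> \<tau> (y n) \<oplus> s"
        unfolding lessThan_Suc s_def by (rule finsum_insert) (auto simp: xy c)
      moreover have "s \<otimes> (u \<otimes> \<tau> b \<oplus> v) \<oplus> (x n \<otimes> u) \<otimes> (\<tau> (y n) \<otimes> \<tau> b) \<oplus> (x n \<otimes> v) \<otimes> \<tau> (y n)
        = (x n \<otimes> \<tau> (y n) \<oplus> s) \<otimes> (u \<otimes> \<tau> b \<oplus> v)"
      proof -
        have "x n \<in> carrier R" "\<tau> (y n) \<in> carrier R" "\<tau> b \<in> carrier R" using xy u c by auto
        with s u(1,3) show ?thesis by algebra
      qed
      ultimately show "(\<Oplus>i\<in>{..<n}. x i \<otimes> \<tau> (y i)) \<otimes> (u \<otimes> \<tau> b \<oplus> v)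
        \<oplus> (x n \<otimes> u) \<otimes> \<tau> (y n \<otimes> b) \<oplus> (x n \<otimes> v) \<otimes> \<tau> (y n)
        = (\<Oplus>i\<in>{..<Suc n}. x i \<otimes> \<tau> (y i)) \<otimes> (u \<otimes> \<tau> b \<oplus> v)"
        using xy u by (simp add: s_def ring_hom_mult[OF \<tau>])
    qed
  qed
  have "\<exists>F. rep F \<and> F \<rho> = \<one> \<and> (\<forall>\<tau>\<in>S. F \<tau> = \<zero>)"
    using assms(1,3,4)
  proof (induction S rule: finite_induct)
    case empty
    \<comment> \<open>The empty product: the constant function one, written with x = y =
      \<one>.\<close>
    have "rep (\<lambda>\<tau>. \<zero> \<oplus> \<one> \<otimes> \<tau> \<one>)" by (intro rep_add rep_zero) auto
    moreover have "\<zero> \<oplus> \<one> \<otimes> \<rho> \<one> = \<one>" using ring_hom_one[OF \<rho>] by simp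
    ultimately show ?case by (intro exI[of _ "\<lambda>\<tau>. \<zero> \<oplus> \<one> \<otimes> \<tau> \<one>"]) simp
  next
    case (insert \<tau>0 S)
    obtain F where F: "rep F" "F \<rho> = \<one>" "\<forall>\<tau>\<in>S. F \<tau> = \<zero>" using insert by auto
    obtain n :: nat and x y where xy: "\<And>i. x i \<in> carrier R" "\<And>i. y i \<in> carrier R"
      "\<And>\<tau>. \<tau> \<in> ring_hom R R \<Longrightarrow> (\<Oplus>i\<in>{..<n}. x i \<otimes> \<tau> (y i)) = F \<tau>"
      using F(1) unfolding rep_def by blast
    obtain b where b: "b \<in> carrier R" "\<rho> b \<noteq> \<tau>0 b" using insert.prems(2)[of \<tau>0] by auto
    have \<tau>0: "\<tau>0 \<in> ring_hom R R" using insert by simp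
    note c\<rho> = ring_hom_closed[OF \<rho> b(1)] and c\<tau> = ring_hom_closed[OF \<tau>0 b(1)]
    \<comment> \<open>The affine factor with coefficients \<open>u\<close> and \<open>v\<close>
      takes the value \<one> at \<rho> and \<zero> at \<open>\<tau>0\<close>.\<close>
    define u where "u = inv (\<rho> b \<ominus> \<tau>0 b)"
    have u: "u \<in> carrier R" "(\<rho> b \<ominus> \<tau>0 b) \<otimes> u = \<one>"
      using inv_of_diff[OF c\<rho> c\<tau> b(2)] by (simp_all add: u_def)
    define v where "v = \<ominus> (u \<otimes> \<tau>0 b)"
    have v: "v \<in> carrier R" using u c\<tau> by (simp add: v_def)
    have uv: "u \<otimes> d \<oplus> v = (d \<ominus> \<tau>0 b) \<otimes> u" if "d \<in> carrier R" for d
      unfolding v_def using u(1) c\<tau> that by algebra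
    let ?F = "\<lambda>\<tau>. (\<Oplus>i\<in>{..<n}. x i \<otimes> \<tau> (y i)) \<otimes> (u \<otimes> \<tau> b \<oplus> v)"
    have "rep ?F" using xy u v b by (intro rep_mult) auto
    moreover have "?F \<rho> = \<one>" using xy(3)[OF \<rho>] F(2) u c\<rho> by (simp add: uv)
    moreover have "?F \<tau> = \<zero>" if "\<tau> \<in> insert \<tau>0 S" for \<tau>
    proof -
      have \<tau>: "\<tau> \<in> ring_hom R R" using insert.prems that by auto
      have Fc: "F \<tau> \<in> carrier R"
        unfolding xy(3)[OF \<tau>, symmetric]
        by (intro finsum_closed) (auto simp: xy ring_hom_closed[OF \<tau>])
      show ?thesis
      proof (cases "\<tau> = \<tau>0")
        case True
        have "(\<tau>0 b \<ominus> \<tau>0 b) \<otimes> u = \<zero>" using c\<tau> u(1) by (simp add: minus_eq r_neg)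
        then show ?thesis using True xy(3)[OF \<tau>] Fc c\<tau> by (simp add: uv)
      next
        case False
        then show ?thesis using xy(3)[OF \<tau>] F(3) that u v ring_hom_closed[OF \<tau> b(1)] by auto
      qed
    qed
    ultimately show ?case by (intro exI[of _ ?F]) blast
  qed
  then obtain F where F: "rep F" "F \<rho> = \<one>" "\<forall>\<tau>\<in>S. F \<tau> = \<zero>" by blast
  obtain n :: nat and x y where xy: "\<forall>i. x i \<in> carrier R \<and> y i \<in> carrier R"
    "\<And>\<tau>. \<tau> \<in> ring_hom R R \<Longrightarrow> (\<Oplus>i\<in>{..<n}. x i \<otimes> \<tau> (y i)) = F \<tau>"
    using F(1) unfolding rep_def by blast
  show ?thesis
    by (intro exI[of _ n] exI[of _ x] exI[of _ y]) (use xy(1) xy(2)[OF \<rho>] xy(2)[OF assms(3)] F(2,3) in auto)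
qed

text \<open>Each row of \<open>a\<close> maps the line into the space of functions on
  \<open>J\<close>. The hypothesis says that these maps are jointly independent under the coordinate
  projections, so exchange injects \<open>I\<close> into \<open>J\<close>.\<close>

lemma injective_matrix_card_le:
  assumes I: "finite I" and J: "finite J" and a: "\<And>i j. \<lbrakk>i \<in> I; j \<in> J\<rbrakk> \<Longrightarrow> a i j \<in> carrier R"
    and inj: "\<And>x. \<lbrakk>\<forall>i\<in>I. x i \<in> carrier R; \<forall>j\<in>J. (\<Oplus>i\<in>I. x i \<otimes> a i j) = \<zero>\<rbrakk> \<Longrightarrow> \<forall>i\<in>I. x i = \<zero>"
  shows "card I \<le> card J"
proof -
  let ?R = "regular_module R"
  let ?D = "direct_sum J (\<lambda>_. ?R)"
  note reg = regular_module_left_module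
  interpret D: left_module R ?D by (rule direct_sum_left_module[OF ring_axioms reg])
  interpret Reg: left_module R ?R by (rule reg)
  have u: "(\<lambda>c. \<lambda>j\<in>J. c \<otimes> a i j) \<in> left_module_hom R ?R ?D" if "i \<in> I" for i
    using a[OF that] by (intro left_module_homI) (auto intro!: restrict_ext simp: l_distr m_assoc)
  have ev: "finsum ?D (\<lambda>i. \<lambda>j\<in>J. x i \<otimes> a i j) I j = (\<Oplus>i\<in>I. x i \<otimes> a i j)"
    if x: "\<forall>i\<in>I. x i \<in> carrier R" and j: "j \<in> J" for x j
  proof -
    interpret p: module_hom_pair R ?D ?R "\<lambda>y. y j"
      using direct_sum_proj_hom[OF j] by (intro module_hom_pairI D.left_module_axioms reg)
    have "finsum ?D (\<lambda>i. \<lambda>j\<in>J. x i \<otimes> a i j) I j = (\<Oplus>\<^bsub>?R\<^esub>i\<in>I. x i \<otimes> a i j)"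
      using p.finsum[OF I, of "\<lambda>i. \<lambda>j\<in>J. x i \<otimes> a i j"] x a j by (simp add: Pi_def)
    also have "\<dots> = (\<Oplus>i\<in>I. x i \<otimes> a i j)"
      using I x j a by (induction I rule: finite_induct) (simp_all add: Pi_def)
    finally show ?thesis .
  qed
  have "\<exists>\<pi>. inj_on \<pi> I \<and> \<pi> ` I \<subseteq> J \<and> (\<forall>i\<in>I. left_module_iso R ?R ?R)"
  proof (rule simple_family_exchange[where M = ?D and u = "\<lambda>i c. \<lambda>j\<in>J. c \<otimes> a i j" and p = "\<lambda>j y. y j"])
    show "(\<lambda>y. y j) \<in> left_module_hom R ?D ?R" if "j \<in> J" for j
      using direct_sum_proj_hom[OF that] by blast
    fix x assume x: "\<forall>i\<in>I. x i \<in> carrier ?R"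
      and 0: "\<forall>j\<in>J. finsum ?D (\<lambda>i. \<lambda>j\<in>J. x i \<otimes> a i j) I j = \<zero>\<^bsub>?R\<^esub>"
    have xR: "\<forall>i\<in>I. x i \<in> carrier R" using x by simp
    have "\<forall>j\<in>J. (\<Oplus>i\<in>I. x i \<otimes> a i j) = \<zero>"
    proof
      fix j assume j: "j \<in> J"
      show "(\<Oplus>i\<in>I. x i \<otimes> a i j) = \<zero>"
        using bspec[OF 0 j] unfolding ev[OF xR j] by simp
    qed
    then show "\<forall>i\<in>I. x i = \<zero>\<^bsub>?R\<^esub>" using inj[OF xR] by simp
  qed (use I J u regular_module_simple D.left_module_axioms in auto)
  then show ?thesis using card_inj_on_le J by metis
qed

end

text \<open>Spans, independence and dimension are formulated with \<open>combine\<close> on lists,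
  whereas traces and coordinates are indexed sums; this converts between the two.\<close>

lemma (in ring) combine_eq_finsum:
  assumes "\<And>i. i < n \<Longrightarrow> k i \<in> carrier R" "\<And>i. i < n \<Longrightarrow> e i \<in> carrier R"
  shows "combine (map k [0..<n]) (map e [0..<n]) = (\<Oplus>i\<in>{..<n::nat}. k i \<otimes> e i)"
  using assms
proof (induction n)
  case (Suc n)
  have "combine (map k [0..<Suc n]) (map e [0..<Suc n]) =
      combine (map k [0..<n]) (map e [0..<n]) \<oplus> combine [k n] [e n]"
    using Suc.prems by (subst combine_append) auto
  also have "\<dots> = (\<Oplus>i\<in>{..<n}. k i \<otimes> e i) \<oplus> k n \<otimes> e n"
    using Suc by simp
  also have "\<dots> = (\<Oplus>i\<in>{..<Suc n}. k i \<otimes> e i)"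
    unfolding lessThan_Suc using Suc.prems by (subst finsum_insert) (auto simp: a_comm)
  finally show ?case .
qed simp

section \<open>Galois theory of the finite group action on l\<close>

locale galois_action = L: field L + G: Group.group G
  for L :: "'l ring" and G :: "'g monoid" +
  fixes \<phi> :: "'g \<Rightarrow> 'l \<Rightarrow> 'l"
  assumes fin: "finite (carrier G)" and action: "group_action G (carrier L) \<phi>"
    and hom: "\<And>g. g \<in> carrier G \<Longrightarrow> \<phi> g \<in> ring_hom L L"
begin

sublocale act: group_action G "carrier L" \<phi> by (rule action)

abbreviation "K \<equiv> fixed_field L G \<phi>"
abbreviation "H \<equiv> kernel G (Gal L K) \<phi>"

lemma phi_closed [simp]: "\<lbrakk>g \<in> carrier G; x \<in> carrier L\<rbrakk> \<Longrightarrow> \<phi> g x \<in> carrier L"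
  by (rule ring_hom_closed[OF hom])

lemma phi_add: "\<lbrakk>g \<in> carrier G; x \<in> carrier L; y \<in> carrier L\<rbrakk> \<Longrightarrow> \<phi> g (x \<oplus>\<^bsub>L\<^esub> y) = \<phi> g x \<oplus>\<^bsub>L\<^esub> \<phi> g y"
  by (rule ring_hom_add[OF hom])

lemma phi_mult_ring: "\<lbrakk>g \<in> carrier G; x \<in> carrier L; y \<in> carrier L\<rbrakk> \<Longrightarrow> \<phi> g (x \<otimes>\<^bsub>L\<^esub> y) = \<phi> g x \<otimes>\<^bsub>L\<^esub> \<phi> g y"
  by (rule ring_hom_mult[OF hom])

lemma phi_one_ring [simp]: "g \<in> carrier G \<Longrightarrow> \<phi> g \<one>\<^bsub>L\<^esub> = \<one>\<^bsub>L\<^esub>"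
  by (rule ring_hom_one[OF hom])

lemma phi_zero [simp]: "g \<in> carrier G \<Longrightarrow> \<phi> g \<zero>\<^bsub>L\<^esub> = \<zero>\<^bsub>L\<^esub>"
  by (rule ring_hom_zero[OF hom L.ring_axioms L.ring_axioms])

lemma phi_minus: "\<lbrakk>g \<in> carrier G; x \<in> carrier L\<rbrakk> \<Longrightarrow> \<phi> g (\<ominus>\<^bsub>L\<^esub> x) = \<ominus>\<^bsub>L\<^esub> \<phi> g x"
  by (rule L.minus_equality[symmetric]) (simp_all add: L.l_neg flip: phi_add)

lemma phi_finsum: "\<lbrakk>g \<in> carrier G; finite I; f \<in> I \<rightarrow> carrier L\<rbrakk> \<Longrightarrow>
    \<phi> g (finsum L f I) = (\<Oplus>\<^bsub>L\<^esub>i\<in>I. \<phi> g (f i))"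
  by (rule ring_hom_finsum[OF L.ring_axioms L.ring_axioms hom])

lemma phi_comp: "\<lbrakk>g \<in> carrier G; h \<in> carrier G; x \<in> carrier L\<rbrakk> \<Longrightarrow> \<phi> (g \<otimes>\<^bsub>G\<^esub> h) x = \<phi> g (\<phi> h x)"
  by (rule act.composition_rule)

lemma phi_one [simp]: "x \<in> carrier L \<Longrightarrow> \<phi> \<one>\<^bsub>G\<^esub> x = x"
  using act.id_eq_one by (metis restrict_apply')

lemma phi_inv [simp]: "\<lbrakk>g \<in> carrier G; x \<in> carrier L\<rbrakk> \<Longrightarrow> \<phi> g (\<phi> (inv\<^bsub>G\<^esub> g) x) = x"
  "\<lbrakk>g \<in> carrier G; x \<in> carrier L\<rbrakk> \<Longrightarrow> \<phi> (inv\<^bsub>G\<^esub> g) (\<phi> g x) = x"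
  using phi_comp[of g "inv\<^bsub>G\<^esub> g" x] phi_comp[of "inv\<^bsub>G\<^esub> g" g x] by simp_all

lemma phi_ext: "g \<in> carrier G \<Longrightarrow> \<phi> g \<in> extensional (carrier L)"
  using act.bij_prop0 by (auto simp: Bij_def)

lemma phi_eqI: "\<lbrakk>g \<in> carrier G; h \<in> carrier G; \<And>x. x \<in> carrier L \<Longrightarrow> \<phi> g x = \<phi> h x\<rbrakk> \<Longrightarrow> \<phi> g = \<phi> h"
  by (rule extensionalityI[OF phi_ext phi_ext])

text \<open>Elements of \<open>Gal L K\<close> are extensional functions on
  \<open>carrier L\<close>, so being the identity there is a pointwise condition on l.\<close>

lemma H_iff: "h \<in> H \<longleftrightarrow> h \<in> carrier G \<and> (\<forall>x\<in>carrier L. \<phi> h x = x)"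
proof -
  have "\<phi> h = (\<lambda>x\<in>carrier L. x) \<longleftrightarrow> (\<forall>x\<in>carrier L. \<phi> h x = x)" if "h \<in> carrier G"
    using phi_ext[OF that] by (auto simp: fun_eq_iff extensional_def)
  then show ?thesis by (auto simp: kernel_def Gal_def BijGroup_def)
qed

text \<open>The cosets of \<open>H\<close> are the fibres of \<phi>; in this form \<open>G/H\<close>
  is handled throughout.\<close>

lemma H_mem: "\<lbrakk>g \<in> carrier G; h \<in> carrier G\<rbrakk> \<Longrightarrow> inv\<^bsub>G\<^esub> g \<otimes>\<^bsub>G\<^esub> h \<in> H \<longleftrightarrow> \<phi> g = \<phi> h"
proof
  assume g: "g \<in> carrier G" "h \<in> carrier G"
  assume *: "inv\<^bsub>G\<^esub> g \<otimes>\<^bsub>G\<^esub> h \<in> H"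
  show "\<phi> g = \<phi> h"
  proof (rule phi_eqI[OF g])
    fix x assume x: "x \<in> carrier L"
    then have "\<phi> (inv\<^bsub>G\<^esub> g) (\<phi> h x) = x" using * g by (simp add: H_iff phi_comp)
    then show "\<phi> g x = \<phi> h x" using phi_inv(1)[OF g(1), of "\<phi> h x"] g x by simp
  qed
next
  assume g: "g \<in> carrier G" "h \<in> carrier G" "\<phi> g = \<phi> h"
  then show "inv\<^bsub>G\<^esub> g \<otimes>\<^bsub>G\<^esub> h \<in> H" by (simp add: H_iff phi_comp flip: g(3))
qed

text \<open>Selected from the fibre of \<phi>, so that elements inducing the same automorphism have
  literally the same representative; \<open>T\<close> is then a transversal of
  \<open>G/H\<close>.\<close>

definition rep where "rep g = (SOME t. t \<in> carrier G \<and> \<phi> t = \<phi> g)"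

definition T where "T = rep ` carrier G"

lemma rep: "g \<in> carrier G \<Longrightarrow> rep g \<in> carrier G \<and> \<phi> (rep g) = \<phi> g"
  unfolding rep_def by (rule someI[of _ g]) simp

lemma rep_eq: "\<phi> g = \<phi> h \<Longrightarrow> rep g = rep h" by (simp add: rep_def)

lemma rep_in_T: "g \<in> carrier G \<Longrightarrow> rep g \<in> T" by (simp add: T_def)

lemma T_carrier: "t \<in> T \<Longrightarrow> t \<in> carrier G" unfolding T_def using rep by blast

lemma rep_T [simp]: "t \<in> T \<Longrightarrow> rep t = t"
  unfolding T_def using rep rep_eq by blast

lemma T_inj: "\<lbrakk>s \<in> T; t \<in> T; \<phi> s = \<phi> t\<rbrakk> \<Longrightarrow> s = t" using rep_T[of s] rep_T[of t] rep_eq[of s t] by simp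

text \<open>The trivial coset is represented by \<open>rep \<one>\<close>, an element of
  \<open>H\<close> that may differ from \<one>; delta functions on \<open>T\<close> are therefore
  centred at \<open>rep \<one>\<close>.\<close>

lemma T_H: "t \<in> T \<Longrightarrow> t \<in> H \<longleftrightarrow> rep \<one>\<^bsub>G\<^esub> = t"
proof -
  assume t: "t \<in> T"
  have "t \<in> H \<longleftrightarrow> \<phi> \<one>\<^bsub>G\<^esub> = \<phi> t" using H_mem[OF G.one_closed T_carrier[OF t]] T_carrier[OF t] by simp
  then show ?thesis using t rep[OF G.one_closed] rep_eq[of "\<one>\<^bsub>G\<^esub>" t] rep_T[OF t] by auto
qed

lemma fin_T [simp]: "finite T" unfolding T_def by (rule finite_imageI[OF fin])

lemma T_nonempty: "T \<noteq> {}" using rep_in_T[OF G.one_closed] by blast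

text \<open>Left translation permutes the cosets of \<open>H\<close>; on the finite set
  \<open>T\<close> injectivity gives bijectivity.\<close>

lemma T_shift:
  assumes g: "g \<in> carrier G"
  shows "bij_betw (\<lambda>t. rep (g \<otimes>\<^bsub>G\<^esub> t)) T T"
proof -
  have "inj_on (\<lambda>t. rep (g \<otimes>\<^bsub>G\<^esub> t)) T"
  proof (rule inj_onI)
    fix s t assume st: "s \<in> T" "t \<in> T" "rep (g \<otimes>\<^bsub>G\<^esub> s) = rep (g \<otimes>\<^bsub>G\<^esub> t)"
    note c = T_carrier[OF st(1)] T_carrier[OF st(2)]
    have eq: "\<phi> (g \<otimes>\<^bsub>G\<^esub> s) = \<phi> (g \<otimes>\<^bsub>G\<^esub> t)" using st rep c g by (metis G.m_closed)
    have "\<phi> s = \<phi> t"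
    proof (rule phi_eqI[OF c])
      fix x assume x: "x \<in> carrier L"
      have "\<phi> g (\<phi> s x) = \<phi> g (\<phi> t x)" using eq phi_comp[OF g] c x by metis
      then show "\<phi> s x = \<phi> t x" using phi_inv(2)[OF g] c x phi_closed by metis
    qed
    then show "s = t" using st T_inj by blast
  qed
  moreover have "(\<lambda>t. rep (g \<otimes>\<^bsub>G\<^esub> t)) ` T \<subseteq> T" using g T_carrier rep_in_T by auto
  ultimately show ?thesis by (simp add: bij_betw_def endo_inj_surj)
qed

lemma coordinates_at:
  assumes s: "s \<in> T"
  obtains n :: nat and x y where "\<And>i. x i \<in> carrier L" "\<And>i. y i \<in> carrier L"
    "\<And>t. t \<in> T \<Longrightarrow> (\<Oplus>\<^bsub>L\<^esub>i\<in>{..<n}. x i \<otimes>\<^bsub>L\<^esub> \<phi> t (y i)) = (if t = s then \<one>\<^bsub>L\<^esub> else \<zero>\<^bsub>L\<^esub>)"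
proof -
  have "\<exists>y\<in>carrier L. \<phi> s y \<noteq> \<phi> t y" if "t \<in> T - {s}" for t
    using that s T_inj phi_eqI[of s t] T_carrier by blast
  then have "\<exists>(n::nat) x y. (\<forall>i. x i \<in> carrier L \<and> y i \<in> carrier L) \<and>
    (\<Oplus>\<^bsub>L\<^esub>i\<in>{..<n}. x i \<otimes>\<^bsub>L\<^esub> \<phi> s (y i)) = \<one>\<^bsub>L\<^esub> \<and>
    (\<forall>\<tau>\<in>\<phi> ` (T - {s}). (\<Oplus>\<^bsub>L\<^esub>i\<in>{..<n}. x i \<otimes>\<^bsub>L\<^esub> \<tau> (y i)) = \<zero>\<^bsub>L\<^esub>)"
    using s hom T_carrier by (intro L.separating_coordinates) auto
  then obtain n :: nat and x y where "\<forall>i. x i \<in> carrier L \<and> y i \<in> carrier L"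
    "(\<Oplus>\<^bsub>L\<^esub>i\<in>{..<n}. x i \<otimes>\<^bsub>L\<^esub> \<phi> s (y i)) = \<one>\<^bsub>L\<^esub>"
    "\<forall>\<tau>\<in>\<phi> ` (T - {s}). (\<Oplus>\<^bsub>L\<^esub>i\<in>{..<n}. x i \<otimes>\<^bsub>L\<^esub> \<tau> (y i)) = \<zero>\<^bsub>L\<^esub>"
    by blast
  then show thesis by (intro that[of x y n]) auto
qed

text \<open>Dual coordinates for l/k, the Galois condition of Chase, Harrison and Rosenberg. The
  indicator is that of \<open>H\<close>, since automorphisms see only cosets.\<close>

lemma galois_coordinates:
  obtains n :: nat and x y where "\<And>i. x i \<in> carrier L" "\<And>i. y i \<in> carrier L"
    "\<And>g. g \<in> carrier G \<Longrightarrow> (\<Oplus>\<^bsub>L\<^esub>i\<in>{..<n}. x i \<otimes>\<^bsub>L\<^esub> \<phi> g (y i)) = (if g \<in> H then \<one>\<^bsub>L\<^esub> else \<zero>\<^bsub>L\<^esub>)"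
proof -
  obtain n :: nat and x y where xy: "\<And>i. x i \<in> carrier L" "\<And>i. y i \<in> carrier L"
    "\<And>t. t \<in> T \<Longrightarrow> (\<Oplus>\<^bsub>L\<^esub>i\<in>{..<n}. x i \<otimes>\<^bsub>L\<^esub> \<phi> t (y i)) = (if t = rep \<one>\<^bsub>G\<^esub> then \<one>\<^bsub>L\<^esub> else \<zero>\<^bsub>L\<^esub>)"
    by (rule coordinates_at[OF rep_in_T[OF G.one_closed]]) (rule that)
  have eqv: "rep g = rep \<one>\<^bsub>G\<^esub> \<longleftrightarrow> g \<in> H" if g: "g \<in> carrier G" for g
  proof -
    have "g \<in> H \<longleftrightarrow> \<phi> \<one>\<^bsub>G\<^esub> = \<phi> g" using H_mem[OF G.one_closed g] g by simp
    then show ?thesis using rep[OF g] rep[OF G.one_closed] rep_eq[of g "\<one>\<^bsub>G\<^esub>"] by auto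
  qed
  show thesis
    by (rule that[of x y n]) (use xy(1,2) xy(3)[OF rep_in_T] rep eqv in simp_all)
qed

text \<open>The trace from l to k, summed over the transversal. Summing over all of \<open>G\<close>
  would multiply it by the order of \<open>H\<close>, which may be zero in l.\<close>

definition trace where "trace z = (\<Oplus>\<^bsub>L\<^esub>t\<in>T. \<phi> t z)"

lemma trace_closed [simp]: "z \<in> carrier L \<Longrightarrow> trace z \<in> carrier L"
  unfolding trace_def by (intro L.finsum_closed) (auto simp: T_carrier)

lemma trace_in_K: assumes z: "z \<in> carrier L" shows "trace z \<in> K"
proof -
  have "\<phi> g (trace z) = trace z" if g: "g \<in> carrier G" for g
  proof -
    have "\<phi> g (trace z) = (\<Oplus>\<^bsub>L\<^esub>t\<in>T. \<phi> g (\<phi> t z))"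
      unfolding trace_def using g z by (intro phi_finsum) (auto simp: T_carrier)
    also have "\<dots> = (\<Oplus>\<^bsub>L\<^esub>t\<in>T. \<phi> (rep (g \<otimes>\<^bsub>G\<^esub> t)) z)"
      using g z by (intro L.finsum_cong') (auto simp: T_carrier rep phi_comp)
    also have "\<dots> = (\<Oplus>\<^bsub>L\<^esub>t\<in>(\<lambda>t. rep (g \<otimes>\<^bsub>G\<^esub> t)) ` T. \<phi> t z)"
      using T_shift[OF g] g z T_carrier rep
      by (intro L.finsum_reindex[symmetric]) (auto simp: bij_betw_def)
    finally show ?thesis using T_shift[OF g] by (simp add: trace_def bij_betw_def)
  qed
  then show ?thesis using z by (simp add: fixed_field_def)
qed

lemma K_closed: "k \<in> K \<Longrightarrow> k \<in> carrier L" by (simp add: fixed_field_def)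

lemma phi_K: "\<lbrakk>k \<in> K; g \<in> carrier G\<rbrakk> \<Longrightarrow> \<phi> g k = k" by (simp add: fixed_field_def)

lemma K_subfield: "subfield K L"
proof (rule L.subfieldI')
  show "subring K L"
    by (rule L.subringI) (auto simp: fixed_field_def phi_add phi_mult_ring phi_minus)
  fix k assume k: "k \<in> K - {\<zero>\<^bsub>L\<^esub>}"
  then have u: "k \<in> Units L" using L.field_Units by (auto simp: K_closed)
  then have c: "inv\<^bsub>L\<^esub> k \<in> carrier L" by simp
  have "\<phi> g (inv\<^bsub>L\<^esub> k) = inv\<^bsub>L\<^esub> k" if g: "g \<in> carrier G" for g
  proof -
    have "\<phi> g (inv\<^bsub>L\<^esub> k) \<otimes>\<^bsub>L\<^esub> k = \<phi> g (inv\<^bsub>L\<^esub> k) \<otimes>\<^bsub>L\<^esub> \<phi> g k" using k g phi_K by auto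
    also have "\<dots> = \<one>\<^bsub>L\<^esub>" using u c g k K_closed by (simp flip: phi_mult_ring)
    finally show ?thesis using c g u k K_closed by (intro L.comm_inv_char[symmetric]) (auto simp: L.m_comm)
  qed
  then show "inv\<^bsub>L\<^esub> k \<in> K" using c by (simp add: fixed_field_def)
qed

text \<open>Interchanging the sums gives, at each \<open>t\<close>, the coefficient \<Sum> x \<phi>
  t (y), which is \<one> on the trivial coset and \<zero> elsewhere. As traces lie in
  \<open>K\<close>, the \<open>x i\<close> span l over k.\<close>

lemma trace_expansion:
  assumes x: "\<And>i. x i \<in> carrier L" and y: "\<And>i. y i \<in> carrier L"
    and xy: "\<And>g. g \<in> carrier G \<Longrightarrow> (\<Oplus>\<^bsub>L\<^esub>i\<in>{..<n::nat}. x i \<otimes>\<^bsub>L\<^esub> \<phi> g (y i)) = (if g \<in> H then \<one>\<^bsub>L\<^esub> else \<zero>\<^bsub>L\<^esub>)"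
    and z: "z \<in> carrier L"
  shows "(\<Oplus>\<^bsub>L\<^esub>i\<in>{..<n}. x i \<otimes>\<^bsub>L\<^esub> trace (y i \<otimes>\<^bsub>L\<^esub> z)) = z"
proof -
  have "(\<Oplus>\<^bsub>L\<^esub>i\<in>{..<n}. x i \<otimes>\<^bsub>L\<^esub> trace (y i \<otimes>\<^bsub>L\<^esub> z))
      = (\<Oplus>\<^bsub>L\<^esub>i\<in>{..<n}. \<Oplus>\<^bsub>L\<^esub>t\<in>T. (x i \<otimes>\<^bsub>L\<^esub> \<phi> t (y i)) \<otimes>\<^bsub>L\<^esub> \<phi> t z)"
  proof (rule L.finsum_cong')
    fix i
    have "x i \<otimes>\<^bsub>L\<^esub> trace (y i \<otimes>\<^bsub>L\<^esub> z) = (\<Oplus>\<^bsub>L\<^esub>t\<in>T. x i \<otimes>\<^bsub>L\<^esub> \<phi> t (y i \<otimes>\<^bsub>L\<^esub> z))"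
      unfolding trace_def using x y z by (intro L.finsum_rdistr) (auto simp: T_carrier)
    also have "\<dots> = (\<Oplus>\<^bsub>L\<^esub>t\<in>T. (x i \<otimes>\<^bsub>L\<^esub> \<phi> t (y i)) \<otimes>\<^bsub>L\<^esub> \<phi> t z)"
      using x y z by (intro L.finsum_cong') (auto simp: T_carrier phi_mult_ring L.m_assoc)
    finally show "x i \<otimes>\<^bsub>L\<^esub> trace (y i \<otimes>\<^bsub>L\<^esub> z) = (\<Oplus>\<^bsub>L\<^esub>t\<in>T. (x i \<otimes>\<^bsub>L\<^esub> \<phi> t (y i)) \<otimes>\<^bsub>L\<^esub> \<phi> t z)" .
  qed (use x y z in \<open>auto intro!: L.finsum_closed simp: T_carrier\<close>)
  also have "\<dots> = (\<Oplus>\<^bsub>L\<^esub>t\<in>T. \<Oplus>\<^bsub>L\<^esub>i\<in>{..<n}. (x i \<otimes>\<^bsub>L\<^esub> \<phi> t (y i)) \<otimes>\<^bsub>L\<^esub> \<phi> t z)"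
    using x y z by (intro L.finsum_swap) (auto simp: T_carrier)
  also have "\<dots> = (\<Oplus>\<^bsub>L\<^esub>t\<in>T. if rep \<one>\<^bsub>G\<^esub> = t then \<phi> t z else \<zero>\<^bsub>L\<^esub>)"
  proof (rule L.finsum_cong')
    fix t assume t: "t \<in> T"
    have "(\<Oplus>\<^bsub>L\<^esub>i\<in>{..<n}. (x i \<otimes>\<^bsub>L\<^esub> \<phi> t (y i)) \<otimes>\<^bsub>L\<^esub> \<phi> t z) = (\<Oplus>\<^bsub>L\<^esub>i\<in>{..<n}. x i \<otimes>\<^bsub>L\<^esub> \<phi> t (y i)) \<otimes>\<^bsub>L\<^esub> \<phi> t z"
      using x y z t by (intro L.finsum_ldistr[symmetric]) (auto simp: T_carrier)
    then show "(\<Oplus>\<^bsub>L\<^esub>i\<in>{..<n}. (x i \<otimes>\<^bsub>L\<^esub> \<phi> t (y i)) \<otimes>\<^bsub>L\<^esub> \<phi> t z) = (if rep \<one>\<^bsub>G\<^esub> = t then \<phi> t z else \<zero>\<^bsub>L\<^esub>)"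
      using xy[OF T_carrier[OF t]] z T_H[OF t] T_carrier[OF t] by simp
  qed (use z in \<open>auto simp: T_carrier\<close>)
  also have "\<dots> = \<phi> (rep \<one>\<^bsub>G\<^esub>) z"
    using z by (intro L.finsum_singleton rep_in_T) (auto simp: T_carrier)
  finally show ?thesis using rep[OF G.one_closed] z by simp
qed

text \<open>Independence of distinct automorphisms: evaluating the relation at the coordinates
  \<open>y i\<close> that belong to \<open>s\<close>, and weighting by \<open>x i\<close>, isolates
  the coefficient \<open>d s\<close>.\<close>

lemma dedekind:
  assumes d: "\<And>t. t \<in> T \<Longrightarrow> d t \<in> carrier L"
    and 0: "\<And>z. z \<in> carrier L \<Longrightarrow> (\<Oplus>\<^bsub>L\<^esub>t\<in>T. d t \<otimes>\<^bsub>L\<^esub> \<phi> t z) = \<zero>\<^bsub>L\<^esub>" and s: "s \<in> T"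
  shows "d s = \<zero>\<^bsub>L\<^esub>"
proof -
  obtain n :: nat and x y where x: "\<And>i. x i \<in> carrier L" and y: "\<And>i. y i \<in> carrier L"
    and xy: "\<And>t. t \<in> T \<Longrightarrow> (\<Oplus>\<^bsub>L\<^esub>i\<in>{..<n}. x i \<otimes>\<^bsub>L\<^esub> \<phi> t (y i)) = (if t = s then \<one>\<^bsub>L\<^esub> else \<zero>\<^bsub>L\<^esub>)"
    by (rule coordinates_at[OF s]) (rule that)
  have "\<zero>\<^bsub>L\<^esub> = (\<Oplus>\<^bsub>L\<^esub>i\<in>{..<n}. x i \<otimes>\<^bsub>L\<^esub> (\<Oplus>\<^bsub>L\<^esub>t\<in>T. d t \<otimes>\<^bsub>L\<^esub> \<phi> t (y i)))"
    using x y by (simp add: 0)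
  also have "\<dots> = (\<Oplus>\<^bsub>L\<^esub>i\<in>{..<n}. \<Oplus>\<^bsub>L\<^esub>t\<in>T. d t \<otimes>\<^bsub>L\<^esub> (x i \<otimes>\<^bsub>L\<^esub> \<phi> t (y i)))"
  proof (rule L.finsum_cong')
    fix i
    have "x i \<otimes>\<^bsub>L\<^esub> (\<Oplus>\<^bsub>L\<^esub>t\<in>T. d t \<otimes>\<^bsub>L\<^esub> \<phi> t (y i)) = (\<Oplus>\<^bsub>L\<^esub>t\<in>T. x i \<otimes>\<^bsub>L\<^esub> (d t \<otimes>\<^bsub>L\<^esub> \<phi> t (y i)))"
      using x y d by (intro L.finsum_rdistr) (auto simp: T_carrier)
    also have "\<dots> = (\<Oplus>\<^bsub>L\<^esub>t\<in>T. d t \<otimes>\<^bsub>L\<^esub> (x i \<otimes>\<^bsub>L\<^esub> \<phi> t (y i)))"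
      using x y d by (intro L.finsum_cong') (auto simp: T_carrier L.m_lcomm)
    finally show "x i \<otimes>\<^bsub>L\<^esub> (\<Oplus>\<^bsub>L\<^esub>t\<in>T. d t \<otimes>\<^bsub>L\<^esub> \<phi> t (y i)) = (\<Oplus>\<^bsub>L\<^esub>t\<in>T. d t \<otimes>\<^bsub>L\<^esub> (x i \<otimes>\<^bsub>L\<^esub> \<phi> t (y i)))" .
  qed (use x y d in \<open>auto intro!: L.finsum_closed simp: T_carrier\<close>)
  also have "\<dots> = (\<Oplus>\<^bsub>L\<^esub>t\<in>T. \<Oplus>\<^bsub>L\<^esub>i\<in>{..<n}. d t \<otimes>\<^bsub>L\<^esub> (x i \<otimes>\<^bsub>L\<^esub> \<phi> t (y i)))"
    using x y d by (intro L.finsum_swap) (auto simp: T_carrier)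
  also have "\<dots> = (\<Oplus>\<^bsub>L\<^esub>t\<in>T. if s = t then d t else \<zero>\<^bsub>L\<^esub>)"
  proof (rule L.finsum_cong')
    fix t assume t: "t \<in> T"
    have "(\<Oplus>\<^bsub>L\<^esub>i\<in>{..<n}. d t \<otimes>\<^bsub>L\<^esub> (x i \<otimes>\<^bsub>L\<^esub> \<phi> t (y i))) = d t \<otimes>\<^bsub>L\<^esub> (\<Oplus>\<^bsub>L\<^esub>i\<in>{..<n}. x i \<otimes>\<^bsub>L\<^esub> \<phi> t (y i))"
      using x y d t by (intro L.finsum_rdistr[symmetric]) (auto simp: T_carrier)
    then show "(\<Oplus>\<^bsub>L\<^esub>i\<in>{..<n}. d t \<otimes>\<^bsub>L\<^esub> (x i \<otimes>\<^bsub>L\<^esub> \<phi> t (y i))) = (if s = t then d t else \<zero>\<^bsub>L\<^esub>)"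
      using xy[OF t] d[OF t] by auto
  qed (use d in auto)
  also have "\<dots> = d s" using s d by (intro L.finsum_singleton) auto
  finally show ?thesis by simp
qed


text \<open>For a basis \<open>e\<close> of l over k the matrix with entries \<phi> t (e j) is
  injective from both sides: on the side of \<open>T\<close> by independence of automorphisms, on
  the side of the basis by the trace. Hence both index sets have the same size.\<close>

lemma dimension_over_K: "L.dimension (card T) K (carrier L)"
proof -
  note K = K_subfield
  obtain n :: nat and x y where x: "\<And>i. x i \<in> carrier L" and y: "\<And>i. y i \<in> carrier L"
    and xy: "\<And>g. g \<in> carrier G \<Longrightarrow> (\<Oplus>\<^bsub>L\<^esub>i\<in>{..<n}. x i \<otimes>\<^bsub>L\<^esub> \<phi> g (y i)) = (if g \<in> H then \<one>\<^bsub>L\<^esub> else \<zero>\<^bsub>L\<^esub>)"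
    by (rule galois_coordinates) (rule that)
  have expand: "(\<Oplus>\<^bsub>L\<^esub>i\<in>{..<n}. x i \<otimes>\<^bsub>L\<^esub> trace (y i \<otimes>\<^bsub>L\<^esub> z)) = z" if "z \<in> carrier L" for z
    by (rule trace_expansion[OF x y _ that]) (rule xy)
  have us: "set (map x [0..<n]) \<subseteq> carrier L" using x by auto
  have "z \<in> L.Span K (map x [0..<n])" if z: "z \<in> carrier L" for z
  proof -
    let ?k = "\<lambda>i. trace (y i \<otimes>\<^bsub>L\<^esub> z)"
    have "L.combine (map ?k [0..<n]) (map x [0..<n]) = (\<Oplus>\<^bsub>L\<^esub>i\<in>{..<n}. ?k i \<otimes>\<^bsub>L\<^esub> x i)"
      using x y z by (intro L.combine_eq_finsum) auto
    also have "\<dots> = (\<Oplus>\<^bsub>L\<^esub>i\<in>{..<n}. x i \<otimes>\<^bsub>L\<^esub> ?k i)"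
      using x y z by (intro L.finsum_cong') (auto simp: L.m_comm)
    also have "\<dots> = z" by (rule expand[OF z])
    finally have "z = L.combine (map ?k [0..<n]) (map x [0..<n])" by simp
    moreover have "set (map ?k [0..<n]) \<subseteq> K" using y z trace_in_K by auto
    ultimately show ?thesis unfolding L.Span_mem_iff_length_version[OF K us]
      by (intro exI[of _ "map ?k [0..<n]"]) simp
  qed
  then have sp: "L.Span K (map x [0..<n]) = carrier L"
    using L.Span_in_carrier[OF subfieldE(3)[OF K] us] by blast
  obtain Vs where Vs: "set Vs \<subseteq> carrier L" "L.independent K Vs" "L.Span K Vs = carrier L"
    using L.filter_base[OF K us] sp by metis
  define m where "m = length Vs"
  define e where "e = (\<lambda>j. Vs ! j)"
  have e: "e j \<in> carrier L" if "j < m" for j using that Vs(1) by (auto simp: e_def m_def)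
  have Vse: "Vs = map e [0..<m]" by (simp add: e_def m_def map_nth)
  have "card T \<le> card {..<m}"
  proof (rule L.injective_matrix_card_le[where a = "\<lambda>t j. \<phi> t (e j)"])
    fix d assume d: "\<forall>t\<in>T. d t \<in> carrier L" and 0: "\<forall>j\<in>{..<m}. (\<Oplus>\<^bsub>L\<^esub>t\<in>T. d t \<otimes>\<^bsub>L\<^esub> \<phi> t (e j)) = \<zero>\<^bsub>L\<^esub>"
    \<comment> \<open>\<open>f\<close> is k-linear, as elements of \<open>K\<close> are fixed by
      every \<open>\<phi> t\<close>; vanishing on the basis, it vanishes on l.\<close>
    define f where "f = (\<lambda>z. \<Oplus>\<^bsub>L\<^esub>t\<in>T. d t \<otimes>\<^bsub>L\<^esub> \<phi> t z)"
    have fcl: "f z \<in> carrier L" if "z \<in> carrier L" for z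
      unfolding f_def using d that by (intro L.finsum_closed) (auto simp: T_carrier)
    have fadd: "f (w \<oplus>\<^bsub>L\<^esub> z) = f w \<oplus>\<^bsub>L\<^esub> f z" if "w \<in> carrier L" "z \<in> carrier L" for w z
    proof -
      have "f (w \<oplus>\<^bsub>L\<^esub> z) = (\<Oplus>\<^bsub>L\<^esub>t\<in>T. d t \<otimes>\<^bsub>L\<^esub> \<phi> t w \<oplus>\<^bsub>L\<^esub> d t \<otimes>\<^bsub>L\<^esub> \<phi> t z)"
        unfolding f_def using d that by (intro L.finsum_cong') (auto simp: T_carrier phi_add L.r_distr)
      then show ?thesis
        unfolding f_def using d that by (simp add: L.finsum_addf T_carrier Pi_def)
    qed
    have fmult: "f (k \<otimes>\<^bsub>L\<^esub> z) = k \<otimes>\<^bsub>L\<^esub> f z" if "k \<in> K" "z \<in> carrier L" for k z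
    proof -
      have "f (k \<otimes>\<^bsub>L\<^esub> z) = (\<Oplus>\<^bsub>L\<^esub>t\<in>T. k \<otimes>\<^bsub>L\<^esub> (d t \<otimes>\<^bsub>L\<^esub> \<phi> t z))"
        unfolding f_def using d that
        by (intro L.finsum_cong') (auto simp: T_carrier phi_mult_ring K_closed phi_K L.m_lcomm)
      also have "\<dots> = k \<otimes>\<^bsub>L\<^esub> f z"
        unfolding f_def using d that by (intro L.finsum_rdistr[symmetric]) (auto simp: T_carrier K_closed)
      finally show ?thesis .
    qed
    have f0: "f \<zero>\<^bsub>L\<^esub> = \<zero>\<^bsub>L\<^esub>" using fadd[of "\<zero>\<^bsub>L\<^esub>" "\<zero>\<^bsub>L\<^esub>"] fcl[of "\<zero>\<^bsub>L\<^esub>"] by simp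
    have fcomb: "f (L.combine Ks Us) = \<zero>\<^bsub>L\<^esub>"
      if "set Ks \<subseteq> K" "set Us \<subseteq> carrier L" "\<forall>u\<in>set Us. f u = \<zero>\<^bsub>L\<^esub>" for Ks Us
      using that
    proof (induction Ks Us rule: L.combine.induct)
      case (1 k Ks u Us)
      then have "L.combine Ks Us \<in> carrier L" using K_closed by (intro L.combine_in_carrier) auto
      then show ?case using 1 by (simp add: fadd fmult K_closed)
    qed (simp_all add: f0)
    have "f z = \<zero>\<^bsub>L\<^esub>" if "z \<in> carrier L" for z
    proof -
      have "z \<in> L.Span K Vs" using that Vs by simp
      then obtain Ks where Ks: "set Ks \<subseteq> K" "z = L.combine Ks Vs"
        unfolding L.Span_mem_iff_length_version[OF K Vs(1)] by blast
      moreover have "\<forall>u\<in>set Vs. f u = \<zero>\<^bsub>L\<^esub>" unfolding Vse using 0 by (auto simp: f_def)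
      ultimately show ?thesis using fcomb Vs(1) by simp
    qed
    note z0 = this[unfolded f_def]
    show "\<forall>t\<in>T. d t = \<zero>\<^bsub>L\<^esub>"
    proof
      fix t assume t: "t \<in> T"
      show "d t = \<zero>\<^bsub>L\<^esub>"
        by (rule dedekind[OF _ _ t]) (rule bspec[OF d], assumption, rule z0, assumption)
    qed
  qed (use e in \<open>auto simp: T_carrier\<close>)
  moreover have "card {..<m} \<le> card T"
  proof (rule L.injective_matrix_card_le[where a = "\<lambda>j t. \<phi> t (e j)"])
    fix c assume c: "\<forall>j\<in>{..<m}. c j \<in> carrier L"
      and 0: "\<forall>t\<in>T. (\<Oplus>\<^bsub>L\<^esub>j\<in>{..<m}. c j \<otimes>\<^bsub>L\<^esub> \<phi> t (e j)) = \<zero>\<^bsub>L\<^esub>"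
    have 0: "(\<Oplus>\<^bsub>L\<^esub>j\<in>{..<m}. c j \<otimes>\<^bsub>L\<^esub> \<phi> g (e j)) = \<zero>\<^bsub>L\<^esub>" if "g \<in> carrier G" for g
      using bspec[OF 0 rep_in_T[OF that]] rep[OF that] by simp
    \<comment> \<open>The traces of r c(j) are coefficients in k of a linear relation between the
      \<open>e j\<close>: their combination regroups as a sum over \<open>t\<close> of \<phi> t (r)
      times the image under \<phi> t of the assumed relation at the inverse of \<open>t\<close>,
      which is zero.\<close>
    have tr0: "trace (r \<otimes>\<^bsub>L\<^esub> c j) = \<zero>\<^bsub>L\<^esub>" if r: "r \<in> carrier L" and j: "j < m" for r j
    proof -
      let ?k = "\<lambda>j. trace (r \<otimes>\<^bsub>L\<^esub> c j)"
      have "L.combine (map ?k [0..<m]) (map e [0..<m]) = (\<Oplus>\<^bsub>L\<^esub>j\<in>{..<m}. ?k j \<otimes>\<^bsub>L\<^esub> e j)"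
        using c e r by (intro L.combine_eq_finsum) auto
      also have "\<dots> = (\<Oplus>\<^bsub>L\<^esub>j\<in>{..<m}. \<Oplus>\<^bsub>L\<^esub>t\<in>T. \<phi> t (r \<otimes>\<^bsub>L\<^esub> c j) \<otimes>\<^bsub>L\<^esub> e j)"
      proof (rule L.finsum_cong')
        fix j assume "j \<in> {..<m}"
        then show "?k j \<otimes>\<^bsub>L\<^esub> e j = (\<Oplus>\<^bsub>L\<^esub>t\<in>T. \<phi> t (r \<otimes>\<^bsub>L\<^esub> c j) \<otimes>\<^bsub>L\<^esub> e j)"
          unfolding trace_def using c e r by (intro L.finsum_ldistr) (auto simp: T_carrier)
      qed (use c e r in \<open>auto intro!: L.finsum_closed simp: T_carrier\<close>)
      also have "\<dots> = (\<Oplus>\<^bsub>L\<^esub>t\<in>T. \<Oplus>\<^bsub>L\<^esub>j\<in>{..<m}. \<phi> t (r \<otimes>\<^bsub>L\<^esub> c j) \<otimes>\<^bsub>L\<^esub> e j)"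
        using c e r by (intro L.finsum_swap) (auto simp: T_carrier)
      also have "\<dots> = (\<Oplus>\<^bsub>L\<^esub>t\<in>T. \<zero>\<^bsub>L\<^esub>)"
      proof (rule L.finsum_cong')
        fix t assume t: "t \<in> T"
        note tG = T_carrier[OF t]
        let ?s = "\<lambda>j. c j \<otimes>\<^bsub>L\<^esub> \<phi> (inv\<^bsub>G\<^esub> t) (e j)"
        have sc: "?s \<in> {..<m} \<rightarrow> carrier L" using c e tG by auto
        have "(\<Oplus>\<^bsub>L\<^esub>j\<in>{..<m}. \<phi> t (r \<otimes>\<^bsub>L\<^esub> c j) \<otimes>\<^bsub>L\<^esub> e j) = (\<Oplus>\<^bsub>L\<^esub>j\<in>{..<m}. \<phi> t r \<otimes>\<^bsub>L\<^esub> \<phi> t (?s j))"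
          using c e r tG by (intro L.finsum_cong') (auto simp: phi_mult_ring L.m_assoc)
        also have "\<dots> = \<phi> t r \<otimes>\<^bsub>L\<^esub> (\<Oplus>\<^bsub>L\<^esub>j\<in>{..<m}. \<phi> t (?s j))"
          using r tG sc by (intro L.finsum_rdistr[symmetric]) (auto simp: Pi_def)
        also have "(\<Oplus>\<^bsub>L\<^esub>j\<in>{..<m}. \<phi> t (?s j)) = \<phi> t (\<Oplus>\<^bsub>L\<^esub>j\<in>{..<m}. ?s j)"
          using phi_finsum[OF tG _ sc] by simp
        finally show "(\<Oplus>\<^bsub>L\<^esub>j\<in>{..<m}. \<phi> t (r \<otimes>\<^bsub>L\<^esub> c j) \<otimes>\<^bsub>L\<^esub> e j) = \<zero>\<^bsub>L\<^esub>"
          using 0[of "inv\<^bsub>G\<^esub> t"] tG r by simp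
      qed auto
      finally have "L.combine (map ?k [0..<m]) Vs = \<zero>\<^bsub>L\<^esub>" using Vse by simp
      moreover have "set (map ?k [0..<m]) \<subseteq> K" using c r trace_in_K by auto
      ultimately have "set (take (length Vs) (map ?k [0..<m])) \<subseteq> {\<zero>\<^bsub>L\<^esub>}"
        using L.independent_imp_trivial_combine[OF K Vs(2)] by blast
      then show ?thesis using j by (simp add: m_def image_subset_iff)
    qed
    show "\<forall>j\<in>{..<m}. c j = \<zero>\<^bsub>L\<^esub>"
    proof
      fix j assume j: "j \<in> {..<m}"
      have "c j = (\<Oplus>\<^bsub>L\<^esub>i\<in>{..<n}. x i \<otimes>\<^bsub>L\<^esub> trace (y i \<otimes>\<^bsub>L\<^esub> c j))"
        using expand[of "c j"] c j by simp
      also have "\<dots> = (\<Oplus>\<^bsub>L\<^esub>i\<in>{..<n}. \<zero>\<^bsub>L\<^esub>)"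
        using j tr0 x y by (intro L.finsum_cong') auto
      finally show "c j = \<zero>\<^bsub>L\<^esub>" by simp
    qed
  qed (use e in \<open>auto simp: T_carrier\<close>)
  ultimately have "card T = length Vs" by (simp add: m_def)
  then show ?thesis using L.dimensionI[OF K Vs(2,3)] by simp
qed

text \<open>Artin's theorem. An automorphism \<open>s\<close> over k, applied to the trace
  expansion, becomes a combination of the \<phi> t because it fixes traces. If \<open>s\<close> were
  different from all of them, coordinates separating \<open>s\<close> from \<open>T\<close> would
  evaluate this combination to both \<one> and \<zero>.\<close>

lemma Gal_iff: "s \<in> carrier (Gal L K) \<longleftrightarrow> (\<exists>g\<in>carrier G. \<phi> g = s)"
proof
  assume "\<exists>g\<in>carrier G. \<phi> g = s"
  then show "s \<in> carrier (Gal L K)"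
    using act.bij_prop0 hom phi_K by (auto simp: Gal_def BijGroup_def)
next
  assume "s \<in> carrier (Gal L K)"
  then have s: "s \<in> Bij (carrier L)" "s \<in> ring_hom L L" "\<And>k. k \<in> K \<Longrightarrow> s k = k"
    by (auto simp: Gal_def BijGroup_def)
  note scl = ring_hom_closed[OF s(2)]
  show "\<exists>g\<in>carrier G. \<phi> g = s"
  proof (rule ccontr)
    assume no: "\<not> (\<exists>g\<in>carrier G. \<phi> g = s)"
    have "\<exists>y\<in>carrier L. s y \<noteq> \<phi> t y" if t: "t \<in> T" for t
    proof (rule ccontr)
      assume "\<not> (\<exists>y\<in>carrier L. s y \<noteq> \<phi> t y)"
      then have "\<phi> t = s"
        using phi_ext[OF T_carrier[OF t]] s(1) by (intro extensionalityI[of _ "carrier L"]) (auto simp: Bij_def)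
      then show False using no T_carrier[OF t] by blast
    qed
    then have "\<exists>(m::nat) a b. (\<forall>i. a i \<in> carrier L \<and> b i \<in> carrier L) \<and>
      (\<Oplus>\<^bsub>L\<^esub>i\<in>{..<m}. a i \<otimes>\<^bsub>L\<^esub> s (b i)) = \<one>\<^bsub>L\<^esub> \<and>
      (\<forall>\<tau>\<in>\<phi> ` T. (\<Oplus>\<^bsub>L\<^esub>i\<in>{..<m}. a i \<otimes>\<^bsub>L\<^esub> \<tau> (b i)) = \<zero>\<^bsub>L\<^esub>)"
      using s(2) hom T_carrier by (intro L.separating_coordinates) auto
    then obtain m :: nat and a b where ab: "\<And>i. a i \<in> carrier L" "\<And>i. b i \<in> carrier L"
      and one: "(\<Oplus>\<^bsub>L\<^esub>i\<in>{..<m}. a i \<otimes>\<^bsub>L\<^esub> s (b i)) = \<one>\<^bsub>L\<^esub>"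
      and 0: "\<And>t. t \<in> T \<Longrightarrow> (\<Oplus>\<^bsub>L\<^esub>i\<in>{..<m}. a i \<otimes>\<^bsub>L\<^esub> \<phi> t (b i)) = \<zero>\<^bsub>L\<^esub>" by blast
    obtain n :: nat and x y where x: "\<And>i. x i \<in> carrier L" and y: "\<And>i. y i \<in> carrier L"
      and xy: "\<And>g. g \<in> carrier G \<Longrightarrow> (\<Oplus>\<^bsub>L\<^esub>i\<in>{..<n}. x i \<otimes>\<^bsub>L\<^esub> \<phi> g (y i)) = (if g \<in> H then \<one>\<^bsub>L\<^esub> else \<zero>\<^bsub>L\<^esub>)"
      by (rule galois_coordinates) (rule that)
    have expand: "(\<Oplus>\<^bsub>L\<^esub>i\<in>{..<n}. x i \<otimes>\<^bsub>L\<^esub> trace (y i \<otimes>\<^bsub>L\<^esub> z)) = z" if "z \<in> carrier L" for z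
    by (rule trace_expansion[OF x y _ that]) (rule xy)
    define c where "c = (\<lambda>t. \<Oplus>\<^bsub>L\<^esub>i\<in>{..<n}. s (x i) \<otimes>\<^bsub>L\<^esub> \<phi> t (y i))"
    have c: "c t \<in> carrier L" if "t \<in> T" for t
      unfolding c_def using x y scl T_carrier[OF that] by (intro L.finsum_closed) auto
    have sz: "s z = (\<Oplus>\<^bsub>L\<^esub>t\<in>T. c t \<otimes>\<^bsub>L\<^esub> \<phi> t z)" if z: "z \<in> carrier L" for z
    proof -
      have "s z = s (\<Oplus>\<^bsub>L\<^esub>i\<in>{..<n}. x i \<otimes>\<^bsub>L\<^esub> trace (y i \<otimes>\<^bsub>L\<^esub> z))"
        using expand[OF z] by simp
      also have "\<dots> = (\<Oplus>\<^bsub>L\<^esub>i\<in>{..<n}. s (x i \<otimes>\<^bsub>L\<^esub> trace (y i \<otimes>\<^bsub>L\<^esub> z)))"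
        using x y z by (intro ring_hom_finsum[OF L.ring_axioms L.ring_axioms s(2)]) auto
      also have "\<dots> = (\<Oplus>\<^bsub>L\<^esub>i\<in>{..<n}. \<Oplus>\<^bsub>L\<^esub>t\<in>T. (s (x i) \<otimes>\<^bsub>L\<^esub> \<phi> t (y i)) \<otimes>\<^bsub>L\<^esub> \<phi> t z)"
      proof (rule L.finsum_cong')
        fix i
        have "s (x i \<otimes>\<^bsub>L\<^esub> trace (y i \<otimes>\<^bsub>L\<^esub> z)) = s (x i) \<otimes>\<^bsub>L\<^esub> trace (y i \<otimes>\<^bsub>L\<^esub> z)"
          using x y z s(3)[OF trace_in_K] by (simp add: ring_hom_mult[OF s(2)])
        also have "\<dots> = (\<Oplus>\<^bsub>L\<^esub>t\<in>T. s (x i) \<otimes>\<^bsub>L\<^esub> \<phi> t (y i \<otimes>\<^bsub>L\<^esub> z))"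
          unfolding trace_def using x y z scl by (intro L.finsum_rdistr) (auto simp: T_carrier)
        also have "\<dots> = (\<Oplus>\<^bsub>L\<^esub>t\<in>T. (s (x i) \<otimes>\<^bsub>L\<^esub> \<phi> t (y i)) \<otimes>\<^bsub>L\<^esub> \<phi> t z)"
          using x y z scl by (intro L.finsum_cong') (auto simp: T_carrier phi_mult_ring L.m_assoc)
        finally show "s (x i \<otimes>\<^bsub>L\<^esub> trace (y i \<otimes>\<^bsub>L\<^esub> z)) = (\<Oplus>\<^bsub>L\<^esub>t\<in>T. (s (x i) \<otimes>\<^bsub>L\<^esub> \<phi> t (y i)) \<otimes>\<^bsub>L\<^esub> \<phi> t z)" .
      qed (use x y z scl in \<open>auto intro!: L.finsum_closed simp: T_carrier\<close>)
      also have "\<dots> = (\<Oplus>\<^bsub>L\<^esub>t\<in>T. \<Oplus>\<^bsub>L\<^esub>i\<in>{..<n}. (s (x i) \<otimes>\<^bsub>L\<^esub> \<phi> t (y i)) \<otimes>\<^bsub>L\<^esub> \<phi> t z)"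
        using x y z scl by (intro L.finsum_swap) (auto simp: T_carrier)
      also have "\<dots> = (\<Oplus>\<^bsub>L\<^esub>t\<in>T. c t \<otimes>\<^bsub>L\<^esub> \<phi> t z)"
      proof (rule L.finsum_cong')
        fix t assume "t \<in> T"
        then show "(\<Oplus>\<^bsub>L\<^esub>i\<in>{..<n}. (s (x i) \<otimes>\<^bsub>L\<^esub> \<phi> t (y i)) \<otimes>\<^bsub>L\<^esub> \<phi> t z) = c t \<otimes>\<^bsub>L\<^esub> \<phi> t z"
          unfolding c_def using x y z scl by (intro L.finsum_ldistr[symmetric]) (auto simp: T_carrier)
      qed (use c z in \<open>auto simp: T_carrier\<close>)
      finally show ?thesis .
    qed
    have "\<one>\<^bsub>L\<^esub> = (\<Oplus>\<^bsub>L\<^esub>i\<in>{..<m}. a i \<otimes>\<^bsub>L\<^esub> s (b i))" using one by simp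
    also have "\<dots> = (\<Oplus>\<^bsub>L\<^esub>i\<in>{..<m}. \<Oplus>\<^bsub>L\<^esub>t\<in>T. c t \<otimes>\<^bsub>L\<^esub> (a i \<otimes>\<^bsub>L\<^esub> \<phi> t (b i)))"
    proof (rule L.finsum_cong')
      fix i
      have "a i \<otimes>\<^bsub>L\<^esub> s (b i) = (\<Oplus>\<^bsub>L\<^esub>t\<in>T. a i \<otimes>\<^bsub>L\<^esub> (c t \<otimes>\<^bsub>L\<^esub> \<phi> t (b i)))"
        unfolding sz[OF ab(2)] using ab c by (intro L.finsum_rdistr) (auto simp: T_carrier)
      also have "\<dots> = (\<Oplus>\<^bsub>L\<^esub>t\<in>T. c t \<otimes>\<^bsub>L\<^esub> (a i \<otimes>\<^bsub>L\<^esub> \<phi> t (b i)))"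
        using ab c by (intro L.finsum_cong') (auto simp: T_carrier L.m_lcomm)
      finally show "a i \<otimes>\<^bsub>L\<^esub> s (b i) = (\<Oplus>\<^bsub>L\<^esub>t\<in>T. c t \<otimes>\<^bsub>L\<^esub> (a i \<otimes>\<^bsub>L\<^esub> \<phi> t (b i)))" .
    qed (use ab c in \<open>auto intro!: L.finsum_closed simp: T_carrier\<close>)
    also have "\<dots> = (\<Oplus>\<^bsub>L\<^esub>t\<in>T. \<Oplus>\<^bsub>L\<^esub>i\<in>{..<m}. c t \<otimes>\<^bsub>L\<^esub> (a i \<otimes>\<^bsub>L\<^esub> \<phi> t (b i)))"
      using ab c by (intro L.finsum_swap) (auto simp: T_carrier)
    also have "\<dots> = (\<Oplus>\<^bsub>L\<^esub>t\<in>T. \<zero>\<^bsub>L\<^esub>)"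
    proof (rule L.finsum_cong')
      fix t assume t: "t \<in> T"
      have "(\<Oplus>\<^bsub>L\<^esub>i\<in>{..<m}. c t \<otimes>\<^bsub>L\<^esub> (a i \<otimes>\<^bsub>L\<^esub> \<phi> t (b i))) = c t \<otimes>\<^bsub>L\<^esub> (\<Oplus>\<^bsub>L\<^esub>i\<in>{..<m}. a i \<otimes>\<^bsub>L\<^esub> \<phi> t (b i))"
        using ab c[OF t] t by (intro L.finsum_rdistr[symmetric]) (auto simp: T_carrier)
      then show "(\<Oplus>\<^bsub>L\<^esub>i\<in>{..<m}. c t \<otimes>\<^bsub>L\<^esub> (a i \<otimes>\<^bsub>L\<^esub> \<phi> t (b i))) = \<zero>\<^bsub>L\<^esub>"
        using 0[OF t] c[OF t] by simp
    qed auto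
    finally show False using L.one_not_zero by simp
  qed
qed

section \<open>The skew group ring\<close>

abbreviation "A \<equiv> skew_group_ring L G \<phi>"
abbreviation "B \<equiv> subgroup_ring L G \<phi> H"
abbreviation "smon \<equiv> skew_monom L G"

lemma A_simps [simp]:
  "carrier A = carrier G \<rightarrow>\<^sub>E carrier L"
  "\<one>\<^bsub>A\<^esub> = smon \<one>\<^bsub>L\<^esub> \<one>\<^bsub>G\<^esub>"
  "\<zero>\<^bsub>A\<^esub> = (\<lambda>x\<in>carrier G. \<zero>\<^bsub>L\<^esub>)"
  "a \<oplus>\<^bsub>A\<^esub> b = (\<lambda>x\<in>carrier G. a x \<oplus>\<^bsub>L\<^esub> b x)"
  by (simp_all add: skew_group_ring_def skew_monom_def)

lemma A_mult: "x \<in> carrier G \<Longrightarrow> (a \<otimes>\<^bsub>A\<^esub> b) x = (\<Oplus>\<^bsub>L\<^esub>g\<in>carrier G. a g \<otimes>\<^bsub>L\<^esub> \<phi> g (b (inv\<^bsub>G\<^esub> g \<otimes>\<^bsub>G\<^esub> x)))"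
  "a \<otimes>\<^bsub>A\<^esub> b \<in> extensional (carrier G)"
  by (simp_all add: skew_group_ring_def)

lemma A_mem: "\<lbrakk>a \<in> carrier A; x \<in> carrier G\<rbrakk> \<Longrightarrow> a x \<in> carrier L"
  by auto

lemma A_mult_closed: "\<lbrakk>a \<in> carrier A; b \<in> carrier A\<rbrakk> \<Longrightarrow> a \<otimes>\<^bsub>A\<^esub> b \<in> carrier A"
  using A_mult(2)[of a b] A_mem[of a] A_mem[of b]
  by (auto simp: PiE_def Pi_def A_mult(1) intro!: L.finsum_closed)

text \<open>In the associativity law both sides are double sums over \<open>G\<close>; the
  substitution g = u v matches them, with \<phi> u multiplicative on l and \<phi> (u v) the
  composite of \<phi> u and \<phi> v.\<close>

lemma A_ring: "ring A"
proof (rule ringI)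
  show "abelian_group A"
  proof (rule abelian_groupI)
    fix a assume "a \<in> carrier A"
    then show "\<exists>b\<in>carrier A. b \<oplus>\<^bsub>A\<^esub> a = \<zero>\<^bsub>A\<^esub>"
      by (intro bexI[of _ "\<lambda>x\<in>carrier G. \<ominus>\<^bsub>L\<^esub> a x"]) (auto intro!: restrict_ext simp: PiE_iff L.l_neg)
  qed (auto intro!: restrict_ext extensionalityI[of _ "carrier G"] simp: PiE_iff L.a_ac)
  show "monoid A"
  proof (rule monoidI)
    fix a b c assume a: "a \<in> carrier A" and b: "b \<in> carrier A" and c: "c \<in> carrier A"
    note cl = A_mem[OF a] A_mem[OF b] A_mem[OF c]
    show "a \<otimes>\<^bsub>A\<^esub> b \<otimes>\<^bsub>A\<^esub> c = a \<otimes>\<^bsub>A\<^esub> (b \<otimes>\<^bsub>A\<^esub> c)"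
    proof (rule extensionalityI[OF A_mult(2) A_mult(2)])
      fix x assume x: "x \<in> carrier G"
      define f where "f = (\<lambda>u g. (a u \<otimes>\<^bsub>L\<^esub> \<phi> u (b (inv\<^bsub>G\<^esub> u \<otimes>\<^bsub>G\<^esub> g))) \<otimes>\<^bsub>L\<^esub> \<phi> g (c (inv\<^bsub>G\<^esub> g \<otimes>\<^bsub>G\<^esub> x)))"
      have fcl: "f u g \<in> carrier L" if "u \<in> carrier G" "g \<in> carrier G" for u g
        using that x cl by (simp add: f_def)
      have "(a \<otimes>\<^bsub>A\<^esub> b \<otimes>\<^bsub>A\<^esub> c) x = (\<Oplus>\<^bsub>L\<^esub>g\<in>carrier G. \<Oplus>\<^bsub>L\<^esub>u\<in>carrier G. f u g)"
        unfolding A_mult(1)[OF x]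
      proof (rule L.finsum_cong')
        fix g assume g: "g \<in> carrier G"
        show "(a \<otimes>\<^bsub>A\<^esub> b) g \<otimes>\<^bsub>L\<^esub> \<phi> g (c (inv\<^bsub>G\<^esub> g \<otimes>\<^bsub>G\<^esub> x)) = (\<Oplus>\<^bsub>L\<^esub>u\<in>carrier G. f u g)"
          unfolding A_mult(1)[OF g] f_def using x g cl fin by (intro L.finsum_ldistr) auto
      qed (use fcl in \<open>auto intro!: L.finsum_closed\<close>)
      also have "\<dots> = (\<Oplus>\<^bsub>L\<^esub>u\<in>carrier G. \<Oplus>\<^bsub>L\<^esub>g\<in>carrier G. f u g)"
        by (rule L.finsum_swap) (use fin fcl in auto)
      also have "\<dots> = (\<Oplus>\<^bsub>L\<^esub>u\<in>carrier G. a u \<otimes>\<^bsub>L\<^esub> \<phi> u ((b \<otimes>\<^bsub>A\<^esub> c) (inv\<^bsub>G\<^esub> u \<otimes>\<^bsub>G\<^esub> x)))"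
      proof (rule L.finsum_cong')
        fix u assume u: "u \<in> carrier G"
        have ux: "inv\<^bsub>G\<^esub> u \<otimes>\<^bsub>G\<^esub> x \<in> carrier G" using u x by simp
        let ?p = "\<lambda>v. b v \<otimes>\<^bsub>L\<^esub> \<phi> v (c (inv\<^bsub>G\<^esub> v \<otimes>\<^bsub>G\<^esub> (inv\<^bsub>G\<^esub> u \<otimes>\<^bsub>G\<^esub> x)))"
        have pcl: "?p v \<in> carrier L" if "v \<in> carrier G" for v using that u x cl by simp
        have inj: "inj_on (\<lambda>v. u \<otimes>\<^bsub>G\<^esub> v) (carrier G)" using u by (intro inj_onI) simp
        have im: "(\<lambda>v. u \<otimes>\<^bsub>G\<^esub> v) ` carrier G = carrier G"
          using G.surj_const_mult[OF u] .
        have "a u \<otimes>\<^bsub>L\<^esub> \<phi> u ((b \<otimes>\<^bsub>A\<^esub> c) (inv\<^bsub>G\<^esub> u \<otimes>\<^bsub>G\<^esub> x)) = a u \<otimes>\<^bsub>L\<^esub> (\<Oplus>\<^bsub>L\<^esub>v\<in>carrier G. \<phi> u (?p v))"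
          unfolding A_mult(1)[OF ux] using u fin pcl by (subst phi_finsum) auto
        also have "\<dots> = (\<Oplus>\<^bsub>L\<^esub>v\<in>carrier G. a u \<otimes>\<^bsub>L\<^esub> \<phi> u (?p v))"
          using u fin pcl cl by (intro L.finsum_rdistr) auto
        also have "\<dots> = (\<Oplus>\<^bsub>L\<^esub>v\<in>carrier G. f u (u \<otimes>\<^bsub>G\<^esub> v))"
        proof (rule L.finsum_cong')
          fix v assume v: "v \<in> carrier G"
          have "inv\<^bsub>G\<^esub> (u \<otimes>\<^bsub>G\<^esub> v) \<otimes>\<^bsub>G\<^esub> x = inv\<^bsub>G\<^esub> v \<otimes>\<^bsub>G\<^esub> (inv\<^bsub>G\<^esub> u \<otimes>\<^bsub>G\<^esub> x)"
            using u v x by (simp add: G.inv_mult_group G.m_assoc)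
          moreover have "inv\<^bsub>G\<^esub> u \<otimes>\<^bsub>G\<^esub> (u \<otimes>\<^bsub>G\<^esub> v) = v" using u v by (simp flip: G.m_assoc)
          ultimately show "a u \<otimes>\<^bsub>L\<^esub> \<phi> u (?p v) = f u (u \<otimes>\<^bsub>G\<^esub> v)"
            using u v x cl by (simp add: f_def phi_mult_ring phi_comp L.m_assoc)
        qed (use fcl u in auto)
        also have "\<dots> = (\<Oplus>\<^bsub>L\<^esub>g\<in>(\<lambda>v. u \<otimes>\<^bsub>G\<^esub> v) ` carrier G. f u g)"
          using fcl u inj by (intro L.finsum_reindex[symmetric]) auto
        finally show "(\<Oplus>\<^bsub>L\<^esub>g\<in>carrier G. f u g) = a u \<otimes>\<^bsub>L\<^esub> \<phi> u ((b \<otimes>\<^bsub>A\<^esub> c) (inv\<^bsub>G\<^esub> u \<otimes>\<^bsub>G\<^esub> x))"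
          unfolding im by simp
      qed (use x cl A_mem[OF A_mult_closed[OF b c]] in auto)
      finally show "(a \<otimes>\<^bsub>A\<^esub> b \<otimes>\<^bsub>A\<^esub> c) x = (a \<otimes>\<^bsub>A\<^esub> (b \<otimes>\<^bsub>A\<^esub> c)) x"
        unfolding A_mult(1)[OF x, of a "b \<otimes>\<^bsub>A\<^esub> c"] .
    qed
  next
    fix a assume a: "a \<in> carrier A"
    note cl = A_mem[OF a]
    show "\<one>\<^bsub>A\<^esub> \<otimes>\<^bsub>A\<^esub> a = a"
    proof (rule extensionalityI[OF A_mult(2)])
      show "a \<in> extensional (carrier G)" using a by (simp add: PiE_def)
      fix x assume x: "x \<in> carrier G"
      have "(\<one>\<^bsub>A\<^esub> \<otimes>\<^bsub>A\<^esub> a) x = (\<Oplus>\<^bsub>L\<^esub>g\<in>carrier G. if \<one>\<^bsub>G\<^esub> = g then a x else \<zero>\<^bsub>L\<^esub>)"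
        unfolding A_mult(1)[OF x] using x cl by (intro L.finsum_cong') (auto simp: skew_monom_def)
      also have "\<dots> = a x" using x cl fin by (intro L.finsum_singleton) auto
      finally show "(\<one>\<^bsub>A\<^esub> \<otimes>\<^bsub>A\<^esub> a) x = a x" .
    qed
    show "a \<otimes>\<^bsub>A\<^esub> \<one>\<^bsub>A\<^esub> = a"
    proof (rule extensionalityI[OF A_mult(2)])
      show "a \<in> extensional (carrier G)" using a by (simp add: PiE_def)
      fix x assume x: "x \<in> carrier G"
      have eq: "inv\<^bsub>G\<^esub> g \<otimes>\<^bsub>G\<^esub> x = \<one>\<^bsub>G\<^esub> \<longleftrightarrow> x = g" if "g \<in> carrier G" for g
        using x that by (metis G.inv_solve_left G.r_one G.one_closed)
      have "(a \<otimes>\<^bsub>A\<^esub> \<one>\<^bsub>A\<^esub>) x = (\<Oplus>\<^bsub>L\<^esub>g\<in>carrier G. if x = g then a g else \<zero>\<^bsub>L\<^esub>)"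
        unfolding A_mult(1)[OF x] using x cl by (intro L.finsum_cong') (auto simp: skew_monom_def eq)
      also have "\<dots> = a x" using x cl fin by (intro L.finsum_singleton) auto
      finally show "(a \<otimes>\<^bsub>A\<^esub> \<one>\<^bsub>A\<^esub>) x = a x" .
    qed
  qed (use A_mult_closed in \<open>auto simp: skew_monom_def\<close>)
  fix a b c assume a: "a \<in> carrier A" and b: "b \<in> carrier A" and c: "c \<in> carrier A"
  note cl = A_mem[OF a] A_mem[OF b] A_mem[OF c]
  show "(a \<oplus>\<^bsub>A\<^esub> b) \<otimes>\<^bsub>A\<^esub> c = a \<otimes>\<^bsub>A\<^esub> c \<oplus>\<^bsub>A\<^esub> b \<otimes>\<^bsub>A\<^esub> c"
  proof (rule extensionalityI[OF A_mult(2)])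
    fix x assume x: "x \<in> carrier G"
    have "((a \<oplus>\<^bsub>A\<^esub> b) \<otimes>\<^bsub>A\<^esub> c) x = (\<Oplus>\<^bsub>L\<^esub>g\<in>carrier G. a g \<otimes>\<^bsub>L\<^esub> \<phi> g (c (inv\<^bsub>G\<^esub> g \<otimes>\<^bsub>G\<^esub> x)) \<oplus>\<^bsub>L\<^esub> b g \<otimes>\<^bsub>L\<^esub> \<phi> g (c (inv\<^bsub>G\<^esub> g \<otimes>\<^bsub>G\<^esub> x)))"
      unfolding A_mult(1)[OF x] using x cl by (intro L.finsum_cong') (auto simp: L.l_distr)
    also have "\<dots> = (a \<otimes>\<^bsub>A\<^esub> c \<oplus>\<^bsub>A\<^esub> b \<otimes>\<^bsub>A\<^esub> c) x"
      using x cl by (subst L.finsum_addf) (auto simp: A_mult(1))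
    finally show "((a \<oplus>\<^bsub>A\<^esub> b) \<otimes>\<^bsub>A\<^esub> c) x = (a \<otimes>\<^bsub>A\<^esub> c \<oplus>\<^bsub>A\<^esub> b \<otimes>\<^bsub>A\<^esub> c) x" .
  qed simp
  show "c \<otimes>\<^bsub>A\<^esub> (a \<oplus>\<^bsub>A\<^esub> b) = c \<otimes>\<^bsub>A\<^esub> a \<oplus>\<^bsub>A\<^esub> c \<otimes>\<^bsub>A\<^esub> b"
  proof (rule extensionalityI[OF A_mult(2)])
    fix x assume x: "x \<in> carrier G"
    have "(c \<otimes>\<^bsub>A\<^esub> (a \<oplus>\<^bsub>A\<^esub> b)) x = (\<Oplus>\<^bsub>L\<^esub>g\<in>carrier G. c g \<otimes>\<^bsub>L\<^esub> \<phi> g (a (inv\<^bsub>G\<^esub> g \<otimes>\<^bsub>G\<^esub> x)) \<oplus>\<^bsub>L\<^esub> c g \<otimes>\<^bsub>L\<^esub> \<phi> g (b (inv\<^bsub>G\<^esub> g \<otimes>\<^bsub>G\<^esub> x)))"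
      unfolding A_mult(1)[OF x] using x cl by (intro L.finsum_cong') (auto simp: L.r_distr phi_add)
    also have "\<dots> = (c \<otimes>\<^bsub>A\<^esub> a \<oplus>\<^bsub>A\<^esub> c \<otimes>\<^bsub>A\<^esub> b) x"
      using x cl by (subst L.finsum_addf) (auto simp: A_mult(1))
    finally show "(c \<otimes>\<^bsub>A\<^esub> (a \<oplus>\<^bsub>A\<^esub> b)) x = (c \<otimes>\<^bsub>A\<^esub> a \<oplus>\<^bsub>A\<^esub> c \<otimes>\<^bsub>A\<^esub> b) x" .
  qed simp
qed

end

section \<open>Twists by group elements\<close>

text \<open>Lets a measure found for one ring and module serve another that has fewer submodules, in
  particular a measure over l serve \<open>A\<close> and \<open>B\<close>.\<close>

lemma finite_length_mono:
  assumes "finite_length S M'" "\<And>N. submodule N R M \<Longrightarrow> submodule N S M'"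
  shows "finite_length R M"
  using assms unfolding finite_length_def by (metis (no_types, opaque_lifting))

section \<open>Monomials and the subring \<open>B\<close>\<close>

context galois_action
begin

declare A_simps [simp del]

sublocale AR: ring A by (rule A_ring)

lemma A_eqI: "\<lbrakk>a \<in> carrier A; b \<in> carrier A; \<And>x. x \<in> carrier G \<Longrightarrow> a x = b x\<rbrakk> \<Longrightarrow> a = b"
  by (rule extensionalityI[of _ "carrier G"]) (auto simp: A_simps PiE_def)

lemma A_zero_apply: "x \<in> carrier G \<Longrightarrow> \<zero>\<^bsub>A\<^esub> x = \<zero>\<^bsub>L\<^esub>"
  and A_add_apply: "x \<in> carrier G \<Longrightarrow> (a \<oplus>\<^bsub>A\<^esub> b) x = a x \<oplus>\<^bsub>L\<^esub> b x"
  by (simp_all add: A_simps)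

lemma smon_closed [simp]: "c \<in> carrier L \<Longrightarrow> smon c g \<in> carrier A"
  by (simp add: A_simps skew_monom_def)

lemma smon_apply: "x \<in> carrier G \<Longrightarrow> smon c g x = (if x = g then c else \<zero>\<^bsub>L\<^esub>)"
  by (simp add: skew_monom_def)

lemma smon_add: "\<lbrakk>c \<in> carrier L; d \<in> carrier L\<rbrakk> \<Longrightarrow> smon c g \<oplus>\<^bsub>A\<^esub> smon d g = smon (c \<oplus>\<^bsub>L\<^esub> d) g"
  by (rule A_eqI) (auto simp: smon_apply A_add_apply)

lemma smon_zero: "smon \<zero>\<^bsub>L\<^esub> g = \<zero>\<^bsub>A\<^esub>"
  by (rule A_eqI) (auto simp: smon_apply A_zero_apply)

lemma smon_one: "smon \<one>\<^bsub>L\<^esub> \<one>\<^bsub>G\<^esub> = \<one>\<^bsub>A\<^esub>"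
  by (simp add: A_simps)

lemma smon_mult: "\<lbrakk>g \<in> carrier G; h \<in> carrier G; c \<in> carrier L; d \<in> carrier L\<rbrakk> \<Longrightarrow>
    smon c g \<otimes>\<^bsub>A\<^esub> smon d h = smon (c \<otimes>\<^bsub>L\<^esub> \<phi> g d) (g \<otimes>\<^bsub>G\<^esub> h)"
  by (rule skew_monom_mult[OF L.field_axioms G.is_group fin hom])

text \<open>Induction on the finite support; the set \<open>S\<close> is a parameter so that the
  choice \<open>carrier G\<close> yields induction over \<open>A\<close> and the choice
  \<open>H\<close> induction over \<open>B\<close>.\<close>

lemma support_induct [consumes 3, case_names zero add monom]:
  assumes "a \<in> carrier A" "S \<subseteq> carrier G" "\<forall>x\<in>carrier G - S. a x = \<zero>\<^bsub>L\<^esub>"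
    and "P \<zero>\<^bsub>A\<^esub>" "\<And>a b. \<lbrakk>a \<in> carrier A; b \<in> carrier A; P a; P b\<rbrakk> \<Longrightarrow> P (a \<oplus>\<^bsub>A\<^esub> b)"
    and mono: "\<And>c g. \<lbrakk>c \<in> carrier L; g \<in> S\<rbrakk> \<Longrightarrow> P (smon c g)"
  shows "P a"
proof -
  have "P a" if "finite F" "F \<subseteq> S" "a \<in> carrier A" "\<forall>x\<in>carrier G - F. a x = \<zero>\<^bsub>L\<^esub>" for F a
    using that
  proof (induction F arbitrary: a rule: finite_induct)
    case empty
    then have "a = \<zero>\<^bsub>A\<^esub>" by (intro A_eqI) (auto simp: A_zero_apply)
    then show ?case using assms(4) by simp
  next
    case (insert g F)
    have g: "g \<in> carrier G" "g \<in> S" using insert.prems assms(2) by auto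
    have ag: "a g \<in> carrier L" using A_mem[OF insert.prems(2) g(1)] .
    define a' where "a' = (\<lambda>x\<in>carrier G. if x = g then \<zero>\<^bsub>L\<^esub> else a x)"
    have a': "a' \<in> carrier A" using A_mem[OF insert.prems(2)] by (auto simp: a'_def A_simps)
    have eq: "a = smon (a g) g \<oplus>\<^bsub>A\<^esub> a'"
      using A_mem[OF insert.prems(2)] a' ag insert.prems(2)
      by (intro A_eqI) (auto simp: smon_apply A_add_apply a'_def)
    have "P a'"
      by (rule insert.IH[OF _ a']) (use insert.prems in \<open>auto simp: a'_def\<close>)
    then have "P (smon (a g) g \<oplus>\<^bsub>A\<^esub> a')"
      using assms(5)[OF smon_closed[OF ag] a'] mono[OF ag g(2)] by blast
    then show ?case using eq by metis
  qed
  then show ?thesis using assms(1-3) finite_subset[OF assms(2) fin] by blast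
qed

lemma A_induct [consumes 1, case_names zero add monom]:
  assumes "a \<in> carrier A" "P \<zero>\<^bsub>A\<^esub>" "\<And>a b. \<lbrakk>a \<in> carrier A; b \<in> carrier A; P a; P b\<rbrakk> \<Longrightarrow> P (a \<oplus>\<^bsub>A\<^esub> b)"
    and "\<And>c g. \<lbrakk>c \<in> carrier L; g \<in> carrier G\<rbrakk> \<Longrightarrow> P (smon c g)"
  shows "P a"
  by (rule support_induct[of a "carrier G"]) (use assms in auto)

lemma H_carrier: "h \<in> H \<Longrightarrow> h \<in> carrier G" by (simp add: H_iff)

lemma H_act: "\<lbrakk>h \<in> H; x \<in> carrier L\<rbrakk> \<Longrightarrow> \<phi> h x = x" by (simp add: H_iff)

lemma H_one: "\<one>\<^bsub>G\<^esub> \<in> H" by (simp add: H_iff)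

lemma H_mult: "\<lbrakk>g \<in> H; h \<in> H\<rbrakk> \<Longrightarrow> g \<otimes>\<^bsub>G\<^esub> h \<in> H" by (simp add: H_iff phi_comp)

lemma H_inv: "h \<in> H \<Longrightarrow> inv\<^bsub>G\<^esub> h \<in> H"
  unfolding H_iff using phi_inv(2)[of h] by auto

lemma H_conj: "\<lbrakk>g \<in> carrier G; h \<in> H\<rbrakk> \<Longrightarrow> inv\<^bsub>G\<^esub> g \<otimes>\<^bsub>G\<^esub> h \<otimes>\<^bsub>G\<^esub> g \<in> H"
  by (simp add: H_iff phi_comp)

lemma B_simps [simp]:
  "\<zero>\<^bsub>B\<^esub> = \<zero>\<^bsub>A\<^esub>" "\<one>\<^bsub>B\<^esub> = \<one>\<^bsub>A\<^esub>" "a \<oplus>\<^bsub>B\<^esub> b = a \<oplus>\<^bsub>A\<^esub> b" "a \<otimes>\<^bsub>B\<^esub> b = a \<otimes>\<^bsub>A\<^esub> b"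
  by (simp_all add: subgroup_ring_def)

lemma B_iff: "a \<in> carrier B \<longleftrightarrow> a \<in> carrier A \<and> (\<forall>x\<in>carrier G - H. a x = \<zero>\<^bsub>L\<^esub>)"
  by (simp add: subgroup_ring_def)

lemma B_subset: "carrier B \<subseteq> carrier A" by (auto simp: B_iff)

lemma B_A: "b \<in> carrier B \<Longrightarrow> b \<in> carrier A" by (simp add: B_iff)

lemma smon_B: "\<lbrakk>c \<in> carrier L; h \<in> H\<rbrakk> \<Longrightarrow> smon c h \<in> carrier B"
  by (auto simp: B_iff smon_apply)

lemma B_subring: "subring (carrier B) A"
proof (rule AR.subringI)
  show "\<one>\<^bsub>A\<^esub> \<in> carrier B" using smon_B[OF L.one_closed H_one] by (simp add: smon_one)
  fix a assume a: "a \<in> carrier B"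
  have "(\<ominus>\<^bsub>A\<^esub> a) x = \<zero>\<^bsub>L\<^esub>" if x: "x \<in> carrier G - H" for x
  proof -
    have "(a \<oplus>\<^bsub>A\<^esub> \<ominus>\<^bsub>A\<^esub> a) x = \<zero>\<^bsub>L\<^esub>" using a x by (simp add: AR.r_neg B_A A_zero_apply)
    then show ?thesis using a x A_mem[OF AR.a_inv_closed[OF B_A[OF a]]] by (simp add: A_add_apply B_iff)
  qed
  then show "\<ominus>\<^bsub>A\<^esub> a \<in> carrier B" using a by (simp add: B_iff)
  fix b assume b: "b \<in> carrier B"
  show "a \<oplus>\<^bsub>A\<^esub> b \<in> carrier B" using a b by (simp add: B_iff A_add_apply)
  have "(a \<otimes>\<^bsub>A\<^esub> b) x = \<zero>\<^bsub>L\<^esub>" if x: "x \<in> carrier G - H" for x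
  proof -
    have "a g \<otimes>\<^bsub>L\<^esub> \<phi> g (b (inv\<^bsub>G\<^esub> g \<otimes>\<^bsub>G\<^esub> x)) = \<zero>\<^bsub>L\<^esub>" if g: "g \<in> carrier G" for g
    proof (cases "g \<in> H")
      case True
      have "inv\<^bsub>G\<^esub> g \<otimes>\<^bsub>G\<^esub> x \<notin> H"
      proof
        assume "inv\<^bsub>G\<^esub> g \<otimes>\<^bsub>G\<^esub> x \<in> H"
        then have "g \<otimes>\<^bsub>G\<^esub> (inv\<^bsub>G\<^esub> g \<otimes>\<^bsub>G\<^esub> x) \<in> H" by (rule H_mult[OF True])
        then show False using x g by (simp add: G.m_assoc[symmetric])
      qed
      then show ?thesis using b g x A_mem[OF B_A[OF a] g] by (simp add: B_iff)
    next
      case False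
      then show ?thesis using a b g x A_mem[OF B_A[OF b], of "inv\<^bsub>G\<^esub> g \<otimes>\<^bsub>G\<^esub> x"] by (simp add: B_iff)
    qed
    note zero = this
    have xG: "x \<in> carrier G" using x by simp
    have "(a \<otimes>\<^bsub>A\<^esub> b) x = (\<Oplus>\<^bsub>L\<^esub>g\<in>carrier G. \<zero>\<^bsub>L\<^esub>)"
      unfolding A_mult(1)[OF xG] by (rule L.finsum_cong') (simp_all add: zero)
    then show ?thesis by simp
  qed
  then show "a \<otimes>\<^bsub>A\<^esub> b \<in> carrier B" using a b by (simp add: B_iff)
qed (auto simp: B_iff)

lemma B_ring: "ring B"
  using AR.subring_is_ring[OF B_subring] by (simp add: subgroup_ring_def)

lemmas B_mult_closed = subringE(6)[OF B_subring]
  and B_add_closed = subringE(7)[OF B_subring]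

lemma B_induct [consumes 1, case_names zero add monom]:
  assumes "b \<in> carrier B" "P \<zero>\<^bsub>A\<^esub>" "\<And>a b. \<lbrakk>a \<in> carrier B; b \<in> carrier B; P a; P b\<rbrakk> \<Longrightarrow> P (a \<oplus>\<^bsub>A\<^esub> b)"
    and "\<And>c h. \<lbrakk>c \<in> carrier L; h \<in> H\<rbrakk> \<Longrightarrow> P (smon c h)"
  shows "P b"
proof -
  \<comment> \<open>Membership in \<open>B\<close> is carried along, since the addition step of
    \<open>P\<close> is assumed only within \<open>B\<close>.\<close>
  have "b \<in> carrier B \<and> P b"
    by (rule support_induct[of b H])
      (use assms B_add_closed smon_B subringE(2)[OF B_subring] in \<open>auto simp: B_iff H_carrier\<close>)
  then show ?thesis ..
qed

lemma A_module_B: assumes "left_module A M" shows "left_module B M"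
proof -
  interpret M: left_module A M by (rule assms)
  show ?thesis
    by (intro left_module.intro left_module_axioms.intro B_ring M.M.abelian_group_axioms)
      (auto simp: B_A M.smult_l_distr M.smult_r_distr M.smult_assoc1)
qed

lemma hom_A_B: "f \<in> left_module_hom A M N \<Longrightarrow> f \<in> left_module_hom B M N"
  by (auto simp: left_module_hom_def B_A)

lemma iso_A_B: "left_module_iso A M N \<Longrightarrow> left_module_iso B M N"
  using hom_A_B unfolding left_module_iso_def by blast

lemma submodule_A_B: "submodule N A M \<Longrightarrow> submodule N B M"
  by (simp add: submodule_def submodule_axioms_def B_A)

section \<open>Conjugation and twisted modules\<close>

abbreviation "e g \<equiv> smon \<one>\<^bsub>L\<^esub> g"

lemma e_mult: "\<lbrakk>g \<in> carrier G; h \<in> carrier G\<rbrakk> \<Longrightarrow> e g \<otimes>\<^bsub>A\<^esub> e h = e (g \<otimes>\<^bsub>G\<^esub> h)"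
  by (simp add: smon_mult)

lemma smon_eq: "\<lbrakk>c \<in> carrier L; g \<in> carrier G\<rbrakk> \<Longrightarrow> smon c g = smon c \<one>\<^bsub>G\<^esub> \<otimes>\<^bsub>A\<^esub> e g"
  by (simp add: smon_mult)

lemma e_scalar: "\<lbrakk>c \<in> carrier L; g \<in> carrier G\<rbrakk> \<Longrightarrow> e g \<otimes>\<^bsub>A\<^esub> smon c \<one>\<^bsub>G\<^esub> = smon (\<phi> g c) \<one>\<^bsub>G\<^esub> \<otimes>\<^bsub>A\<^esub> e g"
  by (simp add: smon_mult)

lemma e_inv: "g \<in> carrier G \<Longrightarrow> e g \<otimes>\<^bsub>A\<^esub> e (inv\<^bsub>G\<^esub> g) = \<one>\<^bsub>A\<^esub>" "g \<in> carrier G \<Longrightarrow> e (inv\<^bsub>G\<^esub> g) \<otimes>\<^bsub>A\<^esub> e g = \<one>\<^bsub>A\<^esub>"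
  by (simp_all add: e_mult smon_one)

text \<open>Left multiplication by \<open>b\<close> passes through \<open>e g\<close> as
  \<open>conj g b\<close>, which is how \<open>b\<close> acts on g \<otimes> w. The inverse stands
  on the left, so that twisting by \<open>h\<close> and then by \<open>g\<close> is twisting by the
  product g h.\<close>

definition conj where "conj g b = e (inv\<^bsub>G\<^esub> g) \<otimes>\<^bsub>A\<^esub> b \<otimes>\<^bsub>A\<^esub> e g"

lemma conj_add: "\<lbrakk>a \<in> carrier A; b \<in> carrier A\<rbrakk> \<Longrightarrow> conj g (a \<oplus>\<^bsub>A\<^esub> b) = conj g a \<oplus>\<^bsub>A\<^esub> conj g b"
  by (simp add: conj_def AR.l_distr AR.r_distr)

lemma e_conj: "\<lbrakk>g \<in> carrier G; a \<in> carrier A\<rbrakk> \<Longrightarrow> e g \<otimes>\<^bsub>A\<^esub> conj g a = a \<otimes>\<^bsub>A\<^esub> e g"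
  by (simp add: conj_def AR.m_assoc[symmetric] e_inv)

lemma conj_mult: "\<lbrakk>g \<in> carrier G; a \<in> carrier A; b \<in> carrier A\<rbrakk> \<Longrightarrow> conj g (a \<otimes>\<^bsub>A\<^esub> b) = conj g a \<otimes>\<^bsub>A\<^esub> conj g b"
proof -
  assume *: "g \<in> carrier G" "a \<in> carrier A" "b \<in> carrier A"
  have "conj g a \<otimes>\<^bsub>A\<^esub> conj g b = e (inv\<^bsub>G\<^esub> g) \<otimes>\<^bsub>A\<^esub> a \<otimes>\<^bsub>A\<^esub> (e g \<otimes>\<^bsub>A\<^esub> conj g b)"
    using * by (simp add: conj_def AR.m_assoc)
  also have "\<dots> = conj g (a \<otimes>\<^bsub>A\<^esub> b)"
    using * by (simp add: e_conj) (simp add: conj_def AR.m_assoc)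
  finally show ?thesis by simp
qed

lemma conj_one: "g \<in> carrier G \<Longrightarrow> conj g \<one>\<^bsub>A\<^esub> = \<one>\<^bsub>A\<^esub>"
  by (simp add: conj_def e_inv)

lemma conj_smon: "\<lbrakk>g \<in> carrier G; h \<in> carrier G; c \<in> carrier L\<rbrakk> \<Longrightarrow>
    conj g (smon c h) = smon (\<phi> (inv\<^bsub>G\<^esub> g) c) (inv\<^bsub>G\<^esub> g \<otimes>\<^bsub>G\<^esub> h \<otimes>\<^bsub>G\<^esub> g)"
  by (simp add: conj_def smon_mult)

lemma conj_B:
  assumes g: "g \<in> carrier G" and b: "b \<in> carrier B"
  shows "conj g b \<in> carrier B"
  using b
proof (induction b rule: B_induct)
  case zero
  then show ?case using subringE(2)[OF B_subring] by (simp add: conj_def)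
next
  case (add a b)
  then show ?case using B_add_closed by (simp add: conj_add B_A)
next
  case (monom c h)
  then show ?case using g by (simp add: conj_smon H_carrier smon_B H_conj)
qed

lemma conj_conj: "\<lbrakk>g \<in> carrier G; h \<in> carrier G; a \<in> carrier A\<rbrakk> \<Longrightarrow> conj h (conj g a) = conj (g \<otimes>\<^bsub>G\<^esub> h) a"
proof -
  assume *: "g \<in> carrier G" "h \<in> carrier G" "a \<in> carrier A"
  have "conj h (conj g a) = (e (inv\<^bsub>G\<^esub> h) \<otimes>\<^bsub>A\<^esub> e (inv\<^bsub>G\<^esub> g)) \<otimes>\<^bsub>A\<^esub> a \<otimes>\<^bsub>A\<^esub> (e g \<otimes>\<^bsub>A\<^esub> e h)"
    using * by (simp add: conj_def AR.m_assoc del: e_mult)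
  then show ?thesis using * by (simp add: e_mult conj_def G.inv_mult_group)
qed

lemma conj_inv: "\<lbrakk>g \<in> carrier G; a \<in> carrier A\<rbrakk> \<Longrightarrow> conj g (conj (inv\<^bsub>G\<^esub> g) a) = a"
  by (simp add: conj_conj) (simp add: conj_def smon_one)

text \<open>The twist of \<open>W\<close> by \<open>g\<close>: a model of \<open>gW\<close> on the carrier of \<open>W\<close> itself.\<close>

definition twist where "twist g W = W\<lparr>module.smult := \<lambda>b w. conj g b \<odot>\<^bsub>W\<^esub> w\<rparr>"

lemma twist_simps [simp]:
  "carrier (twist g W) = carrier W" "\<zero>\<^bsub>twist g W\<^esub> = \<zero>\<^bsub>W\<^esub>"
  "x \<oplus>\<^bsub>twist g W\<^esub> y = x \<oplus>\<^bsub>W\<^esub> y" "b \<odot>\<^bsub>twist g W\<^esub> x = conj g b \<odot>\<^bsub>W\<^esub> x"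
  by (simp_all add: twist_def)

lemma twist_left_module:
  assumes g: "g \<in> carrier G" and W: "left_module B W"
  shows "left_module B (twist g W)"
proof -
  interpret W: left_module B W by (rule W)
  have "abelian_group (twist g W)"
  proof (rule abelian_groupI)
    fix x assume "x \<in> carrier (twist g W)"
    then show "\<exists>y\<in>carrier (twist g W). y \<oplus>\<^bsub>twist g W\<^esub> x = \<zero>\<^bsub>twist g W\<^esub>"
      by (intro bexI[of _ "\<ominus>\<^bsub>W\<^esub> x"]) (auto simp: W.M.l_neg)
  qed (auto simp: W.M.a_ac)
  then show ?thesis
    using g W.smult_l_distr W.smult_assoc1 W.smult_one
    by (intro left_module.intro left_module_axioms.intro B_ring)
      (simp_all add: conj_B W.smult_r_distr conj_add conj_mult conj_one B_A)
qed

lemma twist_hom: "\<lbrakk>g \<in> carrier G; f \<in> left_module_hom B M N\<rbrakk> \<Longrightarrow> f \<in> left_module_hom B (twist g M) (twist g N)"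
  by (auto simp: left_module_hom_def hom_def conj_B)

lemma twist_iso: "\<lbrakk>g \<in> carrier G; left_module_iso B M N\<rbrakk> \<Longrightarrow> left_module_iso B (twist g M) (twist g N)"
  using twist_hom unfolding left_module_iso_def by fastforce

lemma twist_direct_sum: "twist g (direct_sum I S) = direct_sum I (\<lambda>i. twist g (S i))"
  by (simp add: twist_def direct_sum_def)

text \<open>Realised by the identity map. The records themselves need not coincide, since the two
  actions are compared only on scalars from the ring.\<close>

lemma twist_twist:
  "\<lbrakk>g \<in> carrier G; h \<in> carrier G\<rbrakk> \<Longrightarrow> left_module_iso B (twist g (twist h W)) (twist (g \<otimes>\<^bsub>G\<^esub> h) W)"
  by (rule left_module_isoI[of "\<lambda>x. x" _ _ _ "\<lambda>x. x"])
    (auto intro!: left_module_homI simp: conj_conj B_A)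

text \<open>For \<open>h\<close> in \<open>H\<close> the conjugation is inner in \<open>B\<close>,
  so the action of the inverse of \<open>e h\<close> intertwines the two structures.\<close>

lemma twist_H:
  assumes h: "h \<in> H" and W: "left_module B W"
  shows "left_module_iso B W (twist h W)"
proof -
  interpret W: left_module B W by (rule W)
  have hG: "h \<in> carrier G" using h by (rule H_carrier)
  have eB: "e h \<in> carrier B" "e (inv\<^bsub>G\<^esub> h) \<in> carrier B" using h by (simp_all add: smon_B H_inv)
  have ei: "e h \<otimes>\<^bsub>A\<^esub> e (inv\<^bsub>G\<^esub> h) = \<one>\<^bsub>A\<^esub>" "e (inv\<^bsub>G\<^esub> h) \<otimes>\<^bsub>A\<^esub> e h = \<one>\<^bsub>A\<^esub>" using hG by (rule e_inv)+
  note as = W.smult_assoc1[simplified] and W1 = W.smult_one[simplified]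
  show ?thesis
  proof (rule left_module_isoI)
    show "(\<lambda>w. e (inv\<^bsub>G\<^esub> h) \<odot>\<^bsub>W\<^esub> w) \<in> left_module_hom B W (twist h W)"
    proof (rule left_module_homI)
      fix b w assume b: "b \<in> carrier B" and w: "w \<in> carrier W"
      have "conj h b \<otimes>\<^bsub>A\<^esub> e (inv\<^bsub>G\<^esub> h) = e (inv\<^bsub>G\<^esub> h) \<otimes>\<^bsub>A\<^esub> b"
        using hG b by (simp add: conj_def AR.m_assoc e_inv B_A)
      then show "e (inv\<^bsub>G\<^esub> h) \<odot>\<^bsub>W\<^esub> (b \<odot>\<^bsub>W\<^esub> w) = b \<odot>\<^bsub>twist h W\<^esub> (e (inv\<^bsub>G\<^esub> h) \<odot>\<^bsub>W\<^esub> w)"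
        using eB b w conj_B[OF hG b] by (simp flip: as)
    qed (use eB in \<open>auto simp: W.smult_r_distr\<close>)
    show "(\<lambda>w. e h \<odot>\<^bsub>W\<^esub> w) \<in> left_module_hom B (twist h W) W"
    proof (rule left_module_homI)
      fix b w assume b: "b \<in> carrier B" and w: "w \<in> carrier (twist h W)"
      show "e h \<odot>\<^bsub>W\<^esub> (b \<odot>\<^bsub>twist h W\<^esub> w) = b \<odot>\<^bsub>W\<^esub> (e h \<odot>\<^bsub>W\<^esub> w)"
        using eB b w conj_B[OF hG b] hG by (simp add: e_conj B_A flip: as)
    qed (use eB in \<open>auto simp: W.smult_r_distr\<close>)
  qed (use eB in \<open>simp_all add: ei W1 flip: as\<close>)
qed

text \<open>\<open>h\<close> differs from \<open>g\<close> by a right factor in \<open>H\<close>,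
  which twists trivially; up to isomorphism the twist thus depends only on the automorphism induced
  by \<open>g\<close>.\<close>

lemma twist_cong:
  assumes g: "g \<in> carrier G" "h \<in> carrier G" "\<phi> g = \<phi> h" and W: "left_module B W"
  shows "left_module_iso B (twist g W) (twist h W)"
proof -
  let ?k = "inv\<^bsub>G\<^esub> g \<otimes>\<^bsub>G\<^esub> h"
  have k: "?k \<in> H" using g by (simp add: H_mem)
  have "g \<otimes>\<^bsub>G\<^esub> ?k = h" using g by (simp flip: G.m_assoc)
  then show ?thesis
    using left_module_iso_trans[OF twist_iso[OF g(1) twist_H[OF k W]] twist_twist[OF g(1) H_carrier[OF k]]] by simp
qed

lemma twist_one: "left_module B W \<Longrightarrow> left_module_iso B W (twist \<one>\<^bsub>G\<^esub> W)"
  by (rule twist_H[OF H_one])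

lemma twist_inv:
  assumes g: "g \<in> carrier G" and W: "left_module B W"
  shows "left_module_iso B (twist (inv\<^bsub>G\<^esub> g) (twist g W)) W" "left_module_iso B (twist g (twist (inv\<^bsub>G\<^esub> g) W)) W"
proof -
  note one = left_module_iso_sym[OF W twist_left_module[OF G.one_closed W] twist_one[OF W]]
  note gi = G.inv_closed[OF g]
  have "left_module_iso B (twist (inv\<^bsub>G\<^esub> g) (twist g W)) (twist \<one>\<^bsub>G\<^esub> W)"
    using twist_twist[OF gi g, of W] by (simp only: G.l_inv[OF g])
  then show "left_module_iso B (twist (inv\<^bsub>G\<^esub> g) (twist g W)) W"
    by (rule left_module_iso_trans[OF _ one])
  have "left_module_iso B (twist g (twist (inv\<^bsub>G\<^esub> g) W)) (twist \<one>\<^bsub>G\<^esub> W)"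
    using twist_twist[OF g gi, of W] by (simp only: G.r_inv[OF g])
  then show "left_module_iso B (twist g (twist (inv\<^bsub>G\<^esub> g) W)) W"
    by (rule left_module_iso_trans[OF _ one])
qed

text \<open>Conjugation by \<open>g\<close> is bijective on \<open>B\<close>, so the twisted module
  has the same submodules.\<close>

lemma twist_simple:
  assumes g: "g \<in> carrier G" and W: "simple_left_module B W"
  shows "simple_left_module B (twist g W)"
  unfolding simple_left_module_def
proof (intro conjI allI impI)
  show "left_module B (twist g W)" by (rule twist_left_module[OF g simple_left_moduleD(1)[OF W]])
  show "carrier (twist g W) \<noteq> {\<zero>\<^bsub>twist g W\<^esub>}" using W by (simp add: simple_left_module_def)
  interpret W: left_module B W by (rule simple_left_moduleD(1)[OF W])
  fix N assume N: "submodule N B (twist g W)"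
  interpret N: submodule N B "twist g W" by (rule N)
  have "submodule N B W"
  proof (rule W.submoduleI)
    fix b x assume b: "b \<in> carrier B" and x: "x \<in> N"
    have "conj (inv\<^bsub>G\<^esub> g) b \<odot>\<^bsub>twist g W\<^esub> x \<in> N" by (rule N.smult_closed[OF conj_B[OF G.inv_closed[OF g] b] x])
    then show "b \<odot>\<^bsub>W\<^esub> x \<in> N" using g b by (simp add: conj_inv B_A)
  qed (use N.subset N.one_closed N.m_closed in auto)
  then show "N = {\<zero>\<^bsub>twist g W\<^esub>} \<or> N = carrier (twist g W)"
    using simple_left_moduleD(3)[OF W] by simp
qed

text \<open>The action of \<open>e g\<close>, available on an \<open>A\<close>-module, is the
  intertwiner. Restrictions are therefore invariant under all twists, which later equalises the
  multiplicities of conjugate simple modules.\<close>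

lemma twist_restriction:
  assumes M: "left_module A M" and g: "g \<in> carrier G"
  shows "left_module_iso B (twist g M) M"
proof -
  interpret M: left_module A M by (rule M)
  have gi: "inv\<^bsub>G\<^esub> g \<in> carrier G" using g by simp
  have eA: "e h \<in> carrier A" for h by simp
  show ?thesis
  proof (rule left_module_isoI)
    show "(\<lambda>x. e g \<odot>\<^bsub>M\<^esub> x) \<in> left_module_hom B (twist g M) M"
      using g conj_B[OF g]
      by (intro left_module_homI) (simp_all add: M.smult_r_distr e_conj B_A flip: M.smult_assoc1)
    show "(\<lambda>x. e (inv\<^bsub>G\<^esub> g) \<odot>\<^bsub>M\<^esub> x) \<in> left_module_hom B M (twist g M)"
    proof (rule left_module_homI)
      fix b x assume b: "b \<in> carrier B" and x: "x \<in> carrier M"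
      have "e (inv\<^bsub>G\<^esub> g) \<otimes>\<^bsub>A\<^esub> b = conj g b \<otimes>\<^bsub>A\<^esub> e (inv\<^bsub>G\<^esub> g)"
        using g b by (simp add: conj_def AR.m_assoc e_inv B_A)
      then show "e (inv\<^bsub>G\<^esub> g) \<odot>\<^bsub>M\<^esub> (b \<odot>\<^bsub>M\<^esub> x) = b \<odot>\<^bsub>twist g M\<^esub> (e (inv\<^bsub>G\<^esub> g) \<odot>\<^bsub>M\<^esub> x)"
        using b x conj_B[OF g b] by (simp add: B_A flip: M.smult_assoc1)
    qed (simp_all add: M.smult_r_distr)
  qed (use g in \<open>simp_all add: e_inv flip: M.smult_assoc1\<close>)
qed

end

section \<open>Galois descent for module homomorphisms\<close>

lemma add_hom_finsum:
  assumes M: "abelian_group M" and N: "abelian_group N" and f: "f \<in> hom (add_monoid M) (add_monoid N)"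
    and I: "finite I" "x \<in> I \<rightarrow> carrier M"
  shows "f (finsum M x I) = (\<Oplus>\<^bsub>N\<^esub>i\<in>I. f (x i))"
proof -
  interpret M: abelian_group M by (rule M)
  interpret N: abelian_group N by (rule N)
  interpret group_hom "add_monoid M" "add_monoid N" f
    using f by (simp add: group_hom_def group_hom_axioms_def M.a_group N.a_group)
  have cl: "f y \<in> carrier N" if "y \<in> carrier M" for y using hom_closed[of y] that by simp
  have ad: "f (y \<oplus>\<^bsub>M\<^esub> z) = f y \<oplus>\<^bsub>N\<^esub> f z" if "y \<in> carrier M" "z \<in> carrier M" for y z
    using hom_mult[of y z] that by simp
  have zero: "f \<zero>\<^bsub>M\<^esub> = \<zero>\<^bsub>N\<^esub>" using hom_one by simp
  show ?thesis
    using I by (induction I rule: finite_induct) (simp_all add: Pi_def cl ad zero)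
qed

lemma lmh_finsum:
  assumes N: "left_module R N" and I: "finite I" and f: "\<And>i. i \<in> I \<Longrightarrow> f i \<in> left_module_hom R M N"
  shows "(\<lambda>x. \<Oplus>\<^bsub>N\<^esub>i\<in>I. f i x) \<in> left_module_hom R M N"
proof -
  interpret N: left_module R N by (rule N)
  note cl = lmh_closed[OF f]
  show ?thesis
  proof (rule left_module_homI)
    fix x y assume x: "x \<in> carrier M" and y: "y \<in> carrier M"
    have "(\<Oplus>\<^bsub>N\<^esub>i\<in>I. f i (x \<oplus>\<^bsub>M\<^esub> y)) = (\<Oplus>\<^bsub>N\<^esub>i\<in>I. f i x \<oplus>\<^bsub>N\<^esub> f i y)"
      using x y by (intro N.M.finsum_cong') (auto simp: cl lmh_add[OF f])
    then show "(\<Oplus>\<^bsub>N\<^esub>i\<in>I. f i (x \<oplus>\<^bsub>M\<^esub> y)) = (\<Oplus>\<^bsub>N\<^esub>i\<in>I. f i x) \<oplus>\<^bsub>N\<^esub> (\<Oplus>\<^bsub>N\<^esub>i\<in>I. f i y)"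
      using x y by (simp add: N.M.finsum_addf cl Pi_def)
  next
    fix a x assume a: "a \<in> carrier R" and x: "x \<in> carrier M"
    have "(\<Oplus>\<^bsub>N\<^esub>i\<in>I. f i (a \<odot>\<^bsub>M\<^esub> x)) = (\<Oplus>\<^bsub>N\<^esub>i\<in>I. a \<odot>\<^bsub>N\<^esub> f i x)"
      using a x by (intro N.M.finsum_cong') (auto simp: cl lmh_smult[OF f])
    then show "(\<Oplus>\<^bsub>N\<^esub>i\<in>I. f i (a \<odot>\<^bsub>M\<^esub> x)) = a \<odot>\<^bsub>N\<^esub> (\<Oplus>\<^bsub>N\<^esub>i\<in>I. f i x)"
      using a x I by (simp add: N.finsum_smult cl Pi_def)
  qed (use cl in \<open>auto intro!: N.M.finsum_closed\<close>)
qed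

context galois_action
begin

section \<open>Dimension over l and finite length\<close>

definition over_L :: "('g \<Rightarrow> 'l, 'm, 'x) module_scheme \<Rightarrow> ('l, 'm) module" where
  "over_L M = \<lparr>carrier = carrier M, monoid.mult = monoid.mult M, one = one M, ring.zero = ring.zero M,
     ring.add = ring.add M, module.smult = (\<lambda>c x. smon c \<one>\<^bsub>G\<^esub> \<odot>\<^bsub>M\<^esub> x)\<rparr>"

lemma over_L_simps [simp]:
  "carrier (over_L M) = carrier M" "\<zero>\<^bsub>over_L M\<^esub> = \<zero>\<^bsub>M\<^esub>"
  "x \<oplus>\<^bsub>over_L M\<^esub> y = x \<oplus>\<^bsub>M\<^esub> y" "c \<odot>\<^bsub>over_L M\<^esub> x = smon c \<one>\<^bsub>G\<^esub> \<odot>\<^bsub>M\<^esub> x"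
  by (simp_all add: over_L_def)

lemma scalar_module:
  assumes M: "left_module A M"
  shows "left_module L (over_L M)" (is "left_module L ?M")
proof -
  interpret M: left_module A M by (rule M)
  have "abelian_group ?M"
  proof (rule abelian_groupI)
    fix x assume "x \<in> carrier ?M"
    then show "\<exists>y\<in>carrier ?M. y \<oplus>\<^bsub>?M\<^esub> x = \<zero>\<^bsub>?M\<^esub>"
      by (intro bexI[of _ "\<ominus>\<^bsub>M\<^esub> x"]) (auto simp: M.M.l_neg)
  qed (auto simp: M.M.a_ac)
  then show ?thesis
    by (intro left_module.intro left_module_axioms.intro L.ring_axioms)
      (simp_all add: M.smult_r_distr smon_one smon_mult flip: M.smult_l_distr M.smult_assoc1 smon_add)
qed

lemma submodule_scalar:
  assumes M: "left_module A M" and "submodule N B M"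
  shows "submodule N L (over_L M)"
proof -
  interpret M: left_module A M by (rule M)
  interpret OL: left_module L "over_L M" by (rule scalar_module[OF M])
  interpret N: submodule N B M by (rule assms(2))
  show ?thesis
    using N.subset N.one_closed N.m_closed N.smult_closed smon_B[OF _ H_one] by (intro OL.submoduleI) auto
qed

text \<open>As an l-space \<open>A\<close> is spanned by the \<open>e g\<close>, so a cyclic module
  is spanned by their products with the generator. Submodules over \<open>A\<close> or
  \<open>B\<close> are l-subspaces of this finite-dimensional space.\<close>

lemma finite_length_cyclic:
  assumes M: "left_module A M" and v: "v \<in> carrier M" and gen: "carrier M = (\<lambda>a. a \<odot>\<^bsub>M\<^esub> v) ` carrier A"
  shows "finite_length B M" "finite_length A M"
proof -
  interpret M: left_module A M by (rule M)
  let ?M = "over_L M"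
  interpret OL: left_module L ?M by (rule scalar_module[OF M])
  define n where "n = card (carrier G)"
  obtain \<gamma> where \<gamma>: "bij_betw \<gamma> {..<n} (carrier G)"
    using ex_bij_betw_nat_finite[OF fin] by (auto simp: n_def atLeast0LessThan)
  have \<gamma>G: "\<gamma> i \<in> carrier G" if "i < n" for i using \<gamma> that by (auto simp: bij_betw_def)
  let ?m = "\<lambda>i. e (\<gamma> i) \<odot>\<^bsub>M\<^esub> v"
  have m: "?m i \<in> carrier ?M" if "i < n" for i using v by simp
  have sc: "c \<odot>\<^bsub>?M\<^esub> x \<in> carrier ?M" if "c \<in> carrier L" "x \<in> carrier M" for c x
    using OL.smult_closed[of c x] that by simp
  have span: "\<exists>c. (\<forall>i<n. c i \<in> carrier L) \<and> a \<odot>\<^bsub>M\<^esub> v = (\<Oplus>\<^bsub>?M\<^esub>i\<in>{..<n}. c i \<odot>\<^bsub>?M\<^esub> ?m i)"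
    if "a \<in> carrier A" for a
    using that
  proof (induction a rule: A_induct)
    case zero
    have "(\<Oplus>\<^bsub>?M\<^esub>i\<in>{..<n}. \<zero>\<^bsub>L\<^esub> \<odot>\<^bsub>?M\<^esub> ?m i) = (\<Oplus>\<^bsub>?M\<^esub>i\<in>{..<n}. \<zero>\<^bsub>?M\<^esub>)"
      using m by (intro OL.M.finsum_cong') (simp_all add: smon_zero)
    also have "\<dots> = \<zero>\<^bsub>A\<^esub> \<odot>\<^bsub>M\<^esub> v" unfolding OL.M.finsum_zero using v by simp
    finally show ?case by (intro exI[of _ "\<lambda>_. \<zero>\<^bsub>L\<^esub>"]) simp
  next
    case (add a b)
    then obtain c d where c: "\<forall>i<n. c i \<in> carrier L" "a \<odot>\<^bsub>M\<^esub> v = (\<Oplus>\<^bsub>?M\<^esub>i\<in>{..<n}. c i \<odot>\<^bsub>?M\<^esub> ?m i)"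
      and d: "\<forall>i<n. d i \<in> carrier L" "b \<odot>\<^bsub>M\<^esub> v = (\<Oplus>\<^bsub>?M\<^esub>i\<in>{..<n}. d i \<odot>\<^bsub>?M\<^esub> ?m i)" by blast
    have "(\<Oplus>\<^bsub>?M\<^esub>i\<in>{..<n}. (c i \<oplus>\<^bsub>L\<^esub> d i) \<odot>\<^bsub>?M\<^esub> ?m i) =
        (\<Oplus>\<^bsub>?M\<^esub>i\<in>{..<n}. c i \<odot>\<^bsub>?M\<^esub> ?m i \<oplus>\<^bsub>?M\<^esub> d i \<odot>\<^bsub>?M\<^esub> ?m i)"
      using c d m by (intro OL.M.finsum_cong') (auto simp: M.smult_l_distr simp flip: smon_add)
    also have "\<dots> = a \<odot>\<^bsub>M\<^esub> v \<oplus>\<^bsub>?M\<^esub> b \<odot>\<^bsub>M\<^esub> v"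
      unfolding c(2) d(2) using c d m by (intro OL.M.finsum_addf) (auto intro!: OL.smult_closed)
    also have "\<dots> = (a \<oplus>\<^bsub>A\<^esub> b) \<odot>\<^bsub>M\<^esub> v" using add v by (simp add: M.smult_l_distr)
    finally show ?case using c d by (intro exI[of _ "\<lambda>i. c i \<oplus>\<^bsub>L\<^esub> d i"]) simp
  next
    case (monom c g)
    then have "g \<in> \<gamma> ` {..<n}" using \<gamma> by (simp add: bij_betw_def)
    then obtain i0 where i0: "i0 < n" "\<gamma> i0 = g" by blast
    have "(\<Oplus>\<^bsub>?M\<^esub>i\<in>{..<n}. (if i0 = i then c else \<zero>\<^bsub>L\<^esub>) \<odot>\<^bsub>?M\<^esub> ?m i) =
        (\<Oplus>\<^bsub>?M\<^esub>i\<in>{..<n}. if i0 = i then c \<odot>\<^bsub>?M\<^esub> ?m i else \<zero>\<^bsub>?M\<^esub>)"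
      using monom m by (intro OL.M.finsum_cong') (auto simp: smon_zero)
    also have "\<dots> = c \<odot>\<^bsub>?M\<^esub> ?m i0"
      using i0 m monom by (intro OL.M.finsum_singleton) (auto intro!: OL.smult_closed)
    also have "\<dots> = smon c g \<odot>\<^bsub>M\<^esub> v"
      using i0 v monom by (simp add: smon_mult flip: M.smult_assoc1)
    finally show ?case using monom by (intro exI[of _ "\<lambda>i. if i0 = i then c else \<zero>\<^bsub>L\<^esub>"]) simp
  qed
  have "finite_length L ?M"
  proof (rule finite_length_field[OF L.field_axioms OL.left_module_axioms m])
    fix x assume "x \<in> carrier ?M"
    then obtain a where "a \<in> carrier A" "x = a \<odot>\<^bsub>M\<^esub> v" using gen by auto
    then show "\<exists>c. (\<forall>i<n. c i \<in> carrier L) \<and> x = (\<Oplus>\<^bsub>?M\<^esub>i\<in>{..<n}. c i \<odot>\<^bsub>?M\<^esub> ?m i)" using span by simp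
  qed
  note fl = finite_length_mono[OF this]
  show "finite_length B M" by (rule fl) (rule submodule_scalar[OF M])
  show "finite_length A M" by (rule fl) (rule submodule_scalar[OF M submodule_A_B])
qed

text \<open>\<open>B\<close> sits inside the cyclic \<open>A\<close>-module \<open>A\<close>, and
  submodules of \<open>B\<close> are \<open>B\<close>-submodules of \<open>A\<close>.\<close>

lemma finite_length_regular_B: "finite_length B (regular_module B)"
proof -
  interpret reg: left_module A "regular_module A" by (rule AR.regular_module_left_module)
  have gen: "carrier (regular_module A) = (\<lambda>a. a \<odot>\<^bsub>regular_module A\<^esub> \<one>\<^bsub>A\<^esub>) ` carrier A" by force
  have "finite_length B (regular_module A)"
    using finite_length_cyclic(1)[OF reg.left_module_axioms _ gen] by simp
  then show ?thesis
  proof (rule finite_length_mono)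
    fix N assume N: "submodule N B (regular_module B)"
    interpret N: submodule N B "regular_module B" by (rule N)
    interpret regB: left_module B "regular_module A" by (rule A_module_B[OF reg.left_module_axioms])
    show "submodule N B (regular_module A)"
    proof (rule regB.submoduleI)
      show "N \<subseteq> carrier (regular_module A)" using N.subset B_subset by auto
      show "\<zero>\<^bsub>regular_module A\<^esub> \<in> N" using N.one_closed by simp
    next
      fix x y assume "x \<in> N" "y \<in> N"
      then show "x \<oplus>\<^bsub>regular_module A\<^esub> y \<in> N" using N.m_closed[of x y] by simp
    next
      fix b x assume "b \<in> carrier B" "x \<in> N"
      then show "b \<odot>\<^bsub>regular_module A\<^esub> x \<in> N" using N.smult_closed[of b x] by simp
    qed
  qed
qed

lemma finite_sim_B: "finite (sim B)"
  by (rule finite_sim[OF B_ring finite_length_regular_B])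

lemma simple_cyclic:
  assumes M: "simple_left_module A M"
  shows "\<exists>v\<in>carrier M. v \<noteq> \<zero>\<^bsub>M\<^esub> \<and> carrier M = (\<lambda>a. a \<odot>\<^bsub>M\<^esub> v) ` carrier A"
proof -
  interpret M: left_module A M by (rule simple_left_moduleD(1)[OF M])
  obtain v where v: "v \<in> carrier M" "v \<noteq> \<zero>\<^bsub>M\<^esub>" using simple_left_moduleD(2)[OF M] by blast
  have "(\<lambda>a. a \<odot>\<^bsub>M\<^esub> v) ` carrier (regular_module A) = carrier M"
    using v by (intro simple_target_surj[OF AR.regular_module_left_module M M.regular_module_hom, of v "\<one>\<^bsub>A\<^esub>"]) auto
  then show ?thesis using v by auto
qed

text \<open>The action of \<open>g\<close> on maps between two \<open>A\<close>-modules, composing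
  with \<open>g\<close> after and its inverse before. On \<open>B\<close>-linear maps it factors
  through \<open>G/H\<close>.\<close>

definition hom_conj where "hom_conj V M g k = (\<lambda>v. e g \<odot>\<^bsub>M\<^esub> k (e (inv\<^bsub>G\<^esub> g) \<odot>\<^bsub>V\<^esub> v))"

text \<open>\<open>H\<close> acts trivially on l, so scalars commute with the monomials of
  \<open>B\<close>. Hence the \<open>B\<close>-linear maps into an \<open>A\<close>-module form an
  l-space.\<close>

lemma scalar_central:
  assumes y: "y \<in> carrier L" and b: "b \<in> carrier B"
  shows "b \<otimes>\<^bsub>A\<^esub> smon y \<one>\<^bsub>G\<^esub> = smon y \<one>\<^bsub>G\<^esub> \<otimes>\<^bsub>A\<^esub> b"
  using b
proof (induction b rule: B_induct)
  case (monom c h)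
  then show ?case using y by (simp add: smon_mult H_carrier H_act L.m_comm)
qed (use y in \<open>simp_all add: AR.l_distr AR.r_distr B_A\<close>)

context
  fixes V :: "('g \<Rightarrow> 'l, 'v, 'x) module_scheme" and M :: "('g \<Rightarrow> 'l, 'm, 'y) module_scheme"
  assumes V: "left_module A V" and M: "left_module A M"
begin

interpretation V: left_module A V by (rule V)
interpretation M: left_module A M by (rule M)
interpretation VB: left_module B V by (rule A_module_B[OF V])
interpretation MB: left_module B M by (rule A_module_B[OF M])

lemma hom_conj_hom:
  assumes g: "g \<in> carrier G" and k: "k \<in> left_module_hom B V M"
  shows "hom_conj V M g k \<in> left_module_hom B V M"
proof (rule left_module_homI)
  fix b x assume b: "b \<in> carrier B" and x: "x \<in> carrier V"
  have 1: "e (inv\<^bsub>G\<^esub> g) \<otimes>\<^bsub>A\<^esub> b = conj g b \<otimes>\<^bsub>A\<^esub> e (inv\<^bsub>G\<^esub> g)"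
    using g b by (simp add: conj_def AR.m_assoc e_inv B_A)
  have "hom_conj V M g k (b \<odot>\<^bsub>V\<^esub> x) = e g \<odot>\<^bsub>M\<^esub> k (conj g b \<odot>\<^bsub>V\<^esub> (e (inv\<^bsub>G\<^esub> g) \<odot>\<^bsub>V\<^esub> x))"
    using b x conj_B[OF g b] by (simp add: hom_conj_def B_A 1 flip: V.smult_assoc1)
  also have "\<dots> = (e g \<otimes>\<^bsub>A\<^esub> conj g b) \<odot>\<^bsub>M\<^esub> k (e (inv\<^bsub>G\<^esub> g) \<odot>\<^bsub>V\<^esub> x)"
    using b x conj_B[OF g b] by (simp add: lmh_smult[OF k] lmh_closed[OF k] B_A M.smult_assoc1)
  also have "\<dots> = b \<odot>\<^bsub>M\<^esub> hom_conj V M g k x"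
    using g b x by (simp add: e_conj B_A hom_conj_def lmh_closed[OF k] M.smult_assoc1)
  finally show "hom_conj V M g k (b \<odot>\<^bsub>V\<^esub> x) = b \<odot>\<^bsub>M\<^esub> hom_conj V M g k x" .
qed (simp_all add: hom_conj_def lmh_closed[OF k] lmh_add[OF k] V.smult_r_distr M.smult_r_distr)

lemma hom_conj_comp:
  assumes g: "g \<in> carrier G" and h: "h \<in> carrier G" and k: "k \<in> left_module_hom B V M" and v: "v \<in> carrier V"
  shows "hom_conj V M g (hom_conj V M h k) v = hom_conj V M (g \<otimes>\<^bsub>G\<^esub> h) k v"
proof -
  have "hom_conj V M g (hom_conj V M h k) v =
      (e g \<otimes>\<^bsub>A\<^esub> e h) \<odot>\<^bsub>M\<^esub> k ((e (inv\<^bsub>G\<^esub> h) \<otimes>\<^bsub>A\<^esub> e (inv\<^bsub>G\<^esub> g)) \<odot>\<^bsub>V\<^esub> v)"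
    using v by (simp add: hom_conj_def V.smult_assoc1 M.smult_assoc1 lmh_closed[OF k])
  then show ?thesis using g h by (simp add: e_mult hom_conj_def G.inv_mult_group)
qed

lemma hom_conj_H:
  assumes h: "h \<in> H" and k: "k \<in> left_module_hom B V M" and v: "v \<in> carrier V"
  shows "hom_conj V M h k v = k v"
proof -
  have "e h \<in> carrier B" using h by (simp add: smon_B)
  then have "hom_conj V M h k v = k (e h \<odot>\<^bsub>V\<^esub> (e (inv\<^bsub>G\<^esub> h) \<odot>\<^bsub>V\<^esub> v))"
    using v by (simp add: hom_conj_def lmh_smult[OF k])
  then show ?thesis using v h by (simp add: e_inv H_carrier flip: V.smult_assoc1)
qed

lemma hom_conj_cong:
  assumes g: "g \<in> carrier G" "h \<in> carrier G" "\<phi> g = \<phi> h" and k: "k \<in> left_module_hom B V M" and v: "v \<in> carrier V"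
  shows "hom_conj V M g k v = hom_conj V M h k v"
proof -
  let ?k = "inv\<^bsub>G\<^esub> g \<otimes>\<^bsub>G\<^esub> h"
  have kH: "?k \<in> H" using g by (simp add: H_mem)
  have eq: "g \<otimes>\<^bsub>G\<^esub> ?k = h" using g by (simp flip: G.m_assoc)
  have "hom_conj V M h k v = hom_conj V M g (hom_conj V M ?k k) v"
    using hom_conj_comp[OF g(1) H_carrier[OF kH] k v] by (simp add: eq)
  also have "\<dots> = hom_conj V M g k v"
    using hom_conj_H[OF kH k, of "e (inv\<^bsub>G\<^esub> g) \<odot>\<^bsub>V\<^esub> v"] v
    by (subst hom_conj_def, subst (2) hom_conj_def) simp
  finally show ?thesis by simp
qed

text \<open>Moving \<open>e u\<close> through the sum replaces \<open>t\<close> by the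
  representative of the coset of u\<inverse> t, a permutation of \<open>T\<close>. Together with l,
  which lies in \<open>B\<close>, the \<open>e u\<close> generate \<open>A\<close>.\<close>

lemma hom_trace:
  assumes k: "k \<in> left_module_hom B V M"
  shows "(\<lambda>v. \<Oplus>\<^bsub>M\<^esub>t\<in>T. hom_conj V M t k v) \<in> left_module_hom A V M" (is "?F \<in> _")
proof -
  note hc = hom_conj_hom[OF _ k]
  note hcl = lmh_closed[OF hc]
  have F: "?F \<in> left_module_hom B V M"
    by (rule lmh_finsum[OF MB.left_module_axioms fin_T]) (rule hc[OF T_carrier])
  note Fcl = lmh_closed[OF F]
  have Fe: "?F (e u \<odot>\<^bsub>V\<^esub> v) = e u \<odot>\<^bsub>M\<^esub> ?F v" if u: "u \<in> carrier G" and v: "v \<in> carrier V" for u v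
  proof -
    have ui: "inv\<^bsub>G\<^esub> u \<in> carrier G" using u by simp
    have "?F (e u \<odot>\<^bsub>V\<^esub> v) = (\<Oplus>\<^bsub>M\<^esub>t\<in>T. e u \<odot>\<^bsub>M\<^esub> hom_conj V M (rep (inv\<^bsub>G\<^esub> u \<otimes>\<^bsub>G\<^esub> t)) k v)"
    proof (rule M.M.finsum_cong')
      fix t assume t: "t \<in> T"
      note tG = T_carrier[OF t]
      have ut: "inv\<^bsub>G\<^esub> u \<otimes>\<^bsub>G\<^esub> t \<in> carrier G" using ui tG by simp
      have eq: "u \<otimes>\<^bsub>G\<^esub> (inv\<^bsub>G\<^esub> u \<otimes>\<^bsub>G\<^esub> t) = t" using u tG by (simp flip: G.m_assoc)
      have "hom_conj V M t k (e u \<odot>\<^bsub>V\<^esub> v) = hom_conj V M u (hom_conj V M (inv\<^bsub>G\<^esub> u \<otimes>\<^bsub>G\<^esub> t) k) (e u \<odot>\<^bsub>V\<^esub> v)"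
        using hom_conj_comp[OF u ut k, of "e u \<odot>\<^bsub>V\<^esub> v"] v by (simp add: eq)
      also have "\<dots> = e u \<odot>\<^bsub>M\<^esub> hom_conj V M (inv\<^bsub>G\<^esub> u \<otimes>\<^bsub>G\<^esub> t) k v"
        using u v by (subst hom_conj_def) (simp add: e_inv flip: V.smult_assoc1)
      also have "\<dots> = e u \<odot>\<^bsub>M\<^esub> hom_conj V M (rep (inv\<^bsub>G\<^esub> u \<otimes>\<^bsub>G\<^esub> t)) k v"
        using hom_conj_cong[OF ut _ _ k v, of "rep (inv\<^bsub>G\<^esub> u \<otimes>\<^bsub>G\<^esub> t)"] rep[OF ut] by simp
      finally show "hom_conj V M t k (e u \<odot>\<^bsub>V\<^esub> v) = e u \<odot>\<^bsub>M\<^esub> hom_conj V M (rep (inv\<^bsub>G\<^esub> u \<otimes>\<^bsub>G\<^esub> t)) k v" .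
    qed (use v ui rep T_carrier in \<open>auto intro!: M.smult_closed hcl\<close>)
    also have "\<dots> = e u \<odot>\<^bsub>M\<^esub> (\<Oplus>\<^bsub>M\<^esub>t\<in>T. hom_conj V M (rep (inv\<^bsub>G\<^esub> u \<otimes>\<^bsub>G\<^esub> t)) k v)"
      using v ui rep T_carrier by (intro M.finsum_smult[symmetric]) (auto intro!: hcl)
    also have "(\<Oplus>\<^bsub>M\<^esub>t\<in>T. hom_conj V M (rep (inv\<^bsub>G\<^esub> u \<otimes>\<^bsub>G\<^esub> t)) k v)
        = (\<Oplus>\<^bsub>M\<^esub>t\<in>(\<lambda>t. rep (inv\<^bsub>G\<^esub> u \<otimes>\<^bsub>G\<^esub> t)) ` T. hom_conj V M t k v)"
      using T_shift[OF ui] v ui rep T_carrier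
      by (intro M.M.finsum_reindex[symmetric]) (auto intro!: hcl simp: bij_betw_def)
    finally show ?thesis using T_shift[OF ui] by (simp add: bij_betw_def)
  qed
  show ?thesis
  proof (rule left_module_homI)
    fix a v assume a: "a \<in> carrier A" and v: "v \<in> carrier V"
    show "?F (a \<odot>\<^bsub>V\<^esub> v) = a \<odot>\<^bsub>M\<^esub> ?F v"
      using a
    proof (induction a rule: A_induct)
      case zero
      have "?F (\<zero>\<^bsub>B\<^esub> \<odot>\<^bsub>V\<^esub> v) = \<zero>\<^bsub>B\<^esub> \<odot>\<^bsub>M\<^esub> ?F v"
        using lmh_smult[OF F, of "\<zero>\<^bsub>B\<^esub>" v] subringE(2)[OF B_subring] v by simp
      then show ?case by simp
    next
      case (add a b)
      then show ?case
        using v lmh_add[OF F, of "a \<odot>\<^bsub>V\<^esub> v" "b \<odot>\<^bsub>V\<^esub> v"] Fcl[OF v]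
        by (simp add: V.smult_l_distr M.smult_l_distr)
    next
      case (monom c g)
      have "?F (smon c g \<odot>\<^bsub>V\<^esub> v) = ?F (smon c \<one>\<^bsub>G\<^esub> \<odot>\<^bsub>V\<^esub> (e g \<odot>\<^bsub>V\<^esub> v))"
        using monom v by (subst smon_eq) (simp_all add: V.smult_assoc1)
      also have "\<dots> = smon c \<one>\<^bsub>G\<^esub> \<odot>\<^bsub>M\<^esub> ?F (e g \<odot>\<^bsub>V\<^esub> v)"
        using monom v by (intro lmh_smult[OF F]) (auto intro: smon_B[OF _ H_one])
      also have "\<dots> = (smon c \<one>\<^bsub>G\<^esub> \<otimes>\<^bsub>A\<^esub> e g) \<odot>\<^bsub>M\<^esub> ?F v"
        using monom v Fe Fcl[OF v] by (simp add: M.smult_assoc1)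
      also have "\<dots> = smon c g \<odot>\<^bsub>M\<^esub> ?F v" using monom smon_eq[of c g] by simp
      finally show ?case .
    qed
  qed (use lmh_closed[OF F] lmh_add[OF F] in auto)
qed

lemma scalar_sum:
  assumes "finite I" "w \<in> carrier M" "c \<in> I \<rightarrow> carrier L"
  shows "smon (finsum L c I) \<one>\<^bsub>G\<^esub> \<odot>\<^bsub>M\<^esub> w = (\<Oplus>\<^bsub>M\<^esub>i\<in>I. smon (c i) \<one>\<^bsub>G\<^esub> \<odot>\<^bsub>M\<^esub> w)"
  using assms
  by (induction I rule: finite_induct)
    (simp_all add: Pi_def smon_zero M.smult_l_distr flip: smon_add)

text \<open>Galois descent: \<open>Hom\<^sub>B(V, M)\<close> is a semilinear representation of \<open>Gal(l/k)\<close> with invariants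
  \<open>Hom\<^sub>A(V, M)\<close>, hence it is spanned over \<open>l\<close> by them.\<close>

theorem descent:
  assumes h: "h \<in> left_module_hom B V M"
  obtains n :: nat and x f where "\<And>i. x i \<in> carrier L" "\<And>i. f i \<in> left_module_hom A V M"
    "\<And>v. v \<in> carrier V \<Longrightarrow> h v = (\<Oplus>\<^bsub>M\<^esub>i\<in>{..<n}. smon (x i) \<one>\<^bsub>G\<^esub> \<odot>\<^bsub>M\<^esub> f i v)"
proof -
  obtain n :: nat and x y where x: "\<And>i. x i \<in> carrier L" and y: "\<And>i. y i \<in> carrier L"
    and xy: "\<And>g. g \<in> carrier G \<Longrightarrow> (\<Oplus>\<^bsub>L\<^esub>i\<in>{..<n}. x i \<otimes>\<^bsub>L\<^esub> \<phi> g (y i)) = (if g \<in> H then \<one>\<^bsub>L\<^esub> else \<zero>\<^bsub>L\<^esub>)"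
    by (rule galois_coordinates) (rule that)
  define k where "k = (\<lambda>i v. smon (y i) \<one>\<^bsub>G\<^esub> \<odot>\<^bsub>M\<^esub> h v)"
  have k: "k i \<in> left_module_hom B V M" for i
    unfolding k_def
  proof (rule left_module_homI)
    fix b v assume b: "b \<in> carrier B" and v: "v \<in> carrier V"
    show "smon (y i) \<one>\<^bsub>G\<^esub> \<odot>\<^bsub>M\<^esub> h (b \<odot>\<^bsub>V\<^esub> v) = b \<odot>\<^bsub>M\<^esub> (smon (y i) \<one>\<^bsub>G\<^esub> \<odot>\<^bsub>M\<^esub> h v)"
      using b v y lmh_closed[OF h v]
      by (simp add: lmh_smult[OF h] B_A scalar_central flip: M.smult_assoc1)
  qed (use y in \<open>simp_all add: lmh_closed[OF h] lmh_add[OF h] M.smult_r_distr\<close>)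
  define f where "f = (\<lambda>i v. \<Oplus>\<^bsub>M\<^esub>t\<in>T. hom_conj V M t (k i) v)"
  have f: "f i \<in> left_module_hom A V M" for i unfolding f_def by (rule hom_trace[OF k])
  have "h v = (\<Oplus>\<^bsub>M\<^esub>i\<in>{..<n}. smon (x i) \<one>\<^bsub>G\<^esub> \<odot>\<^bsub>M\<^esub> f i v)" if v: "v \<in> carrier V" for v
  proof -
    have hv: "hom_conj V M t h v \<in> carrier M" if "t \<in> T" for t
      by (rule lmh_closed[OF hom_conj_hom[OF T_carrier[OF that] h] v])
    \<comment> \<open>Semilinearity: conjugation by \<open>t\<close> turns the scalar
      \<open>y i\<close> into its image under \<phi> t.\<close>
    have hk: "hom_conj V M t (k i) v = smon (\<phi> t (y i)) \<one>\<^bsub>G\<^esub> \<odot>\<^bsub>M\<^esub> hom_conj V M t h v" if "t \<in> T" for t i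
      using T_carrier[OF that] v y
      by (simp add: hom_conj_def k_def lmh_closed[OF h] e_scalar flip: M.smult_assoc1)
    have "(\<Oplus>\<^bsub>M\<^esub>i\<in>{..<n}. smon (x i) \<one>\<^bsub>G\<^esub> \<odot>\<^bsub>M\<^esub> f i v)
        = (\<Oplus>\<^bsub>M\<^esub>i\<in>{..<n}. \<Oplus>\<^bsub>M\<^esub>t\<in>T. smon (x i \<otimes>\<^bsub>L\<^esub> \<phi> t (y i)) \<one>\<^bsub>G\<^esub> \<odot>\<^bsub>M\<^esub> hom_conj V M t h v)"
    proof (rule M.M.finsum_cong')
      fix i
      have "smon (x i) \<one>\<^bsub>G\<^esub> \<odot>\<^bsub>M\<^esub> f i v = (\<Oplus>\<^bsub>M\<^esub>t\<in>T. smon (x i) \<one>\<^bsub>G\<^esub> \<odot>\<^bsub>M\<^esub> hom_conj V M t (k i) v)"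
        unfolding f_def using x v lmh_closed[OF hom_conj_hom[OF T_carrier k] v]
        by (intro M.finsum_smult) auto
      also have "\<dots> = (\<Oplus>\<^bsub>M\<^esub>t\<in>T. smon (x i \<otimes>\<^bsub>L\<^esub> \<phi> t (y i)) \<one>\<^bsub>G\<^esub> \<odot>\<^bsub>M\<^esub> hom_conj V M t h v)"
      proof (rule M.M.finsum_cong')
        fix t assume t: "t \<in> T"
        have "smon (x i \<otimes>\<^bsub>L\<^esub> \<phi> t (y i)) \<one>\<^bsub>G\<^esub> = smon (x i) \<one>\<^bsub>G\<^esub> \<otimes>\<^bsub>A\<^esub> smon (\<phi> t (y i)) \<one>\<^bsub>G\<^esub>"
          using x y T_carrier[OF t] by (simp add: smon_mult)
        then show "smon (x i) \<one>\<^bsub>G\<^esub> \<odot>\<^bsub>M\<^esub> hom_conj V M t (k i) v = smon (x i \<otimes>\<^bsub>L\<^esub> \<phi> t (y i)) \<one>\<^bsub>G\<^esub> \<odot>\<^bsub>M\<^esub> hom_conj V M t h v"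
          using hk[OF t] hv[OF t] x y T_carrier[OF t] by (simp add: M.smult_assoc1)
      qed (use hv x y T_carrier in auto)
      finally show "smon (x i) \<one>\<^bsub>G\<^esub> \<odot>\<^bsub>M\<^esub> f i v = (\<Oplus>\<^bsub>M\<^esub>t\<in>T. smon (x i \<otimes>\<^bsub>L\<^esub> \<phi> t (y i)) \<one>\<^bsub>G\<^esub> \<odot>\<^bsub>M\<^esub> hom_conj V M t h v)" .
    qed (use hv x y T_carrier in \<open>auto intro!: M.M.finsum_closed M.smult_closed\<close>)
    also have "\<dots> = (\<Oplus>\<^bsub>M\<^esub>t\<in>T. \<Oplus>\<^bsub>M\<^esub>i\<in>{..<n}. smon (x i \<otimes>\<^bsub>L\<^esub> \<phi> t (y i)) \<one>\<^bsub>G\<^esub> \<odot>\<^bsub>M\<^esub> hom_conj V M t h v)"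
      using hv x y T_carrier by (intro M.M.finsum_swap) auto
    \<comment> \<open>The coordinates annihilate every coset but the trivial one, on which
      conjugation leaves \<open>h\<close> unchanged.\<close>
    also have "\<dots> = (\<Oplus>\<^bsub>M\<^esub>t\<in>T. if rep \<one>\<^bsub>G\<^esub> = t then hom_conj V M t h v else \<zero>\<^bsub>M\<^esub>)"
    proof (rule M.M.finsum_cong')
      fix t assume t: "t \<in> T"
      have "(\<Oplus>\<^bsub>M\<^esub>i\<in>{..<n}. smon (x i \<otimes>\<^bsub>L\<^esub> \<phi> t (y i)) \<one>\<^bsub>G\<^esub> \<odot>\<^bsub>M\<^esub> hom_conj V M t h v)
          = smon (\<Oplus>\<^bsub>L\<^esub>i\<in>{..<n}. x i \<otimes>\<^bsub>L\<^esub> \<phi> t (y i)) \<one>\<^bsub>G\<^esub> \<odot>\<^bsub>M\<^esub> hom_conj V M t h v"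
        using hv[OF t] x y T_carrier[OF t] by (intro scalar_sum[symmetric]) auto
      then show "(\<Oplus>\<^bsub>M\<^esub>i\<in>{..<n}. smon (x i \<otimes>\<^bsub>L\<^esub> \<phi> t (y i)) \<one>\<^bsub>G\<^esub> \<odot>\<^bsub>M\<^esub> hom_conj V M t h v)
          = (if rep \<one>\<^bsub>G\<^esub> = t then hom_conj V M t h v else \<zero>\<^bsub>M\<^esub>)"
        using hv[OF t] xy[OF T_carrier[OF t]] T_H[OF t] by (simp add: smon_zero smon_one)
    qed (use hv in auto)
    also have "\<dots> = hom_conj V M (rep \<one>\<^bsub>G\<^esub>) h v"
      using hv by (intro M.M.finsum_singleton rep_in_T) auto
    also have "\<dots> = h v"
      using hom_conj_H[OF _ h v] T_H[OF rep_in_T[OF G.one_closed]] by simp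
    finally show ?thesis by simp
  qed
  then show thesis using that x f by blast
qed

text \<open>If all \<open>f i\<close> vanished at \<open>v\<close>, so would
  \<open>h v\<close>.\<close>

corollary nonzero_hom_descent:
  assumes "nonzero_hom B V M"
  shows "nonzero_hom A V M"
proof -
  obtain h v where h: "h \<in> left_module_hom B V M" and v: "v \<in> carrier V" "h v \<noteq> \<zero>\<^bsub>M\<^esub>"
    using assms by (auto simp: nonzero_hom_def)
  obtain n :: nat and x f where x: "\<And>i. x i \<in> carrier L" and f: "\<And>i. f i \<in> left_module_hom A V M"
    and hv: "\<And>v. v \<in> carrier V \<Longrightarrow> h v = (\<Oplus>\<^bsub>M\<^esub>i\<in>{..<n}. smon (x i) \<one>\<^bsub>G\<^esub> \<odot>\<^bsub>M\<^esub> f i v)"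
    by (rule descent[OF h]) (rule that)
  have "\<exists>i. f i v \<noteq> \<zero>\<^bsub>M\<^esub>"
  proof (rule ccontr)
    assume "\<nexists>i. f i v \<noteq> \<zero>\<^bsub>M\<^esub>"
    then have "h v = (\<Oplus>\<^bsub>M\<^esub>i\<in>{..<n}. \<zero>\<^bsub>M\<^esub>)" using hv[OF v(1)] x by simp
    then show False using v(2) by simp
  qed
  then show ?thesis using f v(1) nonzero_homI by metis
qed

end

end

section \<open>Restriction and induction\<close>

lemma nonzero_hom_direct_sum:
  assumes "nonzero_hom R M (direct_sum J S)"
  shows "\<exists>j\<in>J. nonzero_hom R M (S j)"
proof -
  obtain f x where f: "f \<in> left_module_hom R M (direct_sum J S)" and x: "x \<in> carrier M" "f x \<noteq> \<zero>\<^bsub>direct_sum J S\<^esub>"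
    using assms by (auto simp: nonzero_hom_def)
  have "f x \<in> extensional J" using lmh_closed[OF f x(1)] by (simp add: PiE_def)
  then have "\<exists>j\<in>J. f x j \<noteq> \<zero>\<^bsub>S j\<^esub>"
    using x(2) extensionalityI[of "f x" J "\<zero>\<^bsub>direct_sum J S\<^esub>"] by auto
  then obtain j where j: "j \<in> J" "f x j \<noteq> \<zero>\<^bsub>S j\<^esub>" by blast
  have "(\<lambda>x. f x j) \<in> left_module_hom R M (S j)"
    by (rule lmh_comp[OF f direct_sum_proj_hom[where M = S, OF j(1)]])
  then show ?thesis using j x(1) by (intro bexI[of _ j] nonzero_homI)
qed

lemma nonzero_hom_iso_right:
  assumes "left_module R M" "left_module R N" "left_module R P"
    and iso: "left_module_iso R N P" and "nonzero_hom R M N"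
  shows "nonzero_hom R M P"
proof -
  obtain g where "g \<in> left_module_hom R N P" "bij_betw g (carrier N) (carrier P)"
    using iso by (auto simp: left_module_iso_def)
  then show ?thesis using nonzero_hom_comp_inj[OF assms(1-3,5)] by (simp add: bij_betw_def)
qed

context galois_action
begin

lemma tensor_product_AB: "left_module B W \<Longrightarrow> tensor_product A B W"
  by (simp add: tensor_product_def tensor_product_axioms_def B_subset AR.ring_axioms)

abbreviation "pure W \<equiv> pure_tensor A B W"

lemma Ind_module: "left_module B W \<Longrightarrow> left_module A (Ind L G \<phi> H W)"
  by (rule tensor_product.ind_left_module[OF tensor_product_AB])

text \<open>The projection of \<open>l * G\<close> onto \<open>lH\<close>, a homomorphism of right \<open>lH\<close>-modules.\<close>

definition res where "res a = (\<lambda>x\<in>carrier G. if x \<in> H then a x else \<zero>\<^bsub>L\<^esub>)"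

lemma res_apply: "x \<in> carrier G \<Longrightarrow> res a x = (if x \<in> H then a x else \<zero>\<^bsub>L\<^esub>)"
  by (simp add: res_def)

lemma res_B: "a \<in> carrier A \<Longrightarrow> res a \<in> carrier B"
  using A_mem[of a] by (auto simp: B_iff res_def A_simps)

lemma res_add: "\<lbrakk>a \<in> carrier A; b \<in> carrier A\<rbrakk> \<Longrightarrow> res (a \<oplus>\<^bsub>A\<^esub> b) = res a \<oplus>\<^bsub>A\<^esub> res b"
  by (rule A_eqI) (auto simp: B_A res_B res_apply A_add_apply)

lemma res_smon: "\<lbrakk>c \<in> carrier L; g \<in> carrier G\<rbrakk> \<Longrightarrow> res (smon c g) = (if g \<in> H then smon c g else \<zero>\<^bsub>A\<^esub>)"
  by (rule A_eqI) (auto simp: B_A res_B res_apply smon_apply A_zero_apply)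

text \<open>On monomials: for \<open>h\<close> in \<open>H\<close>, a product g h lies in
  \<open>H\<close> exactly when \<open>g\<close> does.\<close>

lemma res_mult:
  assumes a: "a \<in> carrier A" and b: "b \<in> carrier B"
  shows "res (a \<otimes>\<^bsub>A\<^esub> b) = res a \<otimes>\<^bsub>A\<^esub> b"
  using a
proof (induction a rule: A_induct)
  case zero
  have "res \<zero>\<^bsub>A\<^esub> = \<zero>\<^bsub>A\<^esub>" by (rule A_eqI) (auto simp: B_A res_B res_apply A_zero_apply)
  then show ?case using b by (simp add: B_A)
next
  case (add a a')
  then show ?case using b by (simp add: AR.l_distr B_A res_add res_B)
next
  case (monom c g)
  show ?case
    using b
  proof (induction b rule: B_induct)
    case zero
    have "res \<zero>\<^bsub>A\<^esub> = \<zero>\<^bsub>A\<^esub>" by (rule A_eqI) (auto simp: B_A res_B res_apply A_zero_apply)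
    then show ?case using monom by (simp add: B_A res_B)
  next
    case (add b b')
    then show ?case using monom by (simp add: AR.r_distr B_A res_add res_B)
  next
    case (monom d h)
    note dh = monom
    have "g \<otimes>\<^bsub>G\<^esub> h \<in> H \<longleftrightarrow> g \<in> H"
    proof
      assume "g \<otimes>\<^bsub>G\<^esub> h \<in> H"
      then have "(g \<otimes>\<^bsub>G\<^esub> h) \<otimes>\<^bsub>G\<^esub> inv\<^bsub>G\<^esub> h \<in> H" using H_mult H_inv dh(2) by blast
      then show "g \<in> H" using \<open>g \<in> carrier G\<close> H_carrier[OF dh(2)] by (simp add: G.m_assoc)
    qed (rule H_mult[OF _ dh(2)])
    then show ?case using \<open>c \<in> carrier L\<close> \<open>g \<in> carrier G\<close> dh H_carrier[OF dh(2)]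
      by (simp add: smon_mult res_smon)
  qed
qed

text \<open>The component of Ind W at the coset of \<open>g\<close>, induced by the right
  \<open>B\<close>-linear map a \<mapsto> res (g\<inverse> a). As an additive map it separates the
  summands and recognises nonzero tensors.\<close>

lemma coset_component:
  assumes W: "left_module B W" and g: "g \<in> carrier G"
  obtains p where "p \<in> hom (add_monoid (Ind L G \<phi> H W)) (add_monoid W)"
    "\<And>a w. \<lbrakk>a \<in> carrier A; w \<in> carrier W\<rbrakk> \<Longrightarrow> p (pure W a w) = res (e (inv\<^bsub>G\<^esub> g) \<otimes>\<^bsub>A\<^esub> a) \<odot>\<^bsub>W\<^esub> w"
proof -
  interpret W: left_module B W by (rule W)
  interpret tp: tensor_product A B W by (rule tensor_product_AB[OF W])
  let ?\<beta> = "\<lambda>a w. res (e (inv\<^bsub>G\<^esub> g) \<otimes>\<^bsub>A\<^esub> a) \<odot>\<^bsub>W\<^esub> w"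
  show thesis
  proof (rule tp.tensor_lift[OF W.M.abelian_group_axioms, of ?\<beta>])
    fix a a' w assume a: "a \<in> carrier A" "a' \<in> carrier A" and w: "w \<in> carrier W"
    show "?\<beta> (a \<oplus>\<^bsub>A\<^esub> a') w = ?\<beta> a w \<oplus>\<^bsub>W\<^esub> ?\<beta> a' w"
      using a w W.smult_l_distr[OF res_B res_B w, of "e (inv\<^bsub>G\<^esub> g) \<otimes>\<^bsub>A\<^esub> a" "e (inv\<^bsub>G\<^esub> g) \<otimes>\<^bsub>A\<^esub> a'"]
      by (simp add: AR.r_distr res_add)
  next
    fix a b w assume a: "a \<in> carrier A" and b: "b \<in> carrier B" and w: "w \<in> carrier W"
    show "?\<beta> (a \<otimes>\<^bsub>A\<^esub> b) w = ?\<beta> a (b \<odot>\<^bsub>W\<^esub> w)"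
      using a b w W.smult_assoc1[OF res_B b w, of "e (inv\<^bsub>G\<^esub> g) \<otimes>\<^bsub>A\<^esub> a"]
        res_mult[OF _ b, of "e (inv\<^bsub>G\<^esub> g) \<otimes>\<^bsub>A\<^esub> a"] by (simp add: AR.m_assoc B_A)
  qed (simp_all add: res_B W.smult_r_distr that)
qed

text \<open>Moving \<open>b\<close> across \<open>e g\<close> and then across the tensor sign turns
  it into \<open>conj g b\<close> acting on W, which is the twisted action.\<close>

lemma pure_coset_hom:
  assumes W: "left_module B W" and g: "g \<in> carrier G"
  shows "(\<lambda>w. pure W (e g) w) \<in> left_module_hom B (twist g W) (Ind L G \<phi> H W)"
proof -
  interpret W: left_module B W by (rule W)
  interpret tp: tensor_product A B W by (rule tensor_product_AB[OF W])
  show ?thesis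
  proof (rule left_module_homI)
    fix b w assume b: "b \<in> carrier B" and w: "w \<in> carrier (twist g W)"
    have "pure W (e g) (conj g b \<odot>\<^bsub>W\<^esub> w) = pure W (e g \<otimes>\<^bsub>A\<^esub> conj g b) w"
      using w conj_B[OF g b] by (simp add: tp.pure_balanced)
    then show "pure W (e g) (b \<odot>\<^bsub>twist g W\<^esub> w) = b \<odot>\<^bsub>Ind L G \<phi> H W\<^esub> pure W (e g) w"
      using w g b tp.smult_hom(2)[OF B_A[OF b], of "e g" w] by (simp add: e_conj B_A)
  qed (use tp.pure_closed tp.pure_add_right in simp_all)
qed

text \<open>The component at \<open>g\<close> recovers w from g \<otimes> w, so w \<mapsto> g
  \<otimes> w is injective and identifies the twist with the submodule gW of Ind W.\<close>

lemma conjugate_module_twist: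
  assumes W: "left_module B W" and g: "g \<in> carrier G"
  shows "left_module B (conjugate_module L G \<phi> H g W)"
    "left_module_iso B (twist g W) (conjugate_module L G \<phi> H g W)"
proof -
  interpret W: left_module B W by (rule W)
  interpret I: left_module A "Ind L G \<phi> H W" by (rule Ind_module[OF W])
  note IB = A_module_B[OF I.left_module_axioms]
  interpret tW: left_module B "twist g W" by (rule twist_left_module[OF g W])
  let ?u = "\<lambda>w. pure W (e g) w"
  interpret u: module_hom_pair B "twist g W" "Ind L G \<phi> H W" ?u
    by (intro module_hom_pairI tW.left_module_axioms IB pure_coset_hom[OF W g])
  have eq: "conjugate_module L G \<phi> H g W = (Ind L G \<phi> H W)\<lparr>carrier := ?u ` carrier W\<rparr>"
    by (simp add: conjugate_module_def)
  show "left_module B (conjugate_module L G \<phi> H g W)"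
    unfolding eq using left_module.submodule_left_module[OF IB] u.image_submodule[OF tW.submodule_carrier] by simp
  obtain p where p: "\<And>a w. \<lbrakk>a \<in> carrier A; w \<in> carrier W\<rbrakk> \<Longrightarrow> p (pure W a w) = res (e (inv\<^bsub>G\<^esub> g) \<otimes>\<^bsub>A\<^esub> a) \<odot>\<^bsub>W\<^esub> w"
    by (rule coset_component[OF W g]) (rule that)
  have "p (?u w) = w" if "w \<in> carrier W" for w
    using that g p[of "e g" w] W.smult_one[OF that] res_smon[OF L.one_closed G.one_closed] H_one
    by (simp add: e_inv smon_one)
  then have "inj_on ?u (carrier W)" by (rule inj_on_inverseI)
  moreover have "?u \<in> left_module_hom B (twist g W) (conjugate_module L G \<phi> H g W)"
    unfolding eq using u.closed u.add u.smult by (intro left_module_homI) auto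
  ultimately show "left_module_iso B (twist g W) (conjugate_module L G \<phi> H g W)"
    unfolding left_module_iso_def by (intro bexI[of _ ?u]) (auto simp: eq bij_betw_def)
qed

lemma Ind_family:
  assumes W: "left_module B W"
  shows "hom_family B (Ind L G \<phi> H W) T (\<lambda>t. twist t W) (\<lambda>t w. pure W (e t) w)"
  by (rule hom_familyI[OF A_module_B[OF Ind_module[OF W]] fin_T twist_left_module[OF T_carrier W]
    pure_coset_hom[OF W T_carrier]])

lemma Ind_sum_image:
  assumes W: "left_module B W"
  shows "sum_image (Ind L G \<phi> H W) T (\<lambda>t. twist t W) (\<lambda>t w. pure W (e t) w) = carrier (Ind L G \<phi> H W)"
    (is "?S = carrier ?I")
proof
  interpret W: left_module B W by (rule W)
  interpret I: left_module A ?I by (rule Ind_module[OF W])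
  interpret fam: hom_family B ?I T "\<lambda>t. twist t W" "\<lambda>t w. pure W (e t) w" by (rule Ind_family[OF W])
  interpret tp: tensor_product A B W by (rule tensor_product_AB[OF W])
  interpret S: submodule ?S B ?I by (rule fam.sum_image_submodule)
  show "?S \<subseteq> carrier ?I" using S.subset by simp
  have pc: "pure W a w \<in> carrier ?I" if "a \<in> carrier A" "w \<in> carrier W" for a w
    using tp.pure_closed[OF that] by simp
  have coset: "pure W (e t) w \<in> ?S" if t: "t \<in> T" and w: "w \<in> carrier W" for t w
  proof -
    let ?x = "\<lambda>s. if t = s then w else \<zero>\<^bsub>W\<^esub>"
    have z: "pure W (e s) \<zero>\<^bsub>W\<^esub> = \<zero>\<^bsub>?I\<^esub>" if "s \<in> T" for s
    proof -
      interpret u: module_hom_pair B "twist s W" ?I "\<lambda>w. pure W (e s) w"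
        by (rule module_hom_pairI[OF twist_left_module[OF T_carrier[OF that] W]
          A_module_B[OF Ind_module[OF W]] pure_coset_hom[OF W T_carrier[OF that]]])
      show ?thesis using u.zero by simp
    qed
    have "(\<Oplus>\<^bsub>?I\<^esub>s\<in>T. pure W (e s) (?x s)) = (\<Oplus>\<^bsub>?I\<^esub>s\<in>T. if t = s then pure W (e s) w else \<zero>\<^bsub>?I\<^esub>)"
      by (rule I.M.finsum_cong') (use w z pc in \<open>auto simp del: tp.ind_simps\<close>)
    also have "\<dots> = pure W (e t) w"
      by (rule I.M.finsum_singleton[OF t fin_T]) (use w pc in auto)
    finally show ?thesis unfolding sum_image_def using w by (auto intro!: exI[of _ ?x])
  qed
  have pureS: "pure W a w \<in> ?S" if a: "a \<in> carrier A" and w: "w \<in> carrier W" for a w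
    using a
  proof (induction a rule: A_induct)
    case zero
    have "pure W \<zero>\<^bsub>A\<^esub> w \<oplus>\<^bsub>?I\<^esub> pure W \<zero>\<^bsub>A\<^esub> w = pure W \<zero>\<^bsub>A\<^esub> w"
      using tp.pure_add_left[of "\<zero>\<^bsub>A\<^esub>" "\<zero>\<^bsub>A\<^esub>" w] w by simp
    then have "pure W \<zero>\<^bsub>A\<^esub> w = \<zero>\<^bsub>?I\<^esub>" using pc[of "\<zero>\<^bsub>A\<^esub>" w] w I.M.add.l_cancel_one by simp
    then show ?case using S.one_closed by simp
  next
    case (add a b)
    then show ?case using tp.pure_add_left[OF add(1,2) w] S.m_closed[OF add(3,4)] by simp
  next
    case (monom c g)
    let ?t = "rep g"
    have t: "?t \<in> T" "?t \<in> carrier G" "\<phi> ?t = \<phi> g" using monom rep rep_in_T by auto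
    \<comment> \<open>Factors the monomial along the coset of \<open>g\<close>: \<open>b\<close>
      lies in \<open>B\<close>, so it can be moved into the second tensor factor.\<close>
    define b where "b = e (inv\<^bsub>G\<^esub> ?t) \<otimes>\<^bsub>A\<^esub> smon c g"
    have "inv\<^bsub>G\<^esub> ?t \<otimes>\<^bsub>G\<^esub> g \<in> H" using t monom by (simp add: H_mem)
    then have b: "b \<in> carrier B" using t monom by (simp add: b_def smon_mult smon_B)
    have "e ?t \<otimes>\<^bsub>A\<^esub> b = smon c g" using t monom by (simp add: b_def e_inv flip: AR.m_assoc)
    then have "pure W (smon c g) w = pure W (e ?t) (b \<odot>\<^bsub>W\<^esub> w)"
      using tp.pure_balanced[OF _ b w, of "e ?t"] by simp
    then show ?case using coset[OF t(1)] b w by simp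
  qed
  show "carrier ?I \<subseteq> ?S"
  proof
    fix p assume "p \<in> carrier ?I"
    then show "p \<in> ?S"
    proof (induction p rule: tp.tensor_induct)
      case zero
      then show ?case using S.one_closed by simp
    next
      case (diff p q)
      have "\<ominus>\<^bsub>?I\<^esub> q \<in> ?S" using S.m_inv_closed[OF diff(4)] by (simp add: a_inv_def)
      then show ?case using S.m_closed[OF diff(3)] by (simp add: a_minus_def)
    qed (rule pureS)
  qed
qed

text \<open>This reflects that \<open>A\<close> is free as a right \<open>B\<close>-module on the
  \<open>e t\<close> with \<open>t\<close> in \<open>T\<close>. The summands span by
  \<open>Ind_sum_image\<close>, and the component at each coset reads off its coordinate.\<close>

lemma Ind_decomposition:
  assumes W: "left_module B W"
  shows "left_module_iso B (Ind L G \<phi> H W) (direct_sum T (\<lambda>t. twist t W))"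
proof -
  let ?I = "Ind L G \<phi> H W"
  interpret W: left_module B W by (rule W)
  interpret fam: hom_family B ?I T "\<lambda>t. twist t W" "\<lambda>t w. pure W (e t) w" by (rule Ind_family[OF W])
  interpret tp: tensor_product A B W by (rule tensor_product_AB[OF W])
  have "sum_indep ?I T (\<lambda>t. twist t W) (\<lambda>t w. pure W (e t) w)"
    unfolding sum_indep_def
  proof (intro allI impI ballI)
    fix x t assume x: "\<forall>t\<in>T. x t \<in> carrier (twist t W)" and 0: "(\<Oplus>\<^bsub>?I\<^esub>t\<in>T. pure W (e t) (x t)) = \<zero>\<^bsub>?I\<^esub>"
      and t: "t \<in> T"
    note tG = T_carrier[OF t]
    obtain p where p: "p \<in> hom (add_monoid ?I) (add_monoid W)"
      and pp: "\<And>a w. \<lbrakk>a \<in> carrier A; w \<in> carrier W\<rbrakk> \<Longrightarrow> p (pure W a w) = res (e (inv\<^bsub>G\<^esub> t) \<otimes>\<^bsub>A\<^esub> a) \<odot>\<^bsub>W\<^esub> w"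
      by (rule coset_component[OF W tG]) (rule that)
    have ps: "p (pure W (e s) (x s)) = (if t = s then x s else \<zero>\<^bsub>W\<^esub>)" if s: "s \<in> T" for s
    proof -
      note sG = T_carrier[OF s]
      have xs: "x s \<in> carrier W" using x s by simp
      have "inv\<^bsub>G\<^esub> t \<otimes>\<^bsub>G\<^esub> s \<in> H \<longleftrightarrow> t = s" using H_mem[OF tG sG] T_inj[OF t s] by auto
      then have "res (e (inv\<^bsub>G\<^esub> t) \<otimes>\<^bsub>A\<^esub> e s) = (if t = s then \<one>\<^bsub>B\<^esub> else \<zero>\<^bsub>B\<^esub>)"
        using tG sG by (auto simp: e_mult res_smon smon_one)
      then show ?thesis using pp[of "e s" "x s"] xs W.smult_one[OF xs] W.smult_l_null[OF xs] by simp
    qed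
    have "p (\<Oplus>\<^bsub>?I\<^esub>t\<in>T. pure W (e t) (x t)) = (\<Oplus>\<^bsub>W\<^esub>s\<in>T. p (pure W (e s) (x s)))"
      using x by (intro add_hom_finsum[OF tp.ind_abelian_group W.M.abelian_group_axioms p fin_T]) auto
    also have "\<dots> = (\<Oplus>\<^bsub>W\<^esub>s\<in>T. if t = s then x s else \<zero>\<^bsub>W\<^esub>)"
      using x ps by (intro W.M.finsum_cong') auto
    also have "\<dots> = x t" using x t by (intro W.M.finsum_singleton) auto
    finally have "p \<zero>\<^bsub>?I\<^esub> = x t" unfolding 0 .
    moreover have "p \<zero>\<^bsub>?I\<^esub> = \<zero>\<^bsub>W\<^esub>"
      using add_hom_finsum[OF tp.ind_abelian_group W.M.abelian_group_axioms p, of "{}"]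
      by (simp add: abelian_monoid.finsum_empty[OF abelian_group.axioms(1)[OF tp.ind_abelian_group]])
    ultimately show "x t = \<zero>\<^bsub>twist t W\<^esub>" by simp
  qed
  then have iso: "left_module_iso B (direct_sum T (\<lambda>t. twist t W)) ?I"
    by (rule fam.iso_direct_sum[OF _ Ind_sum_image[OF W]])
  have "left_module B (direct_sum T (\<lambda>t. twist t W))"
    by (rule direct_sum_left_module[OF B_ring twist_left_module[OF T_carrier W]])
  then show ?thesis
    by (rule left_module_iso_sym[OF _ A_module_B[OF Ind_module[OF W]] iso])
qed

section \<open>Simple modules over \<open>B\<close> below simple modules over
  \<open>A\<close>\<close>

lemma twist_nonzero_hom:
  assumes W: "left_module B W" and V: "left_module A V" and nz: "nonzero_hom B W V" and g: "g \<in> carrier G"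
  shows "nonzero_hom B (twist g W) V"
proof -
  note VB = A_module_B[OF V]
  have "nonzero_hom B (twist g W) (twist g V)"
    using nz twist_hom[OF g] unfolding nonzero_hom_def by fastforce
  then show ?thesis
    by (rule nonzero_hom_iso_right[OF twist_left_module[OF g W] twist_left_module[OF g VB] VB twist_restriction[OF V g]])
qed

text \<open>A simple \<open>A\<close>-module is cyclic, hence of finite length over
  \<open>B\<close>, and contains a simple \<open>B\<close>-submodule; this is then copied to the
  carrier type on which isomorphism classes are formed.\<close>

lemma simple_submodule_restriction:
  assumes V: "simple_left_module A V"
  obtains W :: "('g \<Rightarrow> 'l, ('g \<Rightarrow> 'l) set) module" where "simple_left_module B W" "nonzero_hom B W V"
proof -
  note VA = simple_left_moduleD(1)[OF V] and VB = A_module_B[OF simple_left_moduleD(1)[OF V]]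
  interpret V: left_module A V by (rule VA)
  obtain v where v: "v \<in> carrier V" "carrier V = (\<lambda>a. a \<odot>\<^bsub>V\<^esub> v) ` carrier A" using simple_cyclic[OF V] by blast
  have "carrier V \<noteq> {\<zero>\<^bsub>V\<^esub>}" using simple_left_moduleD(2)[OF V] by auto
  then obtain N where N: "submodule N B V" "simple_left_module B (V\<lparr>carrier := N\<rparr>)"
    by (rule simple_submodule_exists[OF VB finite_length_cyclic(1)[OF VA v]])
  obtain W :: "('g \<Rightarrow> 'l, ('g \<Rightarrow> 'l) set) module" where W: "simple_left_module B W" "left_module_iso B (V\<lparr>carrier := N\<rparr>) W"
    by (rule simple_left_module_represented[OF N(2)])
  note Nm = simple_left_moduleD(1)[OF N(2)] and Wm = simple_left_moduleD(1)[OF W(1)]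
  obtain x where "x \<in> N" "x \<noteq> \<zero>\<^bsub>V\<^esub>" using simple_left_moduleD(2)[OF N(2)] by auto
  moreover have "N \<subseteq> carrier V" using submodule.axioms(1)[OF N(1), THEN subgroup.subset] by simp
  ultimately have "nonzero_hom B (V\<lparr>carrier := N\<rparr>) V"
    by (intro nonzero_homI[OF lmh_inclusion]) auto
  then have "nonzero_hom B W V"
    by (rule nonzero_hom_iso[OF Nm Wm VB left_module_iso_sym[OF Nm Wm W(2)]])
  then show thesis using that W(1) by blast
qed

text \<open>By reciprocity a nonzero map from W extends to an \<open>A\<close>-linear map from Ind
  W, which is onto V by simplicity. The images of the conjugates of W span V, and an independent
  subfamily is selected.\<close>

lemma restriction_decomposition:
  assumes W: "simple_left_module B W" and V: "simple_left_module A V" and nz: "nonzero_hom B W V"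
  obtains J where "J \<subseteq> T" "left_module_iso B V (direct_sum J (\<lambda>t. twist t W))" "J \<noteq> {}"
proof -
  let ?I = "Ind L G \<phi> H W"
  note Wm = simple_left_moduleD(1)[OF W] and Vm = simple_left_moduleD(1)[OF V]
  note Im = Ind_module[OF Wm]
  interpret W: left_module B W by (rule Wm)
  interpret V: left_module A V by (rule Vm)
  interpret tp: tensor_product A B W by (rule tensor_product_AB[OF Wm])
  obtain f w where f: "f \<in> left_module_hom B W V" and w: "w \<in> carrier W" "f w \<noteq> \<zero>\<^bsub>V\<^esub>"
    using nz by (auto simp: nonzero_hom_def)
  obtain \<Phi> where \<Phi>: "\<Phi> \<in> left_module_hom A ?I V"
    and \<Phi>p: "\<And>a w. \<lbrakk>a \<in> carrier A; w \<in> carrier W\<rbrakk> \<Longrightarrow> \<Phi> (pure W a w) = a \<odot>\<^bsub>V\<^esub> f w"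
    using tp.tensor_lift_module[OF Vm f] by (metis B_simps(4))
  have "\<Phi> (pure W \<one>\<^bsub>A\<^esub> w) \<noteq> \<zero>\<^bsub>V\<^esub>" using \<Phi>p[of "\<one>\<^bsub>A\<^esub>" w] w lmh_closed[OF f w(1)] by simp
  then have surj: "\<Phi> ` carrier ?I = carrier V"
    using w by (intro simple_target_surj[OF Im V \<Phi>, of "pure W \<one>\<^bsub>A\<^esub> w"]) auto
  note \<Phi>B = hom_A_B[OF \<Phi>]
  interpret \<Phi>: module_hom_pair B ?I V \<Phi> by (intro module_hom_pairI A_module_B Im Vm \<Phi>B)
  define u where "u = (\<lambda>t w. \<Phi> (pure W (e t) w))"
  have u: "u t \<in> left_module_hom B (twist t W) V" if "t \<in> T" for t
    unfolding u_def by (rule lmh_comp[OF pure_coset_hom[OF Wm T_carrier[OF that]] \<Phi>B])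
  have "carrier V \<subseteq> sum_image V T (\<lambda>t. twist t W) u"
  proof
    fix y assume "y \<in> carrier V"
    then obtain z where z: "z \<in> carrier ?I" "y = \<Phi> z" using surj by blast
    from z(1)[folded Ind_sum_image[OF Wm]] obtain x where x: "\<forall>t\<in>T. x t \<in> carrier (twist t W)"
      "z = (\<Oplus>\<^bsub>?I\<^esub>t\<in>T. pure W (e t) (x t))" by (auto simp: sum_image_def)
    have "y = (\<Oplus>\<^bsub>V\<^esub>t\<in>T. u t (x t))"
      unfolding z(2) x(2) u_def using x(1) by (intro \<Phi>.finsum fin_T) auto
    then show "y \<in> sum_image V T (\<lambda>t. twist t W) u" using x(1) by (auto simp: sum_image_def)
  qed
  moreover have "sum_image V T (\<lambda>t. twist t W) u \<subseteq> carrier V"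
    using lmh_closed[OF u] by (auto simp: sum_image_def intro!: V.M.finsum_closed)
  ultimately have im: "sum_image V T (\<lambda>t. twist t W) u = carrier V" by blast
  obtain J where J: "J \<subseteq> T" "left_module_iso B V (direct_sum J (\<lambda>t. twist t W))"
    by (rule semisimple_decomposition[OF A_module_B[OF Vm] fin_T twist_simple[OF T_carrier W] u im])
  \<comment> \<open>A direct sum over no indices has a single element,
    \<open>\<lambda>_. undefined\<close>, and cannot be isomorphic to a nonzero V.\<close>
  have "J \<noteq> {}"
  proof
    assume "J = {}"
    moreover obtain h where "bij_betw h (carrier V) (carrier (direct_sum J (\<lambda>t. twist t W)))"
      using J(2) unfolding left_module_iso_def by blast
    ultimately have "inj_on h (carrier V)" "\<And>x. x \<in> carrier V \<Longrightarrow> h x = (\<lambda>_. undefined)"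
      by (auto simp: bij_betw_def)
    then show False using simple_left_moduleD(2)[OF V] V.M.zero_closed by (metis inj_onD)
  qed
  then show thesis using that J by blast
qed

text \<open>Project the decomposition of V to one of its summands. The target is some conjugate of
  W, because \<open>J\<close> is only known to be nonempty.\<close>

lemma nonzero_hom_to_twist:
  assumes W: "simple_left_module B W" and V: "simple_left_module A V" and nz: "nonzero_hom B W V"
  obtains t f where "t \<in> T" "f \<in> left_module_hom B V (twist t W)" "f ` carrier V = carrier (twist t W)"
proof -
  note Wm = simple_left_moduleD(1)[OF W] and Vm = simple_left_moduleD(1)[OF V]
  obtain J where J: "J \<subseteq> T" "left_module_iso B V (direct_sum J (\<lambda>t. twist t W))" "J \<noteq> {}"
    by (rule restriction_decomposition[OF assms])
  then obtain t where t: "t \<in> J" by auto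
  have tw: "left_module B (twist s W)" if "s \<in> J" for s using J(1) that by (intro twist_left_module Wm T_carrier) auto
  have D: "left_module B (direct_sum J (\<lambda>t. twist t W))"
    by (rule direct_sum_left_module[OF B_ring tw])
  obtain h k where h: "h \<in> left_module_hom B V (direct_sum J (\<lambda>t. twist t W))"
    and k: "k \<in> left_module_hom B (direct_sum J (\<lambda>t. twist t W)) V"
    and "\<And>x. x \<in> carrier V \<Longrightarrow> k (h x) = x"
    and hk: "\<And>y. y \<in> carrier (direct_sum J (\<lambda>t. twist t W)) \<Longrightarrow> h (k y) = y"
    by (rule left_module_isoE[OF A_module_B[OF Vm] D J(2)]) (rule that)
  have f: "(\<lambda>v. h v t) \<in> left_module_hom B V (twist t W)"
    by (rule lmh_comp[OF h direct_sum_proj_hom[where M = "\<lambda>t. twist t W", OF t]])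
  have "(\<lambda>v. h v t) ` carrier V = carrier (twist t W)"
  proof
    show "(\<lambda>v. h v t) ` carrier V \<subseteq> carrier (twist t W)" using lmh_closed[OF f] by blast
    show "carrier (twist t W) \<subseteq> (\<lambda>v. h v t) ` carrier V"
    proof
      fix w assume w: "w \<in> carrier (twist t W)"
      let ?y = "\<lambda>j\<in>J. if j = t then w else \<zero>\<^bsub>twist j W\<^esub>"
      have y: "?y \<in> carrier (direct_sum J (\<lambda>t. twist t W))"
        using lmh_closed[OF direct_sum_inj_hom[where M = "\<lambda>t. twist t W", OF tw t] w] .
      then have "w = h (k ?y) t" using hk t by simp
      then show "w \<in> (\<lambda>v. h v t) ` carrier V" by (rule image_eqI[OF _ lmh_closed[OF k y]])
    qed
  qed
  then show thesis using that f t J(1) by blast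
qed

lemma simple_under_conjugate:
  assumes W: "simple_left_module B W" and V: "simple_left_module A V" and nz: "nonzero_hom B W V"
    and W': "simple_left_module B W'" and nz': "nonzero_hom B W' V"
  obtains t where "t \<in> T" "left_module_iso B W' (twist t W)"
proof -
  note Wm = simple_left_moduleD(1)[OF W] and Vm = simple_left_moduleD(1)[OF V]
  obtain J where J: "J \<subseteq> T" "left_module_iso B V (direct_sum J (\<lambda>t. twist t W))"
    by (rule restriction_decomposition[OF W V nz]) blast
  have tw: "simple_left_module B (twist s W)" if "s \<in> J" for s using J(1) that by (intro twist_simple W T_carrier) auto
  have "left_module B (direct_sum J (\<lambda>t. twist t W))"
    by (rule direct_sum_left_module[OF B_ring simple_left_moduleD(1)[OF tw]])
  then have "nonzero_hom B W' (direct_sum J (\<lambda>t. twist t W))"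
    by (rule nonzero_hom_iso_right[OF simple_left_moduleD(1)[OF W'] A_module_B[OF Vm] _ J(2) nz'])
  then obtain t where t: "t \<in> J" "nonzero_hom B W' (twist t W)" using nonzero_hom_direct_sum by blast
  then show thesis using that J(1) schur_iso[OF W' tw] by blast
qed

text \<open>V maps over \<open>B\<close> onto a conjugate of W, which embeds in V' because
  restrictions are invariant under twisting. The composite is nonzero; descent turns it into a
  nonzero \<open>A\<close>-map, to which Schur's lemma applies.\<close>

lemma simple_over_unique:
  assumes W: "simple_left_module B W" and V: "simple_left_module A V" and nz: "nonzero_hom B W V"
    and V': "simple_left_module A V'" and nz': "nonzero_hom B W V'"
  shows "left_module_iso A V V'"
proof -
  note Wm = simple_left_moduleD(1)[OF W] and Vm = simple_left_moduleD(1)[OF V] and Vm' = simple_left_moduleD(1)[OF V']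
  obtain t f where t: "t \<in> T" and f: "f \<in> left_module_hom B V (twist t W)" "f ` carrier V = carrier (twist t W)"
    by (rule nonzero_hom_to_twist[OF W V nz])
  have "nonzero_hom B V V'"
    by (rule nonzero_hom_comp_surj[OF f twist_nonzero_hom[OF Wm Vm' nz' T_carrier[OF t]]])
  then show ?thesis using schur_iso[OF V V'] nonzero_hom_descent[OF Vm Vm'] by blast
qed

text \<open>Ind W is cyclic and nonzero, so it contains a simple \<open>A\<close>-module N. A simple
  \<open>B\<close>-module below N also lies below Ind W and is thus a conjugate of W; twisting back
  places W itself below N.\<close>

lemma simple_over_exists:
  assumes W: "simple_left_module B W"
  obtains V :: "('g \<Rightarrow> 'l, ('g \<Rightarrow> 'l) set) module" where "simple_left_module A V" "nonzero_hom B W V"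
proof -
  let ?I = "Ind L G \<phi> H W"
  note Wm = simple_left_moduleD(1)[OF W]
  note Im = Ind_module[OF Wm]
  interpret W: left_module B W by (rule Wm)
  interpret I: left_module A ?I by (rule Im)
  interpret tp: tensor_product A B W by (rule tensor_product_AB[OF Wm])
  obtain w where w: "w \<in> carrier W" "w \<noteq> \<zero>\<^bsub>W\<^esub>" using simple_left_moduleD(2)[OF W] by blast
  let ?v = "pure W \<one>\<^bsub>A\<^esub> w"
  have v: "?v \<in> carrier ?I" using w by simp
  \<comment> \<open>W is generated over \<open>B\<close> by w, hence Ind W over \<open>A\<close> by
    \<one> \<otimes> w.\<close>
  have Bw: "(\<lambda>b. b \<odot>\<^bsub>W\<^esub> w) ` carrier (regular_module B) = carrier W"
    by (rule simple_target_surj[OF ring.regular_module_left_module[OF B_ring] W W.regular_module_hom[OF w(1)], of "\<one>\<^bsub>B\<^esub>"])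
      (use w W.smult_one[OF w(1)] subringE(3)[OF B_subring] in auto)
  interpret r: module_hom_pair A "regular_module A" ?I "\<lambda>a. a \<odot>\<^bsub>?I\<^esub> ?v"
    by (intro module_hom_pairI AR.regular_module_left_module Im I.regular_module_hom v)
  interpret P: submodule "(\<lambda>a. a \<odot>\<^bsub>?I\<^esub> ?v) ` carrier (regular_module A)" A ?I
    by (rule r.image_submodule[OF r.M.submodule_carrier])
  have "p \<in> (\<lambda>a. a \<odot>\<^bsub>?I\<^esub> ?v) ` carrier (regular_module A)" if "p \<in> carrier ?I" for p
    using that
  proof (induction p rule: tp.tensor_induct)
    case zero
    then show ?case using P.one_closed by simp
  next
    case (diff p q)
    have "\<ominus>\<^bsub>?I\<^esub> q \<in> (\<lambda>a. a \<odot>\<^bsub>?I\<^esub> ?v) ` carrier (regular_module A)"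
      using P.m_inv_closed[OF diff(4)] by (simp add: a_inv_def)
    then show ?case using P.m_closed[OF diff(3)] by (simp add: a_minus_def)
  next
    case (pure a w')
    from pure(2) obtain b where b: "b \<in> carrier B" "w' = b \<odot>\<^bsub>W\<^esub> w" unfolding Bw[symmetric] by auto
    have "pure W a w' = pure W (a \<otimes>\<^bsub>A\<^esub> b) w" using b pure(1) w by (simp add: tp.pure_balanced)
    also have "\<dots> = (a \<otimes>\<^bsub>A\<^esub> b) \<odot>\<^bsub>?I\<^esub> ?v"
      using b pure(1) w by (subst tp.smult_hom(2)) (simp_all add: B_A)
    finally show ?case using b pure(1) by (auto simp: B_A intro!: image_eqI[of _ _ "a \<otimes>\<^bsub>A\<^esub> b"])
  qed
  then have gen: "carrier ?I = (\<lambda>a. a \<odot>\<^bsub>?I\<^esub> ?v) ` carrier A" using r.closed by auto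
  \<comment> \<open>The component at the trivial coset sends \<one> \<otimes> w to w.\<close>
  have v0: "?v \<noteq> \<zero>\<^bsub>?I\<^esub>"
  proof
    assume 0: "?v = \<zero>\<^bsub>?I\<^esub>"
    interpret tW: left_module B "twist \<one>\<^bsub>G\<^esub> W" by (rule twist_left_module[OF G.one_closed Wm])
    obtain p where p: "p \<in> hom (add_monoid ?I) (add_monoid W)"
      and pp: "\<And>a w. \<lbrakk>a \<in> carrier A; w \<in> carrier W\<rbrakk> \<Longrightarrow> p (pure W a w) = res (e (inv\<^bsub>G\<^esub> \<one>\<^bsub>G\<^esub>) \<otimes>\<^bsub>A\<^esub> a) \<odot>\<^bsub>W\<^esub> w"
      by (rule coset_component[OF Wm G.one_closed]) (rule that)
    have "p ?v = w"
      using pp[of "\<one>\<^bsub>A\<^esub>" w] w W.smult_one[OF w(1)] res_smon[OF L.one_closed G.one_closed] H_one by (simp add: smon_one)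
    moreover have "p \<zero>\<^bsub>?I\<^esub> = \<zero>\<^bsub>W\<^esub>"
      using add_hom_finsum[OF tp.ind_abelian_group W.M.abelian_group_axioms p, of "{}"] by simp
    ultimately show False using 0 w by simp
  qed
  then have ne: "carrier ?I \<noteq> {\<zero>\<^bsub>?I\<^esub>}" using v by blast
  obtain N where N: "submodule N A ?I" "simple_left_module A (?I\<lparr>carrier := N\<rparr>)"
    by (rule simple_submodule_exists[OF Im finite_length_cyclic(2)[OF Im v gen] ne])
  let ?N = "?I\<lparr>carrier := N\<rparr>"
  note Nm = simple_left_moduleD(1)[OF N(2)]
  have NI: "N \<subseteq> carrier ?I" using submodule.axioms(1)[OF N(1), THEN subgroup.subset] by simp
  obtain W' :: "('g \<Rightarrow> 'l, ('g \<Rightarrow> 'l) set) module" where W': "simple_left_module B W'" "nonzero_hom B W' ?N"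
    by (rule simple_submodule_restriction[OF N(2)])
  note Wm' = simple_left_moduleD(1)[OF W'(1)]
  have tw: "simple_left_module B (twist t W)" if "t \<in> T" for t by (rule twist_simple[OF T_carrier[OF that] W])
  have "nonzero_hom B W' ?I"
    by (rule nonzero_hom_comp_inj[OF Wm' A_module_B[OF Nm] A_module_B[OF Im] W'(2) lmh_inclusion[OF NI]]) simp
  note nzI = this
  have "left_module B (direct_sum T (\<lambda>t. twist t W))"
    by (rule direct_sum_left_module[OF B_ring simple_left_moduleD(1)[OF tw]])
  then have "nonzero_hom B W' (direct_sum T (\<lambda>t. twist t W))"
    by (rule nonzero_hom_iso_right[OF Wm' A_module_B[OF Im] _ Ind_decomposition[OF Wm] nzI])
  then obtain t where t: "t \<in> T" "nonzero_hom B W' (twist t W)" using nonzero_hom_direct_sum by blast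
  note tG = T_carrier[OF t(1)] and twm = simple_left_moduleD(1)[OF tw[OF t(1)]]
  have iso: "left_module_iso B W' (twist t W)" by (rule schur_iso[OF W'(1) tw[OF t(1)] t(2)])
  have "nonzero_hom B (twist t W) ?N"
    by (rule nonzero_hom_iso[OF Wm' twm A_module_B[OF Nm] left_module_iso_sym[OF Wm' twm iso] W'(2)])
  then have nz: "nonzero_hom B (twist (inv\<^bsub>G\<^esub> t) (twist t W)) ?N"
    by (rule twist_nonzero_hom[OF twm Nm _ G.inv_closed[OF tG]])
  note ttm = twist_left_module[OF G.inv_closed[OF tG] twm]
  have nzW: "nonzero_hom B W ?N"
    by (rule nonzero_hom_iso[OF ttm Wm A_module_B[OF Nm] left_module_iso_sym[OF ttm Wm twist_inv(1)[OF tG Wm]] nz])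
  obtain V :: "('g \<Rightarrow> 'l, ('g \<Rightarrow> 'l) set) module" where V: "simple_left_module A V" "left_module_iso A ?N V"
    by (rule simple_left_module_represented[OF N(2)])
  have "nonzero_hom B W V"
    by (rule nonzero_hom_iso_right[OF Wm A_module_B[OF Nm] A_module_B[OF simple_left_moduleD(1)[OF V(1)]] iso_A_B[OF V(2)] nzW])
  then show thesis using that V(1) by blast
qed

end

text \<open>Number each fibre by \<open>{..<a}\<close>; the number together with the value of
  \<open>f\<close> gives \<open>h\<close>. This turns equal multiplicities into a power of a direct
  sum.\<close>

lemma ex_bij_betw_fibres:
  assumes fin: "finite J" and f: "f ` J \<subseteq> C" and card: "\<And>c. c \<in> C \<Longrightarrow> card {j \<in> J. f j = c} = a"
  shows "\<exists>h. bij_betw h J ({..<a} \<times> C) \<and> (\<forall>j\<in>J. snd (h j) = f j)"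
proof -
  have "\<exists>\<epsilon>. bij_betw \<epsilon> {j \<in> J. f j = c} {..<a}" if "c \<in> C" for c
    using fin card[OF that] by (intro finite_same_card_bij) auto
  then obtain \<epsilon> where \<epsilon>: "\<And>c. c \<in> C \<Longrightarrow> bij_betw (\<epsilon> c) {j \<in> J. f j = c} {..<a}" by metis
  define h where "h = (\<lambda>j. (\<epsilon> (f j) j, f j))"
  have "inj_on h J"
  proof (rule inj_onI)
    fix i j assume "i \<in> J" "j \<in> J" "h i = h j"
    moreover from this have "inj_on (\<epsilon> (f j)) {k \<in> J. f k = f j}" using \<epsilon> f by (auto simp: bij_betw_def)
    ultimately show "i = j" by (auto simp: h_def inj_on_def)
  qed
  moreover have "h ` J = {..<a} \<times> C"
  proof (intro subset_antisym subsetI)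
    fix p assume "p \<in> h ` J"
    then obtain j where j: "j \<in> J" "p = h j" by auto
    then have "f j \<in> C" using f by auto
    then have "\<epsilon> (f j) j \<in> {..<a}" using bij_betw_apply[OF \<epsilon>, of "f j" j] j by simp
    then show "p \<in> {..<a} \<times> C" using j \<open>f j \<in> C\<close> by (simp add: h_def)
  next
    fix p assume "p \<in> {..<a} \<times> C"
    then obtain i c where p: "p = (i, c)" "i < a" "c \<in> C" by auto
    then have "i \<in> \<epsilon> c ` {j \<in> J. f j = c}" using \<epsilon>[OF p(3)] by (simp add: bij_betw_def)
    then show "p \<in> h ` J" using p by (auto simp: h_def)
  qed
  ultimately show ?thesis by (intro exI[of _ h]) (simp add: bij_betw_def h_def)
qed

section \<open>Multiplicities and the correspondence with orbits\<close>

context galois_action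
begin

text \<open>A \<open>B\<close>-map from V onto a conjugate of W, followed by the inclusion into Ind
  W, descends to a combination of \<open>A\<close>-maps \<open>f i\<close> from V to Ind W. Their
  images together contain t \<otimes> W, so Ind W is a sum of images of the simple module V.\<close>

lemma Ind_power:
  assumes W: "simple_left_module B W" and V: "simple_left_module A V" and nz: "nonzero_hom B W V"
  obtains b where "left_module_iso A (Ind L G \<phi> H W) (module_power V b)"
proof -
  let ?I = "Ind L G \<phi> H W"
  note Wm = simple_left_moduleD(1)[OF W] and Vm = simple_left_moduleD(1)[OF V]
  note Im = Ind_module[OF Wm]
  interpret W: left_module B W by (rule Wm)
  interpret V: left_module A V by (rule Vm)
  interpret I: left_module A ?I by (rule Im)
  interpret tp: tensor_product A B W by (rule tensor_product_AB[OF Wm])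
  obtain t q where t: "t \<in> T" and q: "q \<in> left_module_hom B V (twist t W)" "q ` carrier V = carrier (twist t W)"
    by (rule nonzero_hom_to_twist[OF W V nz])
  note tG = T_carrier[OF t]
  have h: "(\<lambda>v. pure W (e t) (q v)) \<in> left_module_hom B V ?I"
    by (rule lmh_comp[OF q(1) pure_coset_hom[OF Wm tG]])
  obtain n :: nat and x f where x: "\<And>i. x i \<in> carrier L" and f: "\<And>i. f i \<in> left_module_hom A V ?I"
    and hv: "\<And>v. v \<in> carrier V \<Longrightarrow> pure W (e t) (q v) = (\<Oplus>\<^bsub>?I\<^esub>i\<in>{..<n}. smon (x i) \<one>\<^bsub>G\<^esub> \<odot>\<^bsub>?I\<^esub> f i v)"
    by (rule descent[OF Vm Im h]) (rule that)
  let ?S = "sum_image ?I {..<n} (\<lambda>_. V) f"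
  interpret fam: hom_family A ?I "{..<n}" "\<lambda>_. V" f
    by (intro hom_familyI Im Vm f finite_lessThan)
  interpret S: submodule ?S A ?I by (rule fam.sum_image_submodule)
  have coset: "pure W (e t) w \<in> ?S" if "w \<in> carrier W" for w
  proof -
    obtain v where v: "v \<in> carrier V" "w = q v" using q(2) \<open>w \<in> carrier W\<close> by auto
    \<comment> \<open>The scalars \<open>x i\<close> are absorbed into the arguments, the
      \<open>f i\<close> being \<open>A\<close>-linear.\<close>
    have "pure W (e t) w = (\<Oplus>\<^bsub>?I\<^esub>i\<in>{..<n}. f i (smon (x i) \<one>\<^bsub>G\<^esub> \<odot>\<^bsub>V\<^esub> v))"
      unfolding v(2) hv[OF v(1)] using x v(1) lmh_closed[OF f]
      by (intro I.M.finsum_cong') (auto simp: lmh_smult[OF f] simp del: tp.ind_simps)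
    then show ?thesis unfolding sum_image_def using x v(1)
      by (auto intro!: exI[of _ "\<lambda>i. smon (x i) \<one>\<^bsub>G\<^esub> \<odot>\<^bsub>V\<^esub> v"])
  qed
  have "p \<in> ?S" if "p \<in> carrier ?I" for p
    using that
  proof (induction p rule: tp.tensor_induct)
    case zero
    then show ?case using S.one_closed by simp
  next
    case (diff p q)
    have "\<ominus>\<^bsub>?I\<^esub> q \<in> ?S" using S.m_inv_closed[OF diff(4)] by (simp add: a_inv_def)
    then show ?case using S.m_closed[OF diff(3)] by (simp add: a_minus_def)
  next
    case (pure a w)
    \<comment> \<open>\<open>e t\<close> is invertible in \<open>A\<close>, so t \<otimes> W
      generates the whole induced module.\<close>
    have "(a \<otimes>\<^bsub>A\<^esub> e (inv\<^bsub>G\<^esub> t)) \<otimes>\<^bsub>A\<^esub> e t = a" using pure(1) tG by (simp add: AR.m_assoc e_inv)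
    then have "pure W a w = (a \<otimes>\<^bsub>A\<^esub> e (inv\<^bsub>G\<^esub> t)) \<odot>\<^bsub>?I\<^esub> pure W (e t) w"
      using pure by (subst tp.smult_hom(2)) simp_all
    then show ?case using S.smult_closed[OF _ coset[OF pure(2)]] pure(1) by simp
  qed
  then have im: "?S = carrier ?I" using S.subset by auto
  obtain J where J: "J \<subseteq> {..<n}" "left_module_iso A ?I (direct_sum J (\<lambda>_. V))"
    by (rule semisimple_decomposition[OF Im finite_lessThan V f im])
  obtain \<epsilon> where \<epsilon>: "bij_betw \<epsilon> J {..<card J}"
    using ex_bij_betw_finite_nat[OF finite_subset[OF J(1) finite_lessThan]] by (auto simp: atLeast0LessThan)
  have "left_module_iso A (direct_sum J (\<lambda>_. V)) (module_power V (card J))"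
    by (rule direct_sum_iso_reindex[OF Vm Vm \<epsilon> left_module_iso_refl])
  then show thesis using that left_module_iso_trans[OF J(2)] by blast
qed

text \<open>The classes of simple \<open>B\<close>-submodules of V, described without a chosen W;
  this set turns out to be the orbit attached to V.\<close>

definition under :: "('g \<Rightarrow> 'l, 'v, 'x) module_scheme \<Rightarrow> ('g \<Rightarrow> 'l, ('g \<Rightarrow> 'l) set) module set set" where
  "under V = {iso_class B W | W :: ('g \<Rightarrow> 'l, ('g \<Rightarrow> 'l) set) module. simple_left_module B W \<and> nonzero_hom B W V}"

lemma under_iff:
  fixes W :: "('g \<Rightarrow> 'l, ('g \<Rightarrow> 'l) set) module"
  assumes W: "simple_left_module B W" and V: "left_module A V"
  shows "iso_class B W \<in> under V \<longleftrightarrow> nonzero_hom B W V"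
proof
  assume "iso_class B W \<in> under V"
  then obtain W' :: "('g \<Rightarrow> 'l, ('g \<Rightarrow> 'l) set) module"
    where W': "iso_class B W = iso_class B W'" "simple_left_module B W'" "nonzero_hom B W' V"
    by (auto simp: under_def)
  note Wm = simple_left_moduleD(1)[OF W] and Wm' = simple_left_moduleD(1)[OF W'(2)]
  show "nonzero_hom B W V"
    by (rule nonzero_hom_iso[OF Wm' Wm A_module_B[OF V] iso_class_eqD[OF Wm W'(1)] W'(3)])
next
  assume "nonzero_hom B W V"
  then show "iso_class B W \<in> under V" using W by (auto simp: under_def)
qed

lemma under_mono:
  assumes V: "left_module A V" and V': "left_module A V'" and iso: "left_module_iso A V V'"
  shows "under V \<subseteq> under V'"
proof
  fix C assume "C \<in> under V"
  then obtain W :: "('g \<Rightarrow> 'l, ('g \<Rightarrow> 'l) set) module"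
    where W: "C = iso_class B W" "simple_left_module B W" "nonzero_hom B W V" by (auto simp: under_def)
  have "nonzero_hom B W V'"
    by (rule nonzero_hom_iso_right[OF simple_left_moduleD(1)[OF W(2)] A_module_B[OF V] A_module_B[OF V']
      iso_A_B[OF iso] W(3)])
  then show "C \<in> under V'" using W by (auto simp: under_def)
qed

lemma under_cong:
  assumes V: "left_module A V" and V': "left_module A V'" and iso: "left_module_iso A V V'"
  shows "under V = under V'"
  using under_mono[OF V V' iso] under_mono[OF V' V left_module_iso_sym[OF V V' iso]] by (rule subset_antisym)

lemma under_nonempty:
  assumes V: "simple_left_module A V"
  shows "under V \<noteq> {}"
proof -
  obtain W :: "('g \<Rightarrow> 'l, ('g \<Rightarrow> 'l) set) module" where W: "simple_left_module B W" "nonzero_hom B W V"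
    by (rule simple_submodule_restriction[OF V])
  then have "iso_class B W \<in> under V" by (auto simp: under_def)
  then show ?thesis by blast
qed

text \<open>A single common constituent W decides, by uniqueness of the simple
  \<open>A\<close>-module above W.\<close>

lemma under_inj:
  assumes V: "simple_left_module A V" and V': "simple_left_module A V'" and eq: "under V = under V'"
  shows "left_module_iso A V V'"
proof -
  obtain W :: "('g \<Rightarrow> 'l, ('g \<Rightarrow> 'l) set) module" where W: "simple_left_module B W" "nonzero_hom B W V"
    by (rule simple_submodule_restriction[OF V])
  then have "nonzero_hom B W V'"
    using under_iff[OF W(1) simple_left_moduleD(1)[OF V]] under_iff[OF W(1) simple_left_moduleD(1)[OF V']] eq by simp
  then show ?thesis by (rule simple_over_unique[OF W(1) V W(2) V'])
qed

text \<open>All the sets united in \<open>gal_action\<close> coincide: the conjugate module is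
  isomorphic to the twist, whose class depends only on the class of the module and on the
  automorphism.\<close>

lemma gal_action_class:
  fixes W :: "('g \<Rightarrow> 'l, ('g \<Rightarrow> 'l) set) module"
  assumes W: "simple_left_module B W" and g: "g \<in> carrier G"
  shows "gal_action L G \<phi> H (\<phi> g) (iso_class B W) = iso_class B (twist g W)"
proof -
  note Wm = simple_left_moduleD(1)[OF W]
  have in_sim: "iso_class B W \<in> sim B" using W by (auto simp: sim_def)
  have eq: "iso_class B (conjugate_module L G \<phi> H h W') = iso_class B (twist g W)"
    if h: "h \<in> carrier G" "\<phi> h = \<phi> g" and W': "W' \<in> iso_class B W" for h W'
  proof -
    have W'm: "left_module B W'" and iso: "left_module_iso B W' W" using W' by (auto simp: iso_class_def)
    have "iso_class B (conjugate_module L G \<phi> H h W') = iso_class B (twist h W')"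
      by (rule iso_class_eqI[OF twist_left_module[OF h(1) W'm] conjugate_module_twist[OF W'm h(1)], symmetric])
    also have "\<dots> = iso_class B (twist h W)"
      by (rule iso_class_eqI[OF twist_left_module[OF h(1) W'm] twist_left_module[OF h(1) Wm] twist_iso[OF h(1) iso]])
    also have "\<dots> = iso_class B (twist g W)"
      by (rule iso_class_eqI[OF twist_left_module[OF h(1) Wm] twist_left_module[OF g Wm] twist_cong[OF h(1) g h(2) Wm]])
    finally show ?thesis .
  qed
  have self: "W \<in> iso_class B W" using Wm by (auto simp: iso_class_def intro: left_module_iso_refl)
  have "{iso_class B (conjugate_module L G \<phi> H h W') | h W'. h \<in> carrier G \<and> \<phi> h = \<phi> g \<and> W' \<in> iso_class B W}
      = {iso_class B (twist g W)}" (is "?C = _")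
  proof (intro subset_antisym subsetI)
    fix C assume "C \<in> ?C"
    then show "C \<in> {iso_class B (twist g W)}" using eq by blast
  next
    fix C assume "C \<in> {iso_class B (twist g W)}"
    then have "C = iso_class B (conjugate_module L G \<phi> H g W)" using eq[OF g refl self] by simp
    then show "C \<in> ?C" using g self by blast
  qed
  then show ?thesis using in_sim by (simp add: gal_action_def)
qed

abbreviation "act_orbits \<equiv> orbits (Gal L K) (sim B) (gal_action L G \<phi> H)"

text \<open>The elements of \<open>Gal L K\<close> are the \<phi> g, so the orbit consists of the
  classes of twists of W. These are exactly the simple modules below V: by invariance of
  restrictions in one direction, by the decomposition of V in the other.\<close>

lemma orbit_eq_under:
  fixes W :: "('g \<Rightarrow> 'l, ('g \<Rightarrow> 'l) set) module"
  assumes W: "simple_left_module B W" and V: "simple_left_module A V" and nz: "nonzero_hom B W V"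
  shows "orbit (Gal L K) (gal_action L G \<phi> H) (iso_class B W) = under V"
proof -
  note Wm = simple_left_moduleD(1)[OF W] and Vm = simple_left_moduleD(1)[OF V]
  have "orbit (Gal L K) (gal_action L G \<phi> H) (iso_class B W) = {iso_class B (twist g W) | g. g \<in> carrier G}"
    unfolding orbit_def using Gal_iff gal_action_class[OF W] by force
  also have "\<dots> = under V"
  proof (intro subset_antisym subsetI)
    fix C assume "C \<in> {iso_class B (twist g W) | g. g \<in> carrier G}"
    then obtain g where "g \<in> carrier G" "C = iso_class B (twist g W)" by blast
    then show "C \<in> under V" using twist_simple[OF _ W] twist_nonzero_hom[OF Wm Vm nz] by (auto simp: under_def)
  next
    fix C assume "C \<in> under V"
    then obtain W' :: "('g \<Rightarrow> 'l, ('g \<Rightarrow> 'l) set) module"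
      where W': "C = iso_class B W'" "simple_left_module B W'" "nonzero_hom B W' V" by (auto simp: under_def)
    obtain t where t: "t \<in> T" "left_module_iso B W' (twist t W)"
      by (rule simple_under_conjugate[OF W V nz W'(2,3)])
    have "C = iso_class B (twist t W)"
      unfolding W'(1)
      by (rule iso_class_eqI[OF simple_left_moduleD(1)[OF W'(2)] twist_left_module[OF T_carrier[OF t(1)] Wm] t(2)])
    then show "C \<in> {iso_class B (twist g W) | g. g \<in> carrier G}" using T_carrier[OF t(1)] by blast
  qed
  finally show ?thesis .
qed

lemma act_orbits_eq:
  "act_orbits = {under V | V :: ('g \<Rightarrow> 'l, ('g \<Rightarrow> 'l) set) module. simple_left_module A V}"
proof (intro subset_antisym subsetI)
  fix Q assume "Q \<in> act_orbits"
  then obtain W :: "('g \<Rightarrow> 'l, ('g \<Rightarrow> 'l) set) module" where W: "simple_left_module B W"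
    and Q: "Q = orbit (Gal L K) (gal_action L G \<phi> H) (iso_class B W)"
    by (auto simp: orbits_def sim_def)
  obtain V :: "('g \<Rightarrow> 'l, ('g \<Rightarrow> 'l) set) module" where V: "simple_left_module A V" "nonzero_hom B W V"
    by (rule simple_over_exists[OF W])
  then show "Q \<in> {under V | V :: ('g \<Rightarrow> 'l, ('g \<Rightarrow> 'l) set) module. simple_left_module A V}"
    using orbit_eq_under[OF W V] Q by blast
next
  fix Q assume "Q \<in> {under V | V :: ('g \<Rightarrow> 'l, ('g \<Rightarrow> 'l) set) module. simple_left_module A V}"
  then obtain V :: "('g \<Rightarrow> 'l, ('g \<Rightarrow> 'l) set) module" where V: "simple_left_module A V" "Q = under V" by blast
  obtain W :: "('g \<Rightarrow> 'l, ('g \<Rightarrow> 'l) set) module" where W: "simple_left_module B W" "nonzero_hom B W V"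
    by (rule simple_submodule_restriction[OF V(1)])
  have "iso_class B W \<in> sim B" using W(1) by (auto simp: sim_def)
  then show "Q \<in> act_orbits"
    using orbit_eq_under[OF W(1) V(1) W(2)] V(2) by (auto simp: orbits_def)
qed

text \<open>The map inverts V \<mapsto> \<open>under V\<close>. It chooses a module V, but the class
  of V does not depend on the choice because \<open>under V\<close> determines V up to
  isomorphism.\<close>

lemma orbit_correspondence:
  obtains F where "bij_betw F act_orbits (sim A)"
    "\<And>V :: ('g \<Rightarrow> 'l, ('g \<Rightarrow> 'l) set) module. simple_left_module A V \<Longrightarrow> F (under V) = iso_class A V"
proof -
  define F where "F = (\<lambda>Q. SOME D. \<exists>V :: ('g \<Rightarrow> 'l, ('g \<Rightarrow> 'l) set) module.
    simple_left_module A V \<and> Q = under V \<and> D = iso_class A V)"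
  have F: "F (under V) = iso_class A V" if V: "simple_left_module A V"
    for V :: "('g \<Rightarrow> 'l, ('g \<Rightarrow> 'l) set) module"
  proof -
    have "\<exists>V' :: ('g \<Rightarrow> 'l, ('g \<Rightarrow> 'l) set) module.
        simple_left_module A V' \<and> under V = under V' \<and> F (under V) = iso_class A V'"
      unfolding F_def by (rule someI[of _ "iso_class A V"]) (use V in blast)
    then obtain V' :: "('g \<Rightarrow> 'l, ('g \<Rightarrow> 'l) set) module"
      where V': "simple_left_module A V'" "under V = under V'" "F (under V) = iso_class A V'" by blast
    have "iso_class A V = iso_class A V'"
      by (rule iso_class_eqI[OF simple_left_moduleD(1)[OF V] simple_left_moduleD(1)[OF V'(1)] under_inj[OF V V'(1,2)]])
    then show ?thesis using V'(3) by simp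
  qed
  have "inj_on F act_orbits"
  proof (rule inj_onI)
    fix P Q assume PQ: "P \<in> act_orbits" "Q \<in> act_orbits" "F P = F Q"
    obtain V V' :: "('g \<Rightarrow> 'l, ('g \<Rightarrow> 'l) set) module" where V: "simple_left_module A V" "P = under V"
      and V': "simple_left_module A V'" "Q = under V'" using PQ(1,2) unfolding act_orbits_eq by blast
    note Vm = simple_left_moduleD(1)[OF V(1)] and Vm' = simple_left_moduleD(1)[OF V'(1)]
    have "iso_class A V = iso_class A V'" using PQ(3) V V' F by simp
    then have "left_module_iso A V V'" by (rule iso_class_eqD[OF Vm])
    then show "P = Q" using under_cong[OF Vm Vm'] V V' by simp
  qed
  moreover have "F ` act_orbits = sim A"
  proof (intro subset_antisym subsetI)
    fix D assume "D \<in> F ` act_orbits"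
    then obtain V :: "('g \<Rightarrow> 'l, ('g \<Rightarrow> 'l) set) module" where "simple_left_module A V" "D = F (under V)"
      unfolding act_orbits_eq by blast
    then show "D \<in> sim A" using F by (auto simp: sim_def)
  next
    fix D assume "D \<in> sim A"
    then obtain V :: "('g \<Rightarrow> 'l, ('g \<Rightarrow> 'l) set) module" where V: "simple_left_module A V" "D = iso_class A V"
      by (auto simp: sim_def)
    then have "under V \<in> act_orbits" unfolding act_orbits_eq by blast
    moreover have "D = F (under V)" using F V by simp
    ultimately show "D \<in> F ` act_orbits" by blast
  qed
  ultimately show thesis using that F by (auto simp: bij_betw_def)
qed

text \<open>\<open>J\<close> indexes the simple summands of V over \<open>B\<close>, each isomorphic
  to exactly one \<open>W j\<close>. The fibres of this labelling have a common size a, so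
  \<open>J\<close> has a t elements, and b counts the copies of V in Ind (W j). Counting the simple
  summands of Ind (W j) over \<open>B\<close> in two ways gives the identity.\<close>

lemma clifford_decomposition:
  fixes V :: "('g \<Rightarrow> 'l, 'v, 'x) module_scheme"
    and t :: nat and W :: "nat \<Rightarrow> ('g \<Rightarrow> 'l, ('g \<Rightarrow> 'l) set) module"
  assumes V: "simple_left_module A V" and W: "\<And>j. j \<in> {1..t} \<Longrightarrow> simple_left_module B (W j)"
    and inj: "inj_on (\<lambda>j. iso_class B (W j)) {1..t}"
    and orb: "(\<lambda>j. iso_class B (W j)) ` {1..t} = under V"
  obtains a b where "a \<ge> 1" "b \<ge> 1" "left_module_iso B V (module_power (direct_sum {1..t} W) a)"
    "\<And>j. j \<in> {1..t} \<Longrightarrow> left_module_iso A (Ind L G \<phi> H (W j)) (module_power V b)"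
    "t * a * b = card T"
proof -
  note Vm = simple_left_moduleD(1)[OF V] and Wm = simple_left_moduleD(1)[OF W]
  note VB = A_module_B[OF Vm]
  have nz: "nonzero_hom B (W j) V" if "j \<in> {1..t}" for j
    using under_iff[OF W[OF that] Vm] orb that by blast
  have "{1..t} \<noteq> {}" using under_nonempty[OF V] orb by blast
  then have one: "1 \<in> {1..t}" by auto
  have conv: "\<exists>j\<in>{1..t}. left_module_iso B (twist g (W i)) (W j)" if g: "g \<in> carrier G" and i: "i \<in> {1..t}" for g i
  proof -
    note tw = twist_simple[OF g W[OF i]]
    have "iso_class B (twist g (W i)) \<in> under V"
      using under_iff[OF tw Vm] twist_nonzero_hom[OF Wm[OF i] Vm nz[OF i] g] by simp
    then obtain j where "j \<in> {1..t}" "iso_class B (twist g (W i)) = iso_class B (W j)"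
      unfolding orb[symmetric] by blast
    then show ?thesis using iso_class_eqD[OF simple_left_moduleD(1)[OF tw]] by blast
  qed
  obtain J where J: "J \<subseteq> T" "left_module_iso B V (direct_sum J (\<lambda>t. twist t (W 1)))" "J \<noteq> {}"
    by (rule restriction_decomposition[OF W[OF one] V nz[OF one]])
  have finJ: "finite J" by (rule finite_subset[OF J(1) fin_T])
  have JG: "g \<in> carrier G" if "g \<in> J" for g using J(1) T_carrier that by auto
  obtain jj where jj: "\<And>g. g \<in> J \<Longrightarrow> jj g \<in> {1..t}"
    "\<And>g. g \<in> J \<Longrightarrow> left_module_iso B (twist g (W 1)) (W (jj g))"
    using conv[OF JG one] by metis
  have VJ: "left_module_iso B V (direct_sum J (\<lambda>g. W (jj g)))"
    by (rule left_module_iso_trans[OF J(2) direct_sum_iso_cong[OF twist_left_module[OF JG Wm[OF one]] Wm[OF jj(1)] jj(2)]])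
  have same: "i = j" if "i \<in> {1..t}" "j \<in> {1..t}" "left_module_iso B (W i) (W j)" for i j
    using inj_onD[OF inj _ that(1,2)] iso_class_eqI[OF Wm[OF that(1)] Wm[OF that(2)] that(3)] by simp
  define S where "S = (\<lambda>j. {g \<in> J. jj g = j})"
  \<comment> \<open>Twist by an element \<open>u\<close> that carries \<open>W i\<close> to
    \<open>W k\<close>. The restriction of V is unchanged, so uniqueness of the decomposition
    injects the summands of type i into those of type k; by symmetry all fibres have equal
    size.\<close>
  have le: "card (S i) \<le> card (S k)" if i: "i \<in> {1..t}" and k: "k \<in> {1..t}" for i k
  proof -
    obtain u where u: "u \<in> T" "left_module_iso B (W k) (twist u (W i))"
      by (rule simple_under_conjugate[OF W[OF i] V nz[OF i] W[OF k] nz[OF k]])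
    note uG = T_carrier[OF u(1)]
    have "left_module_iso B V (twist u V)"
      by (rule left_module_iso_sym[OF twist_left_module[OF uG VB] VB twist_restriction[OF Vm uG]])
    also have "left_module_iso B (twist u V) (twist u (direct_sum J (\<lambda>g. W (jj g))))"
      by (rule twist_iso[OF uG VJ])
    finally have Vu: "left_module_iso B V (direct_sum J (\<lambda>g. twist u (W (jj g))))"
      by (simp add: twist_direct_sum)
    obtain \<pi> where \<pi>: "inj_on \<pi> J" "\<pi> ` J \<subseteq> J"
      "\<And>g. g \<in> J \<Longrightarrow> left_module_iso B (twist u (W (jj g))) (W (jj (\<pi> g)))"
      by (rule decomposition_unique[OF VB finJ finJ twist_simple[OF uG W[OF jj(1)]] W[OF jj(1)] Vu VJ]) blast+
    have "\<pi> g \<in> S k" if g: "g \<in> S i" for g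
    proof -
      have gJ: "g \<in> J" "jj g = i" using g by (auto simp: S_def)
      have \<pi>J: "\<pi> g \<in> J" using \<pi>(2) gJ by auto
      have "left_module_iso B (W k) (W (jj (\<pi> g)))"
        using left_module_iso_trans[OF u(2)] \<pi>(3)[OF gJ(1)] gJ(2) by simp
      then have "k = jj (\<pi> g)" by (rule same[OF k jj(1)[OF \<pi>J]])
      then show ?thesis using \<pi>J by (simp add: S_def)
    qed
    moreover have "inj_on \<pi> (S i)" using \<pi>(1) by (rule inj_on_subset) (auto simp: S_def)
    ultimately show ?thesis using finJ by (intro card_inj_on_le[of \<pi>]) (auto simp: S_def)
  qed
  define a where "a = card (S 1)"
  have cS: "card (S j) = a" if "j \<in> {1..t}" for j
    using le[OF that one] le[OF one that] by (simp add: a_def)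
  obtain h where h: "bij_betw h J ({..<a} \<times> {1..t})" "\<forall>g\<in>J. snd (h g) = jj g"
    using ex_bij_betw_fibres[of J jj "{1..t}" a] finJ jj(1) cS unfolding S_def by blast
  have cJ: "card J = a * t" using bij_betw_same_card[OF h(1)] by (simp add: card_cartesian_product)
  then have pos: "a * t > 0" using J(3) finJ by (metis card_gt_0_iff)
  have pm: "left_module B (case p of (i, j) \<Rightarrow> W j)" if "p \<in> {..<a} \<times> {1..t}" for p using that Wm by auto
  have "left_module_iso B (direct_sum J (\<lambda>g. W (jj g))) (direct_sum ({..<a} \<times> {1..t}) (\<lambda>(i, j). W j))"
  proof (rule direct_sum_iso_reindex[OF Wm[OF jj(1)] pm h(1)])
    fix g assume "g \<in> J"
    then have "W (jj g) = (case h g of (i, j) \<Rightarrow> W j)" using h(2) by (auto split: prod.split)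
    then show "left_module_iso B (W (jj g)) (case h g of (i, j) \<Rightarrow> W j)" by (simp add: left_module_iso_refl)
  qed
  note V1 = left_module_iso_trans[OF VJ this]
  have dW: "left_module B (direct_sum {1..t} W)" by (rule direct_sum_left_module[OF B_ring Wm])
  have pW: "left_module B (module_power (direct_sum {1..t} W) a)" by (rule direct_sum_left_module[OF B_ring dW])
  have dP: "left_module B (direct_sum ({..<a} \<times> {1..t}) (\<lambda>(i, j). W j))" by (rule direct_sum_left_module[OF B_ring pm])
  have Res: "left_module_iso B V (module_power (direct_sum {1..t} W) a)"
    by (rule left_module_iso_trans[OF V1 left_module_iso_sym[OF pW dP direct_sum_Times_iso]])
  \<comment> \<open>Over \<open>B\<close>, the module Ind (W j) has one simple summand for each
    element of \<open>T\<close>, and also b copies of the \<open>a * t\<close> summands of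
    V.\<close>
  have count: "card T = b * (a * t)" if j: "j \<in> {1..t}" and b: "left_module_iso A (Ind L G \<phi> H (W j)) (module_power V b)" for j b
  proof -
    let ?I = "Ind L G \<phi> H (W j)"
    note IB = A_module_B[OF Ind_module[OF Wm[OF j]]]
    have dJ: "left_module B (direct_sum J (\<lambda>g. W (jj g)))" by (rule direct_sum_left_module[OF B_ring Wm[OF jj(1)]])
    have "left_module_iso B ?I (module_power V b)" by (rule iso_A_B[OF b])
    also have "left_module_iso B (module_power V b) (direct_sum {..<b} (\<lambda>_. direct_sum J (\<lambda>g. W (jj g))))"
      by (rule direct_sum_iso_cong[OF VB dJ VJ])
    also have "left_module_iso B \<dots> (direct_sum ({..<b} \<times> J) (\<lambda>(c, g). W (jj g)))"
      by (rule direct_sum_Times_iso)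
    finally have iso2: "left_module_iso B ?I (direct_sum ({..<b} \<times> J) (\<lambda>(c, g). W (jj g)))" .
    note iso1 = Ind_decomposition[OF Wm[OF j]]
    have s1: "simple_left_module B (twist s (W j))" if "s \<in> T" for s by (rule twist_simple[OF T_carrier[OF that] W[OF j]])
    have s2: "simple_left_module B (case p of (c, g) \<Rightarrow> W (jj g))" if "p \<in> {..<b} \<times> J" for p using that W jj(1) by auto
    have fin2: "finite ({..<b} \<times> J)" using finJ by simp
    have "card T \<le> card ({..<b} \<times> J)"
      by (rule decomposition_unique[OF IB fin_T fin2 s1 s2 iso1 iso2]) (use fin2 card_inj_on_le in blast)+
    moreover have "card ({..<b} \<times> J) \<le> card T"
      by (rule decomposition_unique[OF IB fin2 fin_T s2 s1 iso2 iso1]) (use fin_T card_inj_on_le in blast)+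
    ultimately show ?thesis using cJ by (simp add: card_cartesian_product)
  qed
  have cT: "card T > 0" using T_nonempty by (simp add: card_gt_0_iff)
  obtain b where b: "left_module_iso A (Ind L G \<phi> H (W 1)) (module_power V b)"
    by (rule Ind_power[OF W[OF one] V nz[OF one]])
  have Indj: "left_module_iso A (Ind L G \<phi> H (W j)) (module_power V b)" if j: "j \<in> {1..t}" for j
  proof -
    obtain b' where b': "left_module_iso A (Ind L G \<phi> H (W j)) (module_power V b')"
      by (rule Ind_power[OF W[OF j] V nz[OF j]])
    \<comment> \<open>The count leaves no freedom for the exponent, so the same \<open>b\<close>
      serves every \<open>j\<close>; \<open>a * t\<close> is positive as \<open>J\<close> is
      nonempty.\<close>
    have "b' * (a * t) = b * (a * t)" using count[OF j b'] count[OF one b] by (rule subst)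
    then show ?thesis using b' pos by simp
  qed
  show thesis
  proof (rule that[OF _ _ Res Indj])
    show "a \<ge> 1" using pos by simp
    show "b \<ge> 1" using count[OF one b] cT by (cases b) auto
    show "t * a * b = card T" using count[OF one b] by (simp add: mult.commute mult.left_commute)
  qed
qed

end

text \<open>A single bijection \<open>F\<close> is fixed before the enumerations, so the second half
  holds for every numbering of the orbits and all choices of representatives. Finiteness of
  \<open>sim LH\<close> is part of the conclusion so that such numberings exist.\<close>

theorem theorem0p12:
  fixes L :: "'l ring" and G :: "'g monoid" and \<phi> :: "'g \<Rightarrow> 'l \<Rightarrow> 'l"
    and K :: "'l set" and H :: "'g set" and LG LH :: "('g \<Rightarrow> 'l) ring"
  assumes "field L"
    and "group G"
    and "finite (carrier G)"
    and "group_action G (carrier L) \<phi>"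
    and "\<And>g. g \<in> carrier G \<Longrightarrow> \<phi> g \<in> ring_hom L L"
    and "K = fixed_field L G \<phi>"
    and "H = kernel G (Gal L K) \<phi>"
    and "LG = skew_group_ring L G \<phi>"
    and "LH = subgroup_ring L G \<phi> H"
  shows "finite (sim LH) \<and>
    (\<exists>F. bij_betw F (orbits (Gal L K) (sim LH) (gal_action L G \<phi> H)) (sim LG) \<and>
      (\<forall>(s :: nat) (t :: nat \<Rightarrow> nat)
         (W :: nat \<Rightarrow> nat \<Rightarrow> ('g \<Rightarrow> 'l, ('g \<Rightarrow> 'l) set) module)
         (V :: nat \<Rightarrow> ('g \<Rightarrow> 'l, ('g \<Rightarrow> 'l) set) module).
        (\<forall>i\<in>{1..s}. \<forall>j\<in>{1..t i}. simple_left_module LH (W i j)) \<and>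
        (\<forall>i\<in>{1..s}. inj_on (\<lambda>j. iso_class LH (W i j)) {1..t i}) \<and>
        bij_betw (\<lambda>i. (\<lambda>j. iso_class LH (W i j)) ` {1..t i}) {1..s}
          (orbits (Gal L K) (sim LH) (gal_action L G \<phi> H)) \<and>
        (\<forall>i\<in>{1..s}. simple_left_module LG (V i) \<and>
           F ((\<lambda>j. iso_class LH (W i j)) ` {1..t i}) = iso_class LG (V i))
        \<longrightarrow>
        (\<forall>i\<in>{1..s}. \<exists>a b :: nat. a \<ge> 1 \<and> b \<ge> 1 \<and>
           left_module_iso LH (V i) (module_power (direct_sum {1..t i} (W i)) a) \<and>
           (\<forall>j\<in>{1..t i}. left_module_iso LG (Ind L G \<phi> H (W i j)) (module_power (V i) b)) \<and>
           ring.dimension L (t i * a * b) K (carrier L))))"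
proof -
  interpret ga: galois_action L G \<phi>
    using assms(1-5) by (simp add: galois_action_def galois_action_axioms_def)
  note eqs = assms(6) assms(7)[unfolded assms(6)] assms(8) assms(9)[unfolded assms(7) assms(6)]
  obtain F where F: "bij_betw F ga.act_orbits (sim ga.A)"
    and Fu: "\<And>V :: ('g \<Rightarrow> 'l, ('g \<Rightarrow> 'l) set) module. simple_left_module ga.A V \<Longrightarrow> F (ga.under V) = iso_class ga.A V"
    by (rule ga.orbit_correspondence) (rule that)
  show ?thesis
    unfolding eqs
  proof (intro conjI exI[of _ F] allI impI ballI ga.finite_sim_B F)
    fix s :: nat and t :: "nat \<Rightarrow> nat" and W :: "nat \<Rightarrow> nat \<Rightarrow> ('g \<Rightarrow> 'l, ('g \<Rightarrow> 'l) set) module"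
      and V :: "nat \<Rightarrow> ('g \<Rightarrow> 'l, ('g \<Rightarrow> 'l) set) module" and i :: nat
    let ?O = "\<lambda>i. (\<lambda>j. iso_class ga.B (W i j)) ` {1..t i}"
    assume hyp: "(\<forall>i\<in>{1..s}. \<forall>j\<in>{1..t i}. simple_left_module ga.B (W i j)) \<and>
        (\<forall>i\<in>{1..s}. inj_on (\<lambda>j. iso_class ga.B (W i j)) {1..t i}) \<and>
        bij_betw ?O {1..s} ga.act_orbits \<and>
        (\<forall>i\<in>{1..s}. simple_left_module ga.A (V i) \<and> F (?O i) = iso_class ga.A (V i))"
      and i: "i \<in> {1..s}"
    have W: "simple_left_module ga.B (W i j)" if "j \<in> {1..t i}" for j using hyp i that by blast
    have inj: "inj_on (\<lambda>j. iso_class ga.B (W i j)) {1..t i}" using hyp i by blast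
    have V: "simple_left_module ga.A (V i)" and FO: "F (?O i) = iso_class ga.A (V i)" using hyp i by blast+
    have O: "?O i \<in> ga.act_orbits" using hyp i bij_betw_apply by fast
    have "ga.under (V i) \<in> ga.act_orbits" unfolding ga.act_orbits_eq using V by blast
    \<comment> \<open>Both orbits are sent by \<open>F\<close> to the class of \<open>V i\<close>,
      and \<open>F\<close> is injective on orbits.\<close>
    then have "?O i = ga.under (V i)"
      using inj_onD[OF bij_betw_imp_inj_on[OF F] _ O] FO Fu[OF V] by simp
    then obtain a b where ab: "a \<ge> 1" "b \<ge> 1"
      "left_module_iso ga.B (V i) (module_power (direct_sum {1..t i} (W i)) a)"
      "\<And>j. j \<in> {1..t i} \<Longrightarrow> left_module_iso ga.A (Ind L G \<phi> ga.H (W i j)) (module_power (V i) b)"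
      "t i * a * b = card ga.T"
      using ga.clifford_decomposition[OF V W inj] by blast
    show "\<exists>a b :: nat. a \<ge> 1 \<and> b \<ge> 1 \<and>
           left_module_iso ga.B (V i) (module_power (direct_sum {1..t i} (W i)) a) \<and>
           (\<forall>j\<in>{1..t i}. left_module_iso ga.A (Ind L G \<phi> ga.H (W i j)) (module_power (V i) b)) \<and>
           ring.dimension L (t i * a * b) ga.K (carrier L)"
      using ab ga.dimension_over_K by (intro exI[of _ a] exI[of _ b]) simp
  qed
qed

end
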